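(* Let $\{\lambda,\alpha,\beta\}$ be singular Björling data on an interval $I$, let $X=X_{\lambda,\alpha,\beta}$ be the solution of the singular Björling problem, a maxface on a neighborhood of the trace of $\lambda$, and let $t\in I$. Then $X$ has a swallowtail at $\lambda(t)$ if and only if the following hold at $t$: (1) $\alpha_3'\lambda_1'+\beta_3\lambda_2'=0$; (2) $\lambda_1''\alpha_3'+\lambda_1'\alpha_3''+\lambda_2'\beta_3'+\lambda_2''\beta_3\neq0$; (3) $\alpha_1'\alpha_2''-\alpha_2'\alpha_1''\neq0$ when $\alpha'(t)\ne0$, and $\beta_1\beta_2'-\beta_2\beta_1'\ne0$ when $\beta(t)\neq0$.
   Context: $\mathbb E_1^3$ is $\mathbb R^3$ with $\langle (a_1,b_1,c_1),(a_2,b_2,c_2)\rangle=a_1a_2+b_1b_2-c_1c_2$; $\mathbb C$ is identified with $\mathbb R^2$. Maxface: a map $X:\Omega\to\mathbb E_1^3$ on a domain $\Omega\subset\mathbb C$ is a maxface if there are a meromorphic function $g$ (the Gauss map) and a holomorphic 1-form $f\,dz$ on $\Omega$ such that $(1+|g|^2)^2|f|^2|dz|^2$ is a positive definite Riemannian metric on $\Omega$, $|g|$ is not identically $1$, the form $\Phi=\left(\tfrac12(1+g^2),\tfrac i2(1-g^2),-g\right)f\,dz$ satisfies $\mathrm{Re}\int_\gamma\Phi=0$ for all loops $\gamma$ in $\Omega$, and $X(p)=\mathrm{Re}\int_o^p\Phi$ up to translation. Swallowtail: $X$ has a swallowtail at $p$ if there are a local diffeomorphism $\eta$ of $\mathbb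 R^2$ with $\eta(p)=(0,0)$ and a local diffeomorphism $\Psi$ of $\mathbb R^3$ with $\Psi(X(p))=(0,0,0)$ such that $\Psi\circ X\circ\eta^{-1}=f_{sw}$ near $(0,0)$, where $f_{sw}(u,v)=(3u^4+u^2v,\,4u^3+2uv,\,v)$. Singular Björling data: a triplet $\{\lambda,\alpha,\beta\}$ such that (1) $\lambda=(\lambda_1,\lambda_2):I\to\mathbb C$ is a smooth curve on an interval $I$ with $\lambda'(t)\ne0$ for all $t$; (2) $\alpha=(\alpha_1,\alpha_2,\alpha_3):I\to\mathbb E_1^3$ is a null curve ($\langle\alpha',\alpha'\rangle=0$) and $\beta=(\beta_1,\beta_2,\beta_3):I\to\mathbb E_1^3$ is a null vector field ($\langle\beta,\beta\rangle=0$) with $\langle\alpha'(t),\beta(t)\rangle=0$ for all $t$, and for each $t\in I$ at least one of $\alpha'(t),\beta(t)$ is nonzero; (3) the map $\phi(\lambda(t))=\alpha'(t)-i\beta(t)$ has an analytic extension $\phi(z)=(\phi_1,\phi_2,\phi_3)(z)$ to a neighborhood of the trace of $\lambda$; (4) the function on the trace of $\lambda$ given by $G(t)=\frac{\alpha_1'(t)+i\alpha_2'(t)}{\alpha_3'(t)}$ if $\alpha'(t)\neq0$ and $G(t)=\frac{\beta_1(t)+i\beta_2(t)}{\beta_3(t)}$ if $\beta_3(t)\ne0$ has an analytic extension whose modulus is not identically $1$. Solution of the singular Björling problem: it is assumed that $\mathrm{Re}\int_\gamma\phi(z)\,dz=0$ for all loops $\gamma$ in a neighborhood $\Omega$ of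 the trace of $\lambda$; the solution is $X_{\lambda,\alpha,\beta}(z)=\mathrm{Re}\int_{\lambda(t_0)}^z\phi(w)\,dw$, $z\in\Omega$, for a fixed $t_0\in I$. It is a maxface on a sufficiently small neighborhood of the trace of $\lambda$, and the trace of $\lambda$ consists of singular points (points where $X$ is not an immersion). *)

theory Defs
  imports "HOL-Complex_Analysis.Complex_Analysis"
begin

section \<open>Smooth curves, smooth maps, diffeomorphisms\<close>

text \<open>Derivatives of curves are taken within the interval, so they are one-sided at
  an end point that belongs to the interval.\<close>

definition curve_deriv :: "real set \<Rightarrow> (real \<Rightarrow> 'a::real_normed_vector) \<Rightarrow> real \<Rightarrow> 'a" where
  "curve_deriv I c t = vector_derivative c (at t within I)"

definition smooth_curve_on :: "real set \<Rightarrow> (real \<Rightarrow> 'a::real_normed_vector) \<Rightarrow> bool" where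
  "smooth_curve_on I c \<longleftrightarrow>
     (\<forall>k. \<forall>t\<in>I. (curve_deriv I ^^ k) c differentiable (at t within I))"

text \<open>\<open>Ck_on k U f\<close> is meant for open \<open>U\<close>; \<open>f\<close> is \<open>C\<^sup>k\<^sup>+\<^sup>1\<close> iff it is
  differentiable and all its directional derivatives are \<open>C\<^sup>k\<close>.\<close>

primrec Ck_on :: "nat \<Rightarrow> 'a::euclidean_space set \<Rightarrow> ('a \<Rightarrow> 'b::euclidean_space) \<Rightarrow> bool" where
  "Ck_on 0 U f \<longleftrightarrow> continuous_on U f"
| "Ck_on (Suc k) U f \<longleftrightarrow>
     f differentiable_on U \<and> (\<forall>v. Ck_on k U (\<lambda>x. frechet_derivative f (at x) v))"

definition Cinf_on :: "'a::euclidean_space set \<Rightarrow> ('a \<Rightarrow> 'b::euclidean_space) \<Rightarrow> bool" where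
  "Cinf_on U f \<longleftrightarrow> (\<forall>k. Ck_on k U f)"

definition diffeomorphism ::
  "'a::euclidean_space set \<Rightarrow> 'b::euclidean_space set \<Rightarrow> ('a \<Rightarrow> 'b) \<Rightarrow> ('b \<Rightarrow> 'a) \<Rightarrow> bool" where
  "diffeomorphism U V f f' \<longleftrightarrow>
     open U \<and> open V \<and> homeomorphism U V f f' \<and> Cinf_on U f \<and> Cinf_on V f'"


section \<open>Swallowtails\<close>

definition f_sw :: "real ^ 2 \<Rightarrow> real ^ 3" where
  "f_sw w = (let u = w $ 1; v = w $ 2 in
     vector [3 * u ^ 4 + u ^ 2 * v, 4 * u ^ 3 + 2 * u * v, v])"

text \<open>Here \<open>\<eta>'\<close> is the inverse of \<open>\<eta>\<close>; the domain of \<open>X\<close> is a subset of the complex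
  plane, which is the Euclidean plane as a real vector space.\<close>

definition has_swallowtail :: "(complex \<Rightarrow> real ^ 3) \<Rightarrow> complex \<Rightarrow> bool" where
  "has_swallowtail X p \<longleftrightarrow>
     (\<exists>U V (\<eta> :: complex \<Rightarrow> real ^ 2) \<eta>' A B (\<Psi> :: real ^ 3 \<Rightarrow> real ^ 3) \<Psi>'.
        diffeomorphism U V \<eta> \<eta>' \<and> p \<in> U \<and> \<eta> p = 0 \<and>
        diffeomorphism A B \<Psi> \<Psi>' \<and> X p \<in> A \<and> \<Psi> (X p) = 0 \<and>
        (\<forall>\<^sub>F w in nhds 0. X (\<eta>' w) \<in> A \<and> (\<Psi> \<circ> X \<circ> \<eta>') w = f_sw w))"


section \<open>Real parts of integrals of holomorphic vector-valued 1-forms\<close>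

definition Re_integral :: "(complex \<Rightarrow> complex ^ 3) \<Rightarrow> (real \<Rightarrow> complex) \<Rightarrow> real ^ 3" where
  "Re_integral \<phi> \<gamma> = (\<chi> j. Re (contour_integral \<gamma> (\<lambda>w. \<phi> w $ j)))"

definition no_real_periods :: "complex set \<Rightarrow> (complex \<Rightarrow> complex ^ 3) \<Rightarrow> bool" where
  "no_real_periods U \<phi> \<longleftrightarrow>
     (\<forall>\<gamma>. valid_path \<gamma> \<and> path_image \<gamma> \<subseteq> U \<and> pathfinish \<gamma> = pathstart \<gamma> \<longrightarrow> Re_integral \<phi> \<gamma> = 0)"

text \<open>\<open>X(z) = Re \<integral>\<^sub>p\<^sup>z \<phi>\<close> for \<open>z \<in> U\<close>, the integral being taken along any path in \<open>U\<close>.\<close>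

definition is_Re_integral_from ::
  "complex set \<Rightarrow> (complex \<Rightarrow> complex ^ 3) \<Rightarrow> complex \<Rightarrow> (complex \<Rightarrow> real ^ 3) \<Rightarrow> bool" where
  "is_Re_integral_from U \<phi> p X \<longleftrightarrow>
     (\<forall>\<gamma>. valid_path \<gamma> \<and> path_image \<gamma> \<subseteq> U \<and> pathstart \<gamma> = p \<longrightarrow>
          X (pathfinish \<gamma>) = Re_integral \<phi> \<gamma>)"


section \<open>Maxfaces\<close>

text \<open>At a pole of \<open>g\<close> the coefficients of \<open>\<Phi>\<close> are given by continuous extension,
  which is what \<^const>\<open>remove_sings\<close> does; elsewhere \<^const>\<open>remove_sings\<close> has no effect.\<close>

definition maxface_form ::
  "(complex \<Rightarrow> complex) \<Rightarrow> (complex \<Rightarrow> complex) \<Rightarrow> complex \<Rightarrow> complex ^ 3" where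
  "maxface_form g f z = vector
     [remove_sings (\<lambda>w. 1 / 2 * (1 + (g w)\<^sup>2) * f w) z,
      remove_sings (\<lambda>w. \<i> / 2 * (1 - (g w)\<^sup>2) * f w) z,
      remove_sings (\<lambda>w. - g w * f w) z]"

text \<open>The metric is positive definite iff its conformal factor is finite and positive,
  where at poles of \<open>g\<close> the factor is again understood as a limit.\<close>

definition maxface_on :: "complex set \<Rightarrow> (complex \<Rightarrow> real ^ 3) \<Rightarrow> bool" where
  "maxface_on U X \<longleftrightarrow> open U \<and> connected U \<and>
     (\<exists>g f. g nicely_meromorphic_on U \<and> f holomorphic_on U \<and>
        (\<forall>z\<in>U. \<exists>c>0. ((\<lambda>w. (1 + (cmod (g w))\<^sup>2)\<^sup>2 * (cmod (f w))\<^sup>2) \<longlongrightarrow> c) (at z)) \<and>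
        \<not> (\<forall>z\<in>U. cmod (g z) = 1) \<and>
        no_real_periods U (maxface_form g f) \<and>
        (\<exists>p\<in>U. \<exists>b. is_Re_integral_from U (maxface_form g f) p (\<lambda>z. X z - b)))"


section \<open>Singular Bjoerling data\<close>

definition minkowski :: "real ^ 3 \<Rightarrow> real ^ 3 \<Rightarrow> real" where
  "minkowski x y = x $ 1 * y $ 1 + x $ 2 * y $ 2 - x $ 3 * y $ 3"

definition bjorling_extension ::
  "real set \<Rightarrow> (real \<Rightarrow> complex) \<Rightarrow> (real \<Rightarrow> real ^ 3) \<Rightarrow> (real \<Rightarrow> real ^ 3) \<Rightarrow>
   complex set \<Rightarrow> (complex \<Rightarrow> complex ^ 3) \<Rightarrow> bool" where
  "bjorling_extension I lam \<alpha> \<beta> \<Omega> \<phi> \<longleftrightarrow>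
     open \<Omega> \<and> connected \<Omega> \<and> lam ` I \<subseteq> \<Omega> \<and> (\<forall>j. (\<lambda>z. \<phi> z $ j) holomorphic_on \<Omega>) \<and>
     (\<forall>t\<in>I. \<forall>j. \<phi> (lam t) $ j
        = complex_of_real (curve_deriv I \<alpha> t $ j) - \<i> * complex_of_real (\<beta> t $ j))"

text \<open>If both \<open>\<alpha>'(t)\<close> and \<open>\<beta>(t)\<close> are nonzero, they are parallel (orthogonal null vectors),
  so the two prescriptions for \<open>G\<close> agree; a null vector vanishes iff its third component does.\<close>

definition gauss_extension ::
  "real set \<Rightarrow> (real \<Rightarrow> complex) \<Rightarrow> (real \<Rightarrow> real ^ 3) \<Rightarrow> (real \<Rightarrow> real ^ 3) \<Rightarrow>
   complex set \<Rightarrow> (complex \<Rightarrow> complex) \<Rightarrow> bool" where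
  "gauss_extension I lam \<alpha> \<beta> U G \<longleftrightarrow>
     open U \<and> connected U \<and> lam ` I \<subseteq> U \<and> G holomorphic_on U \<and>
     (\<forall>t\<in>I. let a = curve_deriv I \<alpha> t; b = \<beta> t in
        (a \<noteq> 0 \<longrightarrow> G (lam t) = Complex (a $ 1) (a $ 2) / complex_of_real (a $ 3)) \<and>
        (b $ 3 \<noteq> 0 \<longrightarrow> G (lam t) = Complex (b $ 1) (b $ 2) / complex_of_real (b $ 3)))"

definition singular_bjorling_data ::
  "real set \<Rightarrow> (real \<Rightarrow> complex) \<Rightarrow> (real \<Rightarrow> real ^ 3) \<Rightarrow> (real \<Rightarrow> real ^ 3) \<Rightarrow> bool" where
  "singular_bjorling_data I lam \<alpha> \<beta> \<longleftrightarrow>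
     is_interval I \<and> interior I \<noteq> {} \<and>
     smooth_curve_on I lam \<and> (\<forall>t\<in>I. curve_deriv I lam t \<noteq> 0) \<and>
     smooth_curve_on I \<alpha> \<and> smooth_curve_on I \<beta> \<and>
     (\<forall>t\<in>I. minkowski (curve_deriv I \<alpha> t) (curve_deriv I \<alpha> t) = 0 \<and>
            minkowski (\<beta> t) (\<beta> t) = 0 \<and>
            minkowski (curve_deriv I \<alpha> t) (\<beta> t) = 0 \<and>
            (curve_deriv I \<alpha> t \<noteq> 0 \<or> \<beta> t \<noteq> 0)) \<and>
     (\<exists>\<Omega> \<phi>. bjorling_extension I lam \<alpha> \<beta> \<Omega> \<phi>) \<and>
     (\<exists>U G. gauss_extension I lam \<alpha> \<beta> U G \<and> \<not> (\<forall>z\<in>U. cmod (G z) = 1))"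

text \<open>The data determine \<open>\<phi>\<close> on the connected set \<open>\<Omega>\<close>, hence also \<open>X\<close> there.\<close>

definition bjorling_solution ::
  "real set \<Rightarrow> (real \<Rightarrow> complex) \<Rightarrow> (real \<Rightarrow> real ^ 3) \<Rightarrow> (real \<Rightarrow> real ^ 3) \<Rightarrow>
   complex set \<Rightarrow> (complex \<Rightarrow> complex ^ 3) \<Rightarrow> real \<Rightarrow> (complex \<Rightarrow> real ^ 3) \<Rightarrow> bool" where
  "bjorling_solution I lam \<alpha> \<beta> \<Omega> \<phi> t0 X \<longleftrightarrow>
     bjorling_extension I lam \<alpha> \<beta> \<Omega> \<phi> \<and> no_real_periods \<Omega> \<phi> \<and>
     t0 \<in> I \<and> is_Re_integral_from \<Omega> \<phi> (lam t0) X"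

end

theory Submission
  imports Defs
begin

text \<open>
  Near \<open>p = lam t\<close> put \<open>n\<^sub>j = \<phi>\<^sub>j / \<phi>\<^sub>3\<close> for \<open>j = 1, 2\<close>. Then \<open>n\<^sub>1\<^sup>2 + n\<^sub>2\<^sup>2 = 1\<close>, the \<open>n\<^sub>j\<close> are real on the
  trace of \<open>lam\<close>, and \<open>(X \<circ> lam)' = Re (\<phi>\<^sub>3(lam) lam') (n\<^sub>1, n\<^sub>2, 1)\<close>. The three conditions say that
  \<open>Re (\<phi>\<^sub>3(lam) lam')\<close> has a simple zero at \<open>t\<close> and that \<open>n\<close> has nonzero velocity along \<open>lam\<close>.

  Necessity uses only first derivatives of the diffeomorphisms. They map \<open>lam\<close> into the singular
  curve \<open>v = -6u\<^sup>2\<close> of the standard swallowtail, on which \<open>f_sw\<close> has vanishing velocity and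
  nonvanishing acceleration at the origin; and the least stretching factor of the differential of
  \<open>f_sw\<close> at \<open>(0, v)\<close> is of exact order \<open>v\<close>, whereas for \<open>X\<close> it would be of order \<open>o(v)\<close> if \<open>n' = 0\<close>.

  For sufficiency take \<open>\<xi> = \<integral> \<phi>\<^sub>3\<close> as complex coordinate, so that \<open>X\<^sub>3 = Re \<xi>\<close>. The section of the surface
  by \<open>X\<^sub>3 = c\<close> is the curve \<open>t \<mapsto> X (c + it)\<close>, whose normal is \<open>(Re n\<^sub>1, Re n\<^sub>2)\<close> because
  \<open>Re n \<bullet> Im n = 0\<close>. Hence \<open>F t Y = Re n \<bullet> (Y - X)\<close> at \<open>Y\<^sub>3 + it\<close> generates \<open>X\<close>: both \<open>F\<close> and its
  \<open>t\<close>-derivative vanish at \<open>Y = X (Y\<^sub>3 + it)\<close>. The conditions make \<open>F t 0\<close> vanish to order exactly four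
  and the 2-jets of the \<open>Y\<close>-derivatives of \<open>F\<close> independent. As \<open>F\<close> is holomorphic in \<open>t\<close>, the power sums of its
  four small roots are smooth in \<open>Y\<close>, and they turn \<open>F\<close> into a monic quartic, without cubic term after
  translating \<open>t\<close>. Its three coefficients are local coordinates of \<open>Y\<close>, and the quartics with a double
  root are parametrised by \<open>f_sw\<close>.\<close>

text \<open>In the coordinate \<open>\<xi>\<close> the differential of \<open>X\<close> at a point
  of the trace has the imaginary axis as its kernel, and the trace becomes a curve with velocity
  \<open>\<phi>\<^sub>3(lam) lam'\<close>. The first two conditions therefore say that the singular
  curve has a simple tangency with the null direction at \<open>t\<close>. A swallowtail asks for
  two diffeomorphisms, so a computation of jets does not settle sufficiency: a normal form has to be
  produced. For a smooth family of functions with a zero of order four this is the business of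
  Malgrange's preparation theorem. A maxface is analytic, so contour integrals over a fixed circle
  can take its place. Real parts are not holomorphic; the extension \<open>re_ext\<close> overcomes
  this, and its symmetry under conjugation makes the coefficients of the quartic real again. In the
  converse direction the diffeomorphisms are merely smooth, and \<open>t\<close> may be an end point
  of the interval. The comparison along the curve therefore uses limits of difference quotients
  within the interval.\<close>

no_notation fps_nth (infixl "$" 75)

section \<open>Calculus of smooth maps\<close>

lemma Ck_on_cong:
  assumes "open U" "\<And>x. x \<in> U \<Longrightarrow> f x = g x"
  shows "Ck_on k U f \<longleftrightarrow> Ck_on k U g"
  using assms(2)
proof (induction k arbitrary: f g)
  case 0
  then show ?case by (simp cong: continuous_on_cong)
next
  case (Suc k)
  have "frechet_derivative f (at x) = frechet_derivative g (at x)" if "x \<in> U" for x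
  proof -
    have "(f has_derivative D) (at x) \<longleftrightarrow> (g has_derivative D) (at x)" for D
      using has_derivative_transform_within_open[OF _ assms(1) that]
        Suc.prems by metis
    then show ?thesis by (simp add: frechet_derivative_def)
  qed
  then have "Ck_on k U (\<lambda>x. frechet_derivative f (at x) v)
      \<longleftrightarrow> Ck_on k U (\<lambda>x. frechet_derivative g (at x) v)" for v
    by (intro Suc.IH) auto
  moreover have "f differentiable_on U \<longleftrightarrow> g differentiable_on U"
    using Suc.prems by (simp add: differentiable_on_def)
      (metis differentiable_transform_within zero_less_one)
  ultimately show ?case by simp
qed

text \<open>\<open>frechet_derivative\<close> is a choice operator; this rule lets an induction on
  \<open>k\<close> supply its own formula for the derivative.\<close>

lemma Ck_on_SucI:
  assumes "open U" "\<And>x. x \<in> U \<Longrightarrow> (f has_derivative f' x) (at x)"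
    and "\<And>v. Ck_on k U (\<lambda>x. f' x v)"
  shows "Ck_on (Suc k) U f"
proof -
  have "f differentiable_on U"
    unfolding differentiable_on_def
  proof
    fix x assume "x \<in> U"
    then have "f differentiable (at x)" using assms(2) unfolding differentiable_def by blast
    then show "f differentiable (at x within U)" by (rule differentiable_at_withinI)
  qed
  moreover have "Ck_on k U (\<lambda>x. frechet_derivative f (at x) v)" for v
  proof -
    have "frechet_derivative f (at x) v = f' x v" if "x \<in> U" for x
      using frechet_derivative_at[OF assms(2)[OF that]] by simp
    from Ck_on_cong[OF assms(1) this] show ?thesis using assms(3) by simp
  qed
  ultimately show ?thesis by simp
qed

lemma Ck_on_Suc_derivative:
  assumes "open U" "Ck_on (Suc k) U f" "x \<in> U"
  shows "(f has_derivative frechet_derivative f (at x)) (at x)"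
proof -
  have "f differentiable (at x within U)" using assms(2,3) by (simp add: differentiable_on_def)
  then have "f differentiable (at x)" using at_within_open[OF assms(3,1)] by simp
  then show ?thesis using frechet_derivative_works by blast
qed

text \<open>The derivative of a product or a composite still contains undifferentiated factors,
  which the inductions below need at the lower order.\<close>

lemma Ck_on_SucD: "Ck_on (Suc k) U f \<Longrightarrow> Ck_on k U f"
proof (induction k arbitrary: f)
  case 0
  then show ?case by (auto intro: differentiable_imp_continuous_on)
next
  case (Suc k)
  then show ?case by simp
qed

lemma Ck_on_imp_continuous: "Ck_on k U f \<Longrightarrow> continuous_on U f"
  by (cases k) (auto intro: differentiable_imp_continuous_on)

lemma Ck_on_subset: "Ck_on k U f \<Longrightarrow> V \<subseteq> U \<Longrightarrow> Ck_on k V f"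
  by (induction k arbitrary: f) (auto intro: continuous_on_subset differentiable_on_subset)

lemma Ck_on_const: "open U \<Longrightarrow> Ck_on k U (\<lambda>x. c)"
proof (induction k arbitrary: c)
  case (Suc k)
  then show ?case by (intro Ck_on_SucI[of _ _ "\<lambda>x v. 0"]) auto
qed auto

lemma Ck_on_add:
  assumes "open U" "Ck_on k U f" "Ck_on k U g"
  shows "Ck_on k U (\<lambda>x. f x + g x)"
  using assms(2,3)
proof (induction k arbitrary: f g)
  case 0
  then show ?case by (auto intro: continuous_on_add)
next
  case (Suc k)
  note der = Ck_on_Suc_derivative[OF assms(1)]
  show ?case
    by (rule Ck_on_SucI[OF assms(1) has_derivative_add[OF der der]])
      (use Suc in auto)
qed

lemma Ck_on_sum:
  assumes "open U" "\<And>i. i \<in> S \<Longrightarrow> Ck_on k U (f i)"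
  shows "Ck_on k U (\<lambda>x. \<Sum>i\<in>S. f i x)"
  using assms(2)
  by (induction S rule: infinite_finite_induct) (auto intro: Ck_on_const Ck_on_add assms(1))

lemma Ck_on_bounded_linear:
  fixes L :: "'b::euclidean_space \<Rightarrow> 'c::euclidean_space"
  assumes "open U" "bounded_linear L" "Ck_on k U f"
  shows "Ck_on k U (\<lambda>x. L (f x))"
  using assms(3)
proof (induction k arbitrary: f)
  case 0
  then show ?case
    using assms(2) by (auto intro: bounded_linear.continuous_on)
next
  case (Suc k)
  show ?case
    by (rule Ck_on_SucI[OF assms(1) bounded_linear.has_derivative[OF assms(2) Ck_on_Suc_derivative[OF assms(1)]]])
      (use Suc in auto)
qed

lemma Ck_on_linear:
  fixes L :: "'a::euclidean_space \<Rightarrow> 'b::euclidean_space"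
  assumes "open U" "bounded_linear L"
  shows "Ck_on k U L"
proof (cases k)
  case 0
  then show ?thesis
    using assms(2) by (auto intro: linear_continuous_on)
next
  case (Suc n)
  show ?thesis unfolding Suc
    by (rule Ck_on_SucI[OF assms(1), where f' = "\<lambda>x. L"])
      (use assms in \<open>auto intro: Ck_on_const bounded_linear_imp_has_derivative\<close>)
qed

lemma Ck_on_bilinear:
  fixes prod :: "'b::euclidean_space \<Rightarrow> 'c::euclidean_space \<Rightarrow> 'd::euclidean_space"
  assumes "open U" "bounded_bilinear prod" "Ck_on k U f" "Ck_on k U g"
  shows "Ck_on k U (\<lambda>x. prod (f x) (g x))"
  using assms(3,4)
proof (induction k arbitrary: f g)
  case 0
  then show ?case
    using assms(2) by (auto intro: bounded_bilinear.continuous_on)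
next
  case (Suc k)
  show ?case
    by (rule Ck_on_SucI[OF assms(1) bounded_bilinear.FDERIV[OF assms(2)
            Ck_on_Suc_derivative[OF assms(1)] Ck_on_Suc_derivative[OF assms(1)]]])
      (use Suc Ck_on_SucD[OF Suc.prems(1)] Ck_on_SucD[OF Suc.prems(2)] in
        \<open>auto intro!: Ck_on_add assms(1) Suc.IH\<close>)
qed

lemmas Ck_on_mult = Ck_on_bilinear[OF _ bounded_bilinear_mult]
lemmas Ck_on_scaleR = Ck_on_bilinear[OF _ bounded_bilinear_scaleR]
lemmas Ck_on_inner = Ck_on_bilinear[OF _ bounded_bilinear_inner]

lemma Ck_on_minus:
  assumes "open U" "Ck_on k U f"
  shows "Ck_on k U (\<lambda>x. - f x)"
  by (rule Ck_on_bounded_linear[OF assms(1) bounded_linear_minus[OF bounded_linear_ident] assms(2)])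

lemma Ck_on_diff:
  assumes "open U" "Ck_on k U f" "Ck_on k U g"
  shows "Ck_on k U (\<lambda>x. f x - g x)"
  using Ck_on_add[OF assms(1,2) Ck_on_minus[OF assms(1,3)]] by simp

lemma Ck_on_componentwise:
  assumes "open U" "\<And>b. b \<in> Basis \<Longrightarrow> Ck_on k U (\<lambda>x. f x \<bullet> b)"
  shows "Ck_on k U f"
proof -
  have "Ck_on k U (\<lambda>x. \<Sum>b\<in>Basis. (f x \<bullet> b) *\<^sub>R b)"
    using assms by (intro Ck_on_sum Ck_on_scaleR Ck_on_const)
  then show ?thesis by (simp add: euclidean_representation)
qed

lemma Ck_on_compose:
  fixes f :: "'a::euclidean_space \<Rightarrow> 'b::euclidean_space" and g :: "'b \<Rightarrow> 'c::euclidean_space"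
  assumes "open U" "open V" "Ck_on k V g" "Ck_on k U f" "f ` U \<subseteq> V"
  shows "Ck_on k U (\<lambda>x. g (f x))"
  using assms(3,4)
proof (induction k arbitrary: g)
  case 0
  then show ?case
    using assms(5) by (auto intro: continuous_on_compose2)
next
  case (Suc k)
  let ?g' = "\<lambda>y. frechet_derivative g (at y)" and ?f' = "\<lambda>x. frechet_derivative f (at x)"
  show ?case
  proof (rule Ck_on_SucI[OF assms(1)])
    fix x assume "x \<in> U"
    then show "((\<lambda>x. g (f x)) has_derivative (\<lambda>v. ?g' (f x) (?f' x v))) (at x)"
      using diff_chain_at[OF Ck_on_Suc_derivative[OF assms(1) Suc.prems(2)]
          Ck_on_Suc_derivative[OF assms(2) Suc.prems(1)]] assms(5)
      by (auto simp: o_def)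
  next
    fix v
    \<comment> \<open>The direction \<open>?f' x v\<close> moves with \<open>x\<close>, while
      \<open>Ck_on\<close> speaks of fixed directions only. Expansion in the basis moves the
      dependence into scalar coefficients.\<close>
    have eq: "?g' (f x) (?f' x v) = (\<Sum>b\<in>Basis. (?f' x v \<bullet> b) *\<^sub>R ?g' (f x) b)" if "x \<in> U" for x
    proof -
      have "linear (?g' (f x))"
        using Ck_on_Suc_derivative[OF assms(2) Suc.prems(1)] assms(5) that
        by (auto intro: has_derivative_linear)
      then show ?thesis
        by (subst euclidean_representation[of "?f' x v", symmetric])
          (simp add: linear_sum linear_scale)
    qed
    have "Ck_on k U (\<lambda>x. \<Sum>b\<in>Basis. (?f' x v \<bullet> b) *\<^sub>R ?g' (f x) b)"
      using Suc Ck_on_SucD[OF Suc.prems(2)]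
      by (intro Ck_on_sum Ck_on_scaleR Ck_on_inner Ck_on_const Suc.IH assms(1)) auto
    then show "Ck_on k U (\<lambda>x. ?g' (f x) (?f' x v))"
      using eq by (subst Ck_on_cong[OF assms(1)]) auto
  qed
qed

lemma Ck_on_holomorphic:
  assumes "open S" "f holomorphic_on S"
  shows "Ck_on k S f"
  using assms(2)
proof (induction k arbitrary: f)
  case 0
  then show ?case by (simp add: holomorphic_on_imp_continuous_on)
next
  case (Suc k)
  have "(f has_derivative (\<lambda>v. deriv f x * v)) (at x)" if "x \<in> S" for x
    using holomorphic_derivI[OF Suc.prems assms(1) that] by (simp add: has_field_derivative_def)
  moreover have "Ck_on k S (\<lambda>x. deriv f x * v)" for v
    using Suc assms(1) by (intro Suc.IH holomorphic_on_mult holomorphic_deriv) auto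
  ultimately show ?case by (rule Ck_on_SucI[OF assms(1)])
qed

lemma Ck_on_inverse:
  fixes f :: "'a::euclidean_space \<Rightarrow> real"
  assumes "open U" "Ck_on k U f" "\<And>x. x \<in> U \<Longrightarrow> f x \<noteq> 0"
  shows "Ck_on k U (\<lambda>x. inverse (f x))"
  using assms(2)
proof (induction k)
  case 0
  then show ?case using assms(3) by (auto intro!: continuous_intros)
next
  case (Suc k)
  let ?f' = "\<lambda>x. frechet_derivative f (at x)"
  have "((\<lambda>x. inverse (f x)) has_derivative (\<lambda>v. - (inverse (f x) * ?f' x v * inverse (f x)))) (at x)"
    if "x \<in> U" for x
    using Ck_on_Suc_derivative[OF assms(1) Suc.prems that] assms(3)[OF that]
    by (auto intro!: derivative_eq_intros)
  moreover have "Ck_on k U (\<lambda>x. - (inverse (f x) * ?f' x v * inverse (f x)))" for v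
    using Suc Ck_on_SucD[OF Suc.prems] assms(1)
    by (intro Ck_on_minus Ck_on_mult) auto
  ultimately show ?case by (rule Ck_on_SucI[OF assms(1)])
qed

lemma Ck_on_prod:
  fixes f :: "'i \<Rightarrow> 'a::euclidean_space \<Rightarrow> real"
  assumes "open U" "\<And>i. i \<in> S \<Longrightarrow> Ck_on k U (f i)"
  shows "Ck_on k U (\<lambda>x. \<Prod>i\<in>S. f i x)"
  using assms(2)
  by (induction S rule: infinite_finite_induct) (auto intro: Ck_on_const Ck_on_mult assms(1))

lemma Ck_on_det:
  fixes A :: "'a::euclidean_space \<Rightarrow> real ^ 'n ^ 'n"
  assumes "open U" "\<And>i j. Ck_on k U (\<lambda>x. A x $ i $ j)"
  shows "Ck_on k U (\<lambda>x. det (A x))"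
  unfolding det_def
  by (intro Ck_on_sum Ck_on_mult Ck_on_prod Ck_on_const assms)

lemma Ck_on_vec_componentwise:
  fixes f :: "'a::euclidean_space \<Rightarrow> real ^ 'n"
  assumes "open U" "\<And>i. Ck_on k U (\<lambda>x. f x $ i)"
  shows "Ck_on k U f"
  by (rule Ck_on_componentwise[OF assms(1)]) (auto simp: Basis_vec_def inner_axis assms(2))

lemma Ck_on_vec_nth:
  fixes f :: "'a::euclidean_space \<Rightarrow> real ^ 'n"
  assumes "open U" "Ck_on k U f"
  shows "Ck_on k U (\<lambda>x. f x $ i)"
  using Ck_on_bounded_linear[OF assms(1) bounded_linear_vec_nth assms(2)] .

lemma Ck_on_Pair:
  assumes "open U" "Ck_on k U f" "Ck_on k U g"
  shows "Ck_on k U (\<lambda>x. (f x, g x))"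
proof -
  have "Ck_on k U (\<lambda>x. (f x, 0) + (0, g x))"
    by (intro Ck_on_add assms(1) Ck_on_bounded_linear[OF assms(1) _ assms(2)]
        Ck_on_bounded_linear[OF assms(1) _ assms(3)] bounded_linear_intros)
  then show ?thesis by simp
qed

section \<open>Local inverses of smooth maps\<close>

text \<open>Cramer's rule expresses the derivative of the inverse through that of \<open>f\<close>.\<close>

lemma Ck_on_inverse_function:
  fixes f :: "real ^ 'n \<Rightarrow> real ^ 'n"
  assumes "open U" "open V" "\<And>k. Ck_on k U f" "homeomorphism U V f g"
    and der: "\<And>y. y \<in> V \<Longrightarrow> (g has_derivative inv (frechet_derivative f (at (g y)))) (at y)"
    and bij: "\<And>y. y \<in> V \<Longrightarrow> bij (frechet_derivative f (at (g y)))"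
  shows "Ck_on k V g"
proof (induction k)
  case 0
  then show ?case using assms(4) by (simp add: homeomorphism_def)
next
  case (Suc k)
  let ?f' = "\<lambda>x. frechet_derivative f (at x)"
  define M where "M y = matrix (?f' (g y))" for y
  have gV: "g ` V \<subseteq> U" using assms(4) by (auto simp: homeomorphism_def)
  have lin: "linear (?f' (g y))" if "y \<in> V" for y
    using Ck_on_Suc_derivative[OF assms(1,3)] gV that by (auto intro: has_derivative_linear)
  have det: "det (M y) \<noteq> 0" if "y \<in> V" for y
    using bij[OF that] lin[OF that] matrix_left_invertible_injective[of "M y"]
      invertible_det_nz[of "M y"] invertible_left_inverse[of "M y"]
    by (auto simp: M_def bij_def matrix_works)
  have entries: "Ck_on k V (\<lambda>y. M y $ i $ j)" for i j
  proof -
    have "Ck_on k U (\<lambda>x. ?f' x (axis j 1) $ i)"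
      using assms(3)[of "Suc k"] by (intro Ck_on_vec_nth assms(1)) auto
    then have "Ck_on k V (\<lambda>y. ?f' (g y) (axis j 1) $ i)"
      by (rule Ck_on_compose[OF assms(2,1) _ Suc gV])
    then show ?thesis by (simp add: M_def matrix_def)
  qed
  have inv: "inv (?f' (g y)) v = (\<chi> l. det (\<chi> i j. if j = l then v $ i else M y $ i $ j) * inverse (det (M y)))"
    if "y \<in> V" for y v
  proof -
    have "M y *v inv (?f' (g y)) v = v"
      using bij[OF that] lin[OF that] by (simp add: M_def matrix_works bij_is_surj surj_f_inv_f)
    then show ?thesis
      using cramer[OF det[OF that]] by (simp add: divide_inverse)
  qed
  have "Ck_on k V (\<lambda>y. inv (?f' (g y)) v)" for v
  proof -
    have ent: "Ck_on k V (\<lambda>y. (\<chi> i j. if j = l then v $ i else M y $ i $ j) $ i $ j)" for l i j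
      using entries by (cases "j = l") (auto intro: Ck_on_const assms(2))
    have "Ck_on k V (\<lambda>y. (\<chi> l. det (\<chi> i j. if j = l then v $ i else M y $ i $ j) * inverse (det (M y))))"
      apply (rule Ck_on_vec_componentwise[OF assms(2)])
      apply (subst vec_lambda_beta)
      using det entries ent
      by (intro Ck_on_mult Ck_on_inverse Ck_on_det assms(2)) auto
    then show ?thesis using inv by (subst Ck_on_cong[OF assms(2)]) auto
  qed
  with der show ?case
    by (intro Ck_on_SucI[OF assms(2), where f' = "\<lambda>y. inv (?f' (g y))"])
qed

text \<open>Bridges \<open>Ck_on\<close>, which is about single directions, and the inverse function
  theorem and Leibniz rule, which want continuity in operator norm; the two agree in finite
  dimension.\<close>

lemma continuous_on_blinfun_of_directions:
  fixes F :: "'a::t2_space \<Rightarrow> 'b::euclidean_space \<Rightarrow>\<^sub>L 'c::euclidean_space"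
  assumes "\<And>v. continuous_on U (\<lambda>x. F x v)"
  shows "continuous_on U F"
  using assms by (intro continuous_on_blinfun_componentwise) auto

lemma Cinf_local_diffeomorphism:
  fixes f :: "real ^ 'n \<Rightarrow> real ^ 'n"
  assumes "open S" "x0 \<in> S" "Cinf_on S f" and "inj (frechet_derivative f (at x0))"
  obtains U V g where "U \<subseteq> S" "x0 \<in> U" "f x0 \<in> V" "diffeomorphism U V f g"
proof -
  let ?f' = "\<lambda>x. frechet_derivative f (at x)"
  have Ck: "Ck_on k S f" for k using assms(3) by (simp add: Cinf_on_def)
  have der: "(f has_derivative ?f' x) (at x)" if "x \<in> S" for x
    using Ck_on_Suc_derivative[OF assms(1) Ck that] .
  have app: "blinfun_apply (Blinfun (?f' x)) = ?f' x" if "x \<in> S" for x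
    using der[OF that] by (intro bounded_linear_Blinfun_apply has_derivative_bounded_linear)
  have cont: "continuous_on S (\<lambda>x. Blinfun (?f' x))"
  proof (rule continuous_on_blinfun_of_directions)
    fix v
    have "continuous_on S (\<lambda>x. ?f' x v)" using Ck[of 1] by simp
    then show "continuous_on S (\<lambda>x. blinfun_apply (Blinfun (?f' x)) v)"
      using app by (auto cong: continuous_on_cong)
  qed
  have lin0: "linear (?f' x0)" using der[OF assms(2)] by (rule has_derivative_linear)
  obtain L where L: "linear L" "L \<circ> ?f' x0 = id"
    using linear_injective_left_inverse[OF lin0 assms(4)] by blast
  have "Blinfun L o\<^sub>L Blinfun (?f' x0) = id_blinfun"
    using L app[OF assms(2)]
    by (intro blinfun_eqI) (auto simp: bounded_linear_Blinfun_apply linear_linear fun_eq_iff)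
  then obtain U V g g' where UV: "open U" "U \<subseteq> S" "x0 \<in> U" "open V" "f x0 \<in> V" "homeomorphism U V f g"
    "\<And>y. y \<in> V \<Longrightarrow> (g has_derivative (g' y)) (at y)"
    "\<And>y. y \<in> V \<Longrightarrow> g' y = inv (blinfun_apply (Blinfun (?f' (g y))))"
    "\<And>y. y \<in> V \<Longrightarrow> bij (blinfun_apply (Blinfun (?f' (g y))))"
    using inverse_function_theorem[OF assms(1) _ cont assms(2), of f "Blinfun L"] der app by metis
  have gS: "g y \<in> S" if "y \<in> V" for y using UV that by (auto simp: homeomorphism_def)
  have "Ck_on k V g" for k
  proof (rule Ck_on_inverse_function[OF UV(1,4) _ UV(6)])
    show "Ck_on k U f" for k using Ck UV(2) by (rule Ck_on_subset)
  qed (use UV(7-9) gS app in auto)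
  then have "diffeomorphism U V f g"
    using UV Ck_on_subset[OF Ck UV(2)] by (auto simp: diffeomorphism_def Cinf_on_def)
  with UV that show ?thesis by blast
qed

section \<open>Integrals that depend smoothly on a parameter\<close>

lemma parametric_integral_has_derivative:
  fixes f :: "'a::euclidean_space \<times> real \<Rightarrow> 'b::euclidean_space"
  assumes U: "open U" "convex U" and W: "open W" "cbox a b \<subseteq> W"
    and f: "Ck_on (Suc k) (U \<times> W) f" and x0: "x0 \<in> U"
  shows "((\<lambda>x. integral (cbox a b) (\<lambda>t. f (x, t))) has_derivative
    (\<lambda>v. integral (cbox a b) (\<lambda>t. frechet_derivative f (at (x0, t)) (v, 0)))) (at x0)"
proof -
  let ?f' = "\<lambda>p. frechet_derivative f (at p)"
  have UW: "open (U \<times> W)" using U(1) W(1) by (rule open_Times)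
  have der: "(f has_derivative ?f' p) (at p)" if "p \<in> U \<times> W" for p
    using Ck_on_Suc_derivative[OF UW f that] .
  have contf: "continuous_on (U \<times> W) f" using f by (rule Ck_on_imp_continuous)
  have Ck': "Ck_on k (U \<times> W) (\<lambda>p. ?f' p v)" for v
    using f by (simp del: split_paired_All)
  define D where "D x t = Blinfun (\<lambda>v. ?f' (x, t) (v, 0))" for x t
  have D: "blinfun_apply (D x t) = (\<lambda>v. ?f' (x, t) (v, 0))" if "x \<in> U" "t \<in> W" for x t
  proof -
    have "bounded_linear (?f' (x, t))"
      using der that by (auto intro: has_derivative_bounded_linear)
    then have "bounded_linear (\<lambda>v. ?f' (x, t) (v, 0))"
      by (rule bounded_linear_compose) (intro bounded_linear_intros)
    then show ?thesis by (simp add: D_def bounded_linear_Blinfun_apply)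
  qed
  have contD: "continuous_on (U \<times> cbox a b) (\<lambda>(x, t). D x t)"
  proof (rule continuous_on_blinfun_of_directions)
    fix v
    have "continuous_on (U \<times> cbox a b) (\<lambda>p. ?f' p (v, 0))"
      using W(2) by (intro continuous_on_subset[OF Ck_on_imp_continuous[OF Ck']]) auto
    then show "continuous_on (U \<times> cbox a b) (\<lambda>p. blinfun_apply (case p of (x, t) \<Rightarrow> D x t) v)"
      by (rule continuous_on_eq) (use D W(2) in auto)
  qed
  have "((\<lambda>x. integral (cbox a b) (\<lambda>t. f (x, t))) has_derivative integral (cbox a b) (D x0)) (at x0 within U)"
  proof (rule leibniz_rule[OF _ _ contD x0 U(2)])
    fix x t assume xt: "x \<in> U" "t \<in> cbox a b"
    have "((\<lambda>x. (x, t)) has_derivative (\<lambda>v. (v, 0))) (at x within U)"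
      by (auto intro!: derivative_eq_intros)
    moreover have "(f has_derivative ?f' (x, t)) (at (x, t) within (\<lambda>x. (x, t)) ` U)"
      using xt W(2) by (intro has_derivative_at_withinI[OF der]) auto
    ultimately have "(f \<circ> (\<lambda>x. (x, t)) has_derivative ?f' (x, t) \<circ> (\<lambda>v. (v, 0))) (at x within U)"
      by (rule diff_chain_within)
    then show "((\<lambda>x. f (x, t)) has_derivative blinfun_apply (D x t)) (at x within U)"
      using D xt W(2) by (auto simp: o_def)
  next
    fix x assume "x \<in> U"
    then have "continuous_on (cbox a b) (\<lambda>t. f (x, t))"
      using W(2) by (intro continuous_on_compose2[OF contf] continuous_intros) auto
    then show "(\<lambda>t. f (x, t)) integrable_on cbox a b" by (rule integrable_continuous)
  qed
  moreover have intD: "blinfun_apply (integral (cbox a b) (D x0)) v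
      = integral (cbox a b) (\<lambda>t. ?f' (x0, t) (v, 0))" for v
  proof -
    have "continuous_on (cbox a b) (\<lambda>t. (x0, t))" by (intro continuous_intros)
    then have "continuous_on (cbox a b) (D x0)"
      using continuous_on_compose2[OF contD, of "cbox a b" "\<lambda>t. (x0, t)"] x0 by auto
    then have "D x0 integrable_on cbox a b" by (rule integrable_continuous)
    then have "blinfun_apply (integral (cbox a b) (D x0)) v = integral (cbox a b) (\<lambda>t. D x0 t v)"
      by (rule blinfun_apply_integral)
    also have "\<dots> = integral (cbox a b) (\<lambda>t. ?f' (x0, t) (v, 0))"
      using D x0 W(2) by (intro integral_cong) (auto simp: subset_iff)
    finally show ?thesis .
  qed
  from intD have "blinfun_apply (integral (cbox a b) (D x0))
      = (\<lambda>v. integral (cbox a b) (\<lambda>t. ?f' (x0, t) (v, 0)))" by (rule ext)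
  ultimately show ?thesis using at_within_open[OF x0 U(1)] by simp
qed

text \<open>Differentiating in direction \<open>v\<close> gives another integral of the same kind,
  with the partial derivative in direction \<open>(v, 0)\<close> as integrand; hence the induction
  over all \<open>f\<close>.\<close>

lemma Ck_on_parametric_integral:
  fixes f :: "'a::euclidean_space \<times> real \<Rightarrow> 'b::euclidean_space"
  assumes U: "open U" "convex U" and W: "open W" "cbox a b \<subseteq> W"
    and f: "Ck_on k (U \<times> W) f"
  shows "Ck_on k U (\<lambda>x. integral (cbox a b) (\<lambda>t. f (x, t)))"
  using f
proof (induction k arbitrary: f)
  case 0
  then have "continuous_on (U \<times> cbox a b) f"
    using W(2) by (auto intro: continuous_on_subset)
  then show ?case
    using integral_continuous_on_param[of U a b "\<lambda>x t. f (x, t)"] by simp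
next
  case (Suc k)
  then have "Ck_on k (U \<times> W) (\<lambda>p. frechet_derivative f (at p) v)" for v
    by (simp del: split_paired_All)
  from Suc.IH[OF this] Suc.prems show ?case
    by (intro Ck_on_SucI[OF U(1) parametric_integral_has_derivative[OF U W]])
qed

text \<open>A chart \<open>\<eta>\<close> goes from the complex plane to \<open>real ^ 2\<close>,
  whereas inversion by Cramer's rule is for maps of \<open>real ^ 'n\<close> to itself.\<close>

definition cvec :: "complex \<Rightarrow> real ^ 2" where "cvec z = vector [Re z, Im z]"

definition vecc :: "real ^ 2 \<Rightarrow> complex" where "vecc w = Complex (w $ 1) (w $ 2)"

lemma cvec_nth [simp]: "cvec z $ 1 = Re z" "cvec z $ 2 = Im z"
  by (simp_all add: cvec_def)

lemma vecc_cvec [simp]: "vecc (cvec z) = z" "cvec (vecc w) = w"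
  by (simp_all add: vecc_def cvec_def vec_eq_iff forall_2)

lemma bounded_linear_cvec: "bounded_linear cvec"
  unfolding linear_conv_bounded_linear[symmetric]
  by (rule linearI) (auto simp: vec_eq_iff forall_2)

lemma bounded_linear_vecc: "bounded_linear vecc"
  unfolding linear_conv_bounded_linear[symmetric]
  by (rule linearI) (auto simp: vecc_def complex_eq_iff)

text \<open>Reduces a swallowtail to two smooth germs with injective derivatives and an equation at
  \<open>z\<close> near \<open>p\<close>. The local inverse of \<open>\<eta>\<close> moves the
  equation to \<open>w\<close> near 0, and continuity of \<open>X\<close> keeps the image in the
  domain on which \<open>\<Psi>\<close> is invertible.\<close>

lemma has_swallowtailI:
  fixes \<eta> :: "complex \<Rightarrow> real ^ 2" and \<Psi> :: "real ^ 3 \<Rightarrow> real ^ 3"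
  assumes S: "open S" "p \<in> S" "Cinf_on S \<eta>" "\<eta> p = 0" "inj (frechet_derivative \<eta> (at p))"
    and T: "open T" "X p \<in> T" "Cinf_on T \<Psi>" "\<Psi> (X p) = 0" "inj (frechet_derivative \<Psi> (at (X p)))"
    and X: "isCont X p" "\<forall>\<^sub>F z in nhds p. \<Psi> (X z) = f_sw (\<eta> z)"
  shows "has_swallowtail X p"
proof -
  obtain A B \<Psi>' where A: "A \<subseteq> T" "X p \<in> A" "\<Psi> (X p) \<in> B" "diffeomorphism A B \<Psi> \<Psi>'"
    using Cinf_local_diffeomorphism[OF T(1,2,3,5)] by metis
  have Svec: "open (vecc -` S)"
    using bounded_linear_vecc S(1) continuous_open_vimage linear_continuous_at by blast
  have Ck_eta: "Ck_on k S \<eta>" for k using S(3) by (simp add: Cinf_on_def)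
  define h where "h = \<eta> \<circ> vecc"
  have Ck_h: "Ck_on k (vecc -` S) h" for k
    unfolding h_def o_def
    by (rule Ck_on_compose[OF Svec S(1) Ck_eta Ck_on_linear[OF Svec bounded_linear_vecc]]) auto
  have "(\<eta> has_derivative frechet_derivative \<eta> (at p)) (at p)"
    using Ck_on_Suc_derivative[OF S(1) Ck_eta S(2)] .
  then have "(h has_derivative frechet_derivative \<eta> (at p) \<circ> vecc) (at (cvec p))"
    unfolding h_def
    by (intro diff_chain_at bounded_linear_imp_has_derivative bounded_linear_vecc) auto
  then have "frechet_derivative h (at (cvec p)) = frechet_derivative \<eta> (at p) \<circ> vecc"
    using frechet_derivative_at by metis
  moreover have "inj vecc" by (metis injI vecc_cvec(2))
  ultimately have "inj (frechet_derivative h (at (cvec p)))"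
    using S(5) by (auto intro: inj_compose)
  then obtain U V g where U: "U \<subseteq> vecc -` S" "cvec p \<in> U" "h (cvec p) \<in> V" "diffeomorphism U V h g"
    using Cinf_local_diffeomorphism[OF Svec, of "cvec p" h] S(2) Ck_h by (auto simp: Cinf_on_def)
  have oU: "open U" and oV: "open V" and hom: "homeomorphism U V h g"
    and Ckg: "Ck_on k V g" for k
    using U(4) by (auto simp: diffeomorphism_def Cinf_on_def)
  define U' where "U' = cvec -` U"
  have oU': "open U'"
    unfolding U'_def
    using bounded_linear_cvec oU continuous_open_vimage linear_continuous_at by blast
  have U'S: "U' \<subseteq> S" using U(1) by (auto simp: U'_def)
  have diffeo: "diffeomorphism U' V \<eta> (vecc \<circ> g)"
    unfolding diffeomorphism_def Cinf_on_def o_def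
  proof (intro conjI allI)
    show "homeomorphism U' V \<eta> (\<lambda>x. vecc (g x))"
    proof (rule homeomorphismI)
      show "continuous_on U' \<eta>"
        using Ck_on_imp_continuous[OF Ck_eta] U'S by (rule continuous_on_subset)
      show "continuous_on V (\<lambda>x. vecc (g x))"
        using hom by (intro bounded_linear.continuous_on[OF bounded_linear_vecc]) (simp add: homeomorphism_def)
      show "\<eta> ` U' \<subseteq> V" "\<And>x. x \<in> U' \<Longrightarrow> vecc (g (\<eta> x)) = x"
        "(\<lambda>x. vecc (g x)) ` V \<subseteq> U'" "\<And>y. y \<in> V \<Longrightarrow> \<eta> (vecc (g y)) = y"
        using hom unfolding homeomorphism_def h_def U'_def o_def
        by (auto simp: image_subset_iff) (metis imageI vecc_cvec(1))+
    qed
    show "Ck_on k U' \<eta>" for k using Ck_eta U'S by (rule Ck_on_subset)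
    show "Ck_on k V (\<lambda>x. vecc (g x))" for k
      by (rule Ck_on_bounded_linear[OF oV bounded_linear_vecc Ckg])
  qed (use oU' oV in auto)
  have p: "p \<in> U'" using U(2) by (simp add: U'_def)
  have V0: "0 \<in> V" using U(3) S(4) by (simp add: h_def)
  have g0: "vecc (g 0) = p"
    using diffeo p S(4) by (auto simp: diffeomorphism_def homeomorphism_def)
  have "continuous_on V (vecc \<circ> g)"
    using diffeo by (simp add: diffeomorphism_def homeomorphism_def)
  then have cont: "isCont (vecc \<circ> g) 0"
    using V0 oV continuous_on_eq_continuous_at by blast
  have "isCont (X \<circ> (vecc \<circ> g)) 0"
    using continuous_at_compose[OF cont, of X] X(1) g0 by simp
  then have "\<forall>\<^sub>F w in nhds 0. X ((vecc \<circ> g) w) \<in> A"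
    using A(2,4) g0 by (auto simp: diffeomorphism_def o_def continuous_at_open eventually_nhds)
  moreover have "\<forall>\<^sub>F w in nhds 0. \<Psi> (X ((vecc \<circ> g) w)) = f_sw (\<eta> ((vecc \<circ> g) w))"
    using X(2) cont g0 eventually_compose_filterlim[of _ "nhds p" "vecc \<circ> g" "nhds 0"]
    by (auto simp: continuous_within tendsto_nhds_iff)
  moreover have "\<forall>\<^sub>F w in nhds 0. \<eta> ((vecc \<circ> g) w) = w"
    using diffeo V0 oV by (auto simp: diffeomorphism_def homeomorphism_def eventually_nhds)
  ultimately have "\<forall>\<^sub>F w in nhds 0. X ((vecc \<circ> g) w) \<in> A \<and> (\<Psi> \<circ> X \<circ> (vecc \<circ> g)) w = f_sw w"
    by eventually_elim auto
  then show ?thesis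
    unfolding has_swallowtail_def using diffeo p S(4) A T(4) by blast
qed

section \<open>Quartic families and their roots\<close>

lemma contour_integral_zeros_in_disc:
  assumes f: "f holomorphic_on ball 0 \<rho>" and r: "0 < r" "r < \<rho>"
    and nz: "\<And>t. cmod t = r \<Longrightarrow> f t \<noteq> 0"
  shows "finite {w \<in> ball 0 r. f w = 0}"
    and "contour_integral (circlepath 0 r) (\<lambda>t. deriv f t * t ^ k / f t)
      = 2 * pi * \<i> * (\<Sum>p\<in>{w \<in> ball 0 r. f w = 0}. of_int (zorder f p) * p ^ k)"
proof -
  \<comment> \<open>The argument principle wants an open set around the circle with finitely many
    zeros. The closed disc of intermediate radius is compact, which gives finiteness, and the zeros
    between the two radii have winding number 0.\<close>
  define r2 where "r2 = (r + \<rho>) / 2"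
  have r2: "r < r2" "r2 < \<rho>" using r by (auto simp: r2_def)
  define pz where "pz = {w \<in> ball 0 r2. f w = 0 \<or> w \<in> {}}"
  have nonconst: "\<not> f constant_on ball 0 \<rho>" if "\<exists>w\<in>ball 0 \<rho>. f w = 0"
  proof
    assume "f constant_on ball 0 \<rho>"
    then obtain c where c: "\<And>t. t \<in> ball 0 \<rho> \<Longrightarrow> f t = c" by (auto simp: constant_on_def)
    have "of_real r \<in> ball (0::complex) \<rho>" using r by simp
    then have "c \<noteq> 0" using nz[of "of_real r"] c[of "of_real r"] r by auto
    then show False using c that by auto
  qed
  have fin: "finite {w \<in> cball 0 r2. f w = 0}"
  proof (cases "\<exists>w\<in>ball 0 \<rho>. f w = 0")
    case True
    then show ?thesis
      using r r2 by (intro holomorphic_compact_finite_zeros[OF f _ _ _ _ nonconst]) auto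
  next
    case False
    then have "{w \<in> cball 0 r2. f w = 0} = {}" using r2 by auto
    then show ?thesis by (simp only: finite.emptyI)
  qed
  have finpz: "finite pz" by (rule finite_subset[OF _ fin]) (auto simp: pz_def)
  show "finite {w \<in> ball 0 r. f w = 0}"
    by (rule finite_subset[OF _ finpz]) (use r2 in \<open>auto simp: pz_def\<close>)
  have "contour_integral (circlepath 0 r) (\<lambda>t. deriv f t * t ^ k / f t)
      = 2 * pi * \<i> * (\<Sum>p\<in>pz. winding_number (circlepath 0 r) p * p ^ k * zorder f p)"
    unfolding pz_def
  proof (rule argument_principle)
    show "f holomorphic_on ball 0 r2 - {}"
      using f r2 by (auto intro: holomorphic_on_subset)
    show "path_image (circlepath 0 r) \<subseteq> ball 0 r2 - {w \<in> ball 0 r2. f w = 0 \<or> w \<in> {}}"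
      using nz r r2 by auto
    show "\<forall>z. z \<notin> ball 0 r2 \<longrightarrow> winding_number (circlepath 0 r) z = 0"
      using r r2 by (auto intro!: winding_number_zero_outside[of _ "cball 0 r"])
    show "finite {w \<in> ball 0 r2. f w = 0 \<or> w \<in> {}}" using finpz by (simp add: pz_def)
  qed (auto intro!: holomorphic_intros)
  also have "(\<Sum>p\<in>pz. winding_number (circlepath 0 r) p * p ^ k * zorder f p)
      = (\<Sum>p\<in>{w \<in> ball 0 r. f w = 0}. of_int (zorder f p) * p ^ k)"
  proof (rule sum.mono_neutral_cong_right[OF finpz])
    show "\<forall>p\<in>pz - {w \<in> ball 0 r. f w = 0}. winding_number (circlepath 0 r) p * p ^ k * zorder f p = 0"
    proof
      fix p assume p: "p \<in> pz - {w \<in> ball 0 r. f w = 0}"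
      with nz have "p \<notin> cball 0 r" by (force simp: pz_def)
      then have "winding_number (circlepath 0 r) p = 0"
        using r by (intro winding_number_zero_outside[of _ "cball 0 r"]) auto
      then show "winding_number (circlepath 0 r) p * p ^ k * zorder f p = 0" by simp
    qed
    show "winding_number (circlepath 0 r) p * p ^ k * zorder f p = of_int (zorder f p) * p ^ k"
      if "p \<in> {w \<in> ball 0 r. f w = 0}" for p
      using that winding_number_circlepath[of p 0 r] by (simp add: norm_minus_commute)
  qed (use r2 in \<open>auto simp: pz_def\<close>)
  finally show "contour_integral (circlepath 0 r) (\<lambda>t. deriv f t * t ^ k / f t)
      = 2 * pi * \<i> * (\<Sum>p\<in>{w \<in> ball 0 r. f w = 0}. of_int (zorder f p) * p ^ k)" .
qed

lemma sum_remove_multiplicity: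
  fixes m :: "'b \<Rightarrow> int" and g :: "nat \<Rightarrow> 'b \<Rightarrow> complex"
  assumes "finite Z" "p \<in> Z"
  shows "(\<Sum>x\<in>Z. of_int (m x) * g k x)
      = g k p + (\<Sum>x\<in>Z. of_int ((m(p := m p - 1)) x) * g k x)"
  using assms by (simp add: sum.remove[of Z p] algebra_simps)

text \<open>The function \<open>m\<close> describes a multiset of four numbers that contains
  \<open>t0\<close> twice. The remaining two, which may coincide with each other or with
  \<open>t0\<close>, are peeled off one at a time; they do not depend on \<open>k\<close>.\<close>

lemma power_sums_double_root:
  fixes m :: "complex \<Rightarrow> int"
  assumes Z: "finite Z" "t0 \<in> Z" and nn: "\<And>p. p \<in> Z \<Longrightarrow> m p \<ge> 0" and "m t0 \<ge> 2" "sum m Z = 4"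
  shows "\<exists>t1 t2. \<forall>k. (\<Sum>p\<in>Z. of_int (m p) * p ^ k) = 2 * t0 ^ k + t1 ^ k + t2 ^ k"
proof -
  let ?S = "\<lambda>m k. \<Sum>p\<in>Z. of_int (m p) * (p::complex) ^ k"
  define rm where "rm p m = m(p := m p - (1::int))" for p :: complex and m
  have step: "?S m k = p ^ k + ?S (rm p m) k" if "p \<in> Z" for m p k
    unfolding rm_def using sum_remove_multiplicity[OF Z(1) that, of m "\<lambda>k x. x ^ k" k] .
  have tot: "sum (rm p m) Z = sum m Z - 1" if "p \<in> Z" for m p
    using that Z(1) by (simp add: rm_def sum.remove[of Z p])
  have pos: "\<exists>p\<in>Z. m p \<ge> 1" if "sum m Z > 0" for m :: "complex \<Rightarrow> int"
    using that sum_nonpos[of Z m] by force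
  define m2 where "m2 = rm t0 (rm t0 m)"
  have m2: "\<And>p. p \<in> Z \<Longrightarrow> m2 p \<ge> 0" "sum m2 Z = 2"
    using assms by (auto simp: m2_def tot) (auto simp: rm_def)
  obtain t1 where t1: "t1 \<in> Z" "m2 t1 \<ge> 1" using pos[of m2] m2 by auto
  define m3 where "m3 = rm t1 m2"
  have m3: "\<And>p. p \<in> Z \<Longrightarrow> m3 p \<ge> 0" "sum m3 Z = 1"
    using m2 t1 by (auto simp: m3_def tot) (auto simp: rm_def)
  obtain t2 where t2: "t2 \<in> Z" "m3 t2 \<ge> 1" using pos[of m3] m3 by auto
  define m4 where "m4 = rm t2 m3"
  have m4: "\<And>p. p \<in> Z \<Longrightarrow> m4 p \<ge> 0" "sum m4 Z = 0"
    using m3 t2 by (auto simp: m4_def tot) (auto simp: rm_def)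
  then have "\<forall>p\<in>Z. m4 p = 0" using Z(1) sum_nonneg_eq_0_iff[of Z m4] by auto
  then have "?S m k = 2 * t0 ^ k + t1 ^ k + t2 ^ k" for k
    using step[OF Z(2), of m k] step[OF Z(2), of "rm t0 m" k] step[OF t1(1), of m2 k] step[OF t2(1), of m3 k]
    by (simp add: m2_def[symmetric] m3_def[symmetric] m4_def[symmetric])
  then show ?thesis by blast
qed

text \<open>\<open>t\<close> is the variable and \<open>Y\<close> the parameter. At
  \<open>Y = 0\<close> there is a zero of order four, with unit factor \<open>E\<close>, and
  \<open>D V\<close> is the derivative in the parameter direction \<open>V\<close>. The hypothesis
  \<open>close\<close> is Rouche's condition on the circle of radius \<open>r\<close>: it traps four
  roots inside for every \<open>Y\<close>.\<close>

locale quartic_family =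
  fixes F :: "complex \<Rightarrow> 'a::euclidean_space \<Rightarrow> complex" and E :: "complex \<Rightarrow> complex"
    and D :: "'a \<Rightarrow> complex \<Rightarrow> complex" and \<rho> \<delta> r :: real
  assumes radii: "0 < r" "r < \<rho>" "0 < \<delta>"
    and holF: "\<And>Y. Y \<in> ball 0 \<delta> \<Longrightarrow> (\<lambda>t. F t Y) holomorphic_on ball 0 \<rho>"
    and holE: "E holomorphic_on ball 0 \<rho>" and Enz: "\<And>t. t \<in> ball 0 \<rho> \<Longrightarrow> E t \<noteq> 0"
    and F0: "\<And>t. t \<in> ball 0 \<rho> \<Longrightarrow> F t 0 = t ^ 4 * E t"
    and smooth: "\<And>k. Ck_on k (ball 0 \<delta> \<times> ball 0 \<rho>) (\<lambda>p. F (snd p) (fst p))"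
    and cnjF: "\<And>t Y. t \<in> ball 0 \<rho> \<Longrightarrow> Y \<in> ball 0 \<delta> \<Longrightarrow> F (cnj t) Y = cnj (F t Y)"
    and derF: "\<And>t. t \<in> ball 0 \<rho> \<Longrightarrow> ((\<lambda>Y. F t Y) has_derivative (\<lambda>V. D V t)) (at 0)"
    and holD: "\<And>V. D V holomorphic_on ball 0 \<rho>"
    and close: "\<And>t Y. cmod t = r \<Longrightarrow> Y \<in> ball 0 \<delta> \<Longrightarrow> cmod (F t Y - F t 0) < cmod (F t 0)"
begin

text \<open>Division by \<open>F t 0\<close> brings the argument within distance 1 of 1, by
  \<open>close\<close>, so the principal logarithm serves along the whole circle.\<close>

definition L :: "'a \<Rightarrow> complex \<Rightarrow> complex" where "L Y t = Ln (F t Y / F t 0)"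

text \<open>Integration by parts turns \<open>- k t\<^sup>k\<^sup>-\<^sup>1 L\<close> into \<open>t\<^sup>k L'\<close>, so \<open>J k Y\<close> is the sum of the \<open>k\<close>-th powers of the
  roots of \<open>F\<close> inside the circle. Unlike the logarithmic derivative, \<open>L\<close> needs no \<open>t\<close>-derivative of \<open>F\<close>.\<close>

definition J :: "nat \<Rightarrow> 'a \<Rightarrow> complex" where
  "J k Y = - of_nat k * integral (cbox 0 1) (\<lambda>\<theta>. circlepath 0 r \<theta> ^ k * L Y (circlepath 0 r \<theta>))"

lemma on_circle: "cmod t = r \<Longrightarrow> t \<in> ball 0 \<rho>" "cmod t = r \<Longrightarrow> F t 0 \<noteq> 0"
  using radii F0[of t] Enz[of t] by auto

lemma norm_circlepath: "cmod (circlepath 0 r \<theta>) = r"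
  using radii by (simp add: circlepath norm_mult)

lemma ratio: assumes "cmod t = r" "Y \<in> ball 0 \<delta>" shows "F t Y / F t 0 \<in> ball 1 1" "F t Y \<noteq> 0"
proof -
  have nz: "F t 0 \<noteq> 0" using on_circle assms by blast
  have "F t Y / F t 0 - 1 = (F t Y - F t 0) / F t 0" using nz by (simp add: field_simps)
  then have "cmod (F t Y / F t 0 - 1) < 1"
    using close[OF assms] nz by (simp add: norm_divide)
  then show "F t Y / F t 0 \<in> ball 1 1" by (simp add: dist_norm norm_minus_commute)
  then show "F t Y \<noteq> 0" by auto
qed

lemma ball_1_1: "w \<in> ball (1::complex) 1 \<Longrightarrow> w \<notin> \<real>\<^sub>\<le>\<^sub>0"
proof -
  assume "w \<in> ball (1::complex) 1"
  then have "cmod (1 - w) < 1" by (simp add: dist_norm)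
  then have "Re w > 0" using complex_Re_le_cmod[of "1 - w"] by simp
  then show ?thesis by (auto simp: complex_nonpos_Reals_iff)
qed

lemma Ck_on_circlepath: "Ck_on n (ball (0::'a) \<delta> \<times> UNIV) (\<lambda>p. circlepath 0 r (snd p))"
proof -
  have o: "open (ball (0::'a) \<delta> \<times> (UNIV::real set))" by (simp add: open_Times)
  have bl: "bounded_linear (\<lambda>p::'a \<times> real. 2 * of_real pi * \<i> * complex_of_real (snd p))"
    by (intro bounded_linear_intros bounded_linear_compose[OF bounded_linear_of_real])
  have "Ck_on n (ball 0 \<delta> \<times> UNIV)
      (\<lambda>p::'a \<times> real. of_real r * exp (2 * of_real pi * \<i> * complex_of_real (snd p)))"
    by (intro Ck_on_mult Ck_on_const o
        Ck_on_compose[OF o open_UNIV Ck_on_holomorphic[OF open_UNIV] Ck_on_linear[OF o bl]])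
      (auto intro!: holomorphic_intros)
  then show ?thesis by (simp add: circlepath)
qed

lemma Ck_on_integrand:
  "Ck_on n (ball 0 \<delta> \<times> UNIV) (\<lambda>p. circlepath 0 r (snd p) ^ k * L (fst p) (circlepath 0 r (snd p)))"
proof -
  let ?S = "ball (0::'a) \<delta> \<times> (UNIV::real set)" and ?c = "\<lambda>p::'a \<times> real. circlepath 0 r (snd p)"
  have o: "open ?S" by (simp add: open_Times)
  have oS: "open (ball 0 \<delta> \<times> ball 0 \<rho> :: ('a \<times> complex) set)" by (simp add: open_Times)
  have hol: "(\<lambda>t. inverse (F t 0)) holomorphic_on ball 0 \<rho> - {0}"
    using holF[of 0] radii F0 Enz
    by (intro holomorphic_on_inverse) (auto intro: holomorphic_on_subset)
  have pow: "Ck_on n ?S (\<lambda>p. ?c p ^ k)"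
    by (rule Ck_on_compose[OF o open_UNIV Ck_on_holomorphic[OF open_UNIV] Ck_on_circlepath])
      (auto intro!: holomorphic_intros)
  have num: "Ck_on n ?S (\<lambda>p. F (?c p) (fst p))"
  proof -
    have "Ck_on n ?S (\<lambda>p. (fst p, ?c p))"
      by (intro Ck_on_Pair o Ck_on_circlepath Ck_on_linear bounded_linear_fst)
    from Ck_on_compose[OF o oS smooth this] show ?thesis
      using norm_circlepath radii by (auto simp: image_subset_iff)
  qed
  have den: "Ck_on n ?S (\<lambda>p. inverse (F (?c p) 0))"
    using norm_circlepath radii
    by (intro Ck_on_compose[OF o _ Ck_on_holomorphic[OF _ hol] Ck_on_circlepath])
      (auto simp: image_subset_iff, metis norm_zero less_irrefl)
  have "Ck_on n ?S (\<lambda>p. Ln (F (?c p) (fst p) * inverse (F (?c p) 0)))"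
  proof (rule Ck_on_compose[OF o open_ball Ck_on_holomorphic[OF open_ball] Ck_on_mult[OF o num den]])
    show "Ln holomorphic_on ball 1 1" using ball_1_1 by (intro holomorphic_on_Ln) auto
    show "(\<lambda>p. F (?c p) (fst p) * inverse (F (?c p) 0)) ` ?S \<subseteq> ball 1 1"
      using ratio(1)[OF norm_circlepath] by (auto simp: divide_inverse simp del: mem_ball)
  qed
  then show ?thesis
    using Ck_on_mult[OF o pow] by (simp add: L_def divide_inverse)
qed

lemma Ck_on_J: "Ck_on n (ball 0 \<delta>) (J k)"
proof -
  have "Ck_on n (ball 0 \<delta>)
      (\<lambda>Y. integral (cbox 0 1) (\<lambda>\<theta>. circlepath 0 r \<theta> ^ k * L Y (circlepath 0 r \<theta>)))"
    using Ck_on_parametric_integral[OF open_ball convex_ball open_UNIV subset_UNIV Ck_on_integrand]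
    by simp
  then show ?thesis
    unfolding J_def by (intro Ck_on_mult Ck_on_const open_ball)
qed

text \<open>At \<open>Y = 0\<close> the derivative of \<open>L\<close> is
  \<open>D V t / (t^4 * E t)\<close>. Since \<open>d\<theta> = dt / (2 \<pi> i t)\<close>, the
  integral becomes Cauchy's formula with denominator \<open>t^(5-k)\<close> for the Taylor
  coefficient of order \<open>4 - k\<close> of \<open>D V / E\<close>. So the power sums with
  \<open>k = 2, 3, 4\<close> see exactly the 2-jet of that quotient.\<close>

lemma J_has_derivative:
  assumes k: "1 \<le> k" "k \<le> 4"
  shows "(J k has_derivative
    (\<lambda>V. - of_nat k * ((deriv ^^ (4 - k)) (\<lambda>t. D V t / E t) 0 / fact (4 - k)))) (at 0)"
proof -
  let ?g = "\<lambda>p. circlepath 0 r (snd p) ^ k * L (fst p) (circlepath 0 r (snd p))"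
  have 0: "(0::'a) \<in> ball 0 \<delta>" using radii by simp
  have o: "open (ball (0::'a) \<delta> \<times> (UNIV::real set))" by (simp add: open_Times)
  have J: "(J k has_derivative (\<lambda>v. - of_nat k * integral (cbox 0 1)
      (\<lambda>\<theta>. frechet_derivative ?g (at (0, \<theta>)) (v, 0)))) (at 0)"
    unfolding J_def
    using has_derivative_mult_right[OF parametric_integral_has_derivative[OF open_ball convex_ball open_UNIV
        subset_UNIV Ck_on_integrand 0]] by simp
  have fd: "frechet_derivative ?g (at (0, \<theta>)) (v, 0)
      = circlepath 0 r \<theta> ^ k * (D v (circlepath 0 r \<theta>) / F (circlepath 0 r \<theta>) 0)" for \<theta> v
  proof -
    let ?t = "circlepath 0 r \<theta>"
    have "(?g has_derivative frechet_derivative ?g (at (0, \<theta>))) (at (0, \<theta>))"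
      by (rule Ck_on_Suc_derivative[OF o Ck_on_integrand]) (use 0 in auto)
    moreover have "((\<lambda>Y::'a. (Y, \<theta>)) has_derivative (\<lambda>v. (v, 0))) (at 0)"
      by (auto intro!: derivative_eq_intros)
    ultimately have 1: "((\<lambda>Y. ?g (Y, \<theta>)) has_derivative (\<lambda>v. frechet_derivative ?g (at (0, \<theta>)) (v, 0))) (at 0)"
      using diff_chain_at[of "\<lambda>Y::'a. (Y, \<theta>)" "\<lambda>v. (v, 0)" 0 ?g] by (simp add: o_def)
    have t: "?t \<in> ball 0 \<rho>" "F ?t 0 \<noteq> 0" using on_circle norm_circlepath by blast+
    have "((\<lambda>Y. F ?t Y / F ?t 0) has_derivative (\<lambda>v. D v ?t / F ?t 0)) (at 0)"
      using derF[OF t(1)] t(2) by (auto intro!: derivative_eq_intros)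
    moreover have "(*) 1 = (\<lambda>v::complex. v)" by auto
    then have "(Ln has_derivative (\<lambda>v. v)) (at (F ?t 0 / F ?t 0))"
      using has_field_derivative_Ln[of 1] t(2) by (simp add: has_field_derivative_def)
    ultimately have "((\<lambda>Y. L Y ?t) has_derivative (\<lambda>v. D v ?t / F ?t 0)) (at 0)"
      unfolding L_def using diff_chain_at[of "\<lambda>Y. F ?t Y / F ?t 0" _ 0 Ln] by (simp add: o_def)
    from has_derivative_mult_right[OF this, of "?t ^ k"]
    have "((\<lambda>Y. ?g (Y, \<theta>)) has_derivative (\<lambda>v. ?t ^ k * (D v ?t / F ?t 0))) (at 0)"
      by simp
    from has_derivative_unique[OF 1 this] show ?thesis by metis
  qed
  have "integral (cbox 0 1) (\<lambda>\<theta>. frechet_derivative ?g (at (0, \<theta>)) (v, 0))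
      = (deriv ^^ (4 - k)) (\<lambda>t. D v t / E t) 0 / fact (4 - k)" for v
  proof -
    define m where "m = 4 - k"
    let ?q = "\<lambda>t. D v t / E t"
    have hq: "?q holomorphic_on ball 0 \<rho>"
      using holD holE Enz by (intro holomorphic_on_divide)
    have "((\<lambda>u. ?q u / (u - 0) ^ Suc m) has_contour_integral
        ((2 * pi * \<i>) / fact m * (deriv ^^ m) ?q 0)) (circlepath 0 r)"
      using radii hq
      by (intro Cauchy_has_contour_integral_higher_derivative_circlepath)
        (auto intro!: holomorphic_on_imp_continuous_on intro: holomorphic_on_subset)
    then have "((\<lambda>\<theta>. ?q (circlepath 0 r \<theta>) / circlepath 0 r \<theta> ^ Suc m
        * vector_derivative (circlepath 0 r) (at \<theta>)) has_integral
        ((2 * pi * \<i>) / fact m * (deriv ^^ m) ?q 0)) {0..1}"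
      by (simp add: has_contour_integral has_contour_integral_def)
    then have "((\<lambda>\<theta>. inverse (2 * pi * \<i>) * (?q (circlepath 0 r \<theta>) / circlepath 0 r \<theta> ^ Suc m
        * vector_derivative (circlepath 0 r) (at \<theta>))) has_integral
        inverse (2 * pi * \<i>) * ((2 * pi * \<i>) / fact m * (deriv ^^ m) ?q 0)) {0..1}"
      by (rule has_integral_mult_right)
    moreover have "inverse (2 * pi * \<i>) * (?q (circlepath 0 r \<theta>) / circlepath 0 r \<theta> ^ Suc m
        * vector_derivative (circlepath 0 r) (at \<theta>)) = frechet_derivative ?g (at (0, \<theta>)) (v, 0)" for \<theta>
    proof -
      let ?t = "circlepath 0 r \<theta>"
      have t: "?t \<in> ball 0 \<rho>" "?t \<noteq> 0" "E ?t \<noteq> 0"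
        using on_circle norm_circlepath[of \<theta>] radii Enz by auto
      have vd: "vector_derivative (circlepath 0 r) (at \<theta>) = 2 * pi * \<i> * ?t"
        unfolding vector_derivative_circlepath by (simp add: circlepath)
      have "?t ^ 4 = ?t ^ k * ?t ^ m" using k by (simp add: m_def flip: power_add)
      then show ?thesis unfolding fd vd F0[OF t(1)] using t(2,3) by (simp add: field_simps)
    qed
    ultimately have "((\<lambda>\<theta>. frechet_derivative ?g (at (0, \<theta>)) (v, 0)) has_integral
        (deriv ^^ m) ?q 0 / fact m) (cbox 0 1)" by (simp add: field_simps)
    then show ?thesis unfolding m_def by (rule integral_unique)
  qed
  with J show ?thesis by simp
qed

text \<open>Replacing \<open>\<theta>\<close> by \<open>1 - \<theta>\<close> conjugates the point on
  the circle, hence the integrand by \<open>cnjF\<close>, but does not change the integral.\<close>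

lemma J_real: assumes Y: "Y \<in> ball 0 \<delta>" shows "J k Y \<in> \<real>"
proof -
  let ?h = "\<lambda>\<theta>. circlepath 0 r \<theta> ^ k * L Y (circlepath 0 r \<theta>)"
  have "integral {0..1} (\<lambda>x. ?h (1 - x)) = integral {0..1} ?h"
  proof -
    have "integral {0..1} ?h = integral {-1..0} (\<lambda>x. ?h (- x))"
      using Henstock_Kurzweil_Integration.integral_reflect_real[of 1 0 ?h] by simp
    also have "\<dots> = integral {0..1} (\<lambda>x. ?h (1 - x))"
      using integral_shift_Icc_real[of "-1" 0 "\<lambda>x. ?h (1 - x)" 1] by (simp add: o_def)
    finally show ?thesis by simp
  qed
  moreover have "?h (1 - x) = cnj (?h x)" for x
  proof -
    let ?t = "circlepath 0 r x"
    have "exp (2 * complex_of_real pi * \<i> * (1 - x)) = exp (- (2 * complex_of_real pi * \<i> * x))"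
      by (simp add: algebra_simps exp_diff exp_minus exp_of_real divide_inverse)
    then have t: "circlepath 0 r (1 - x) = cnj ?t"
      by (simp add: circlepath exp_cnj)
    have tb: "?t \<in> ball 0 \<rho>" using on_circle norm_circlepath by blast
    have 0: "0 \<in> ball 0 \<delta>" using radii by simp
    show ?thesis
      using cnj_Ln[OF ball_1_1[OF ratio(1)[OF norm_circlepath Y]]]
      unfolding t L_def cnjF[OF tb Y] cnjF[OF tb 0] by simp
  qed
  ultimately have "cnj (integral {0..1} ?h) = integral {0..1} ?h"
    by (simp add: integral_cnj)
  then show ?thesis by (simp add: J_def Reals_cnj_iff)
qed

lemma L_has_derivative:
  assumes t: "cmod t = r" and Y: "Y \<in> ball 0 \<delta>"
  shows "(L Y has_field_derivative
    (deriv (\<lambda>t. F t Y) t / F t Y - deriv (\<lambda>t. F t 0) t / F t 0)) (at t)"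
proof -
  have 0: "0 \<in> ball 0 \<delta>" using radii by simp
  note d = holomorphic_derivI[OF holF open_ball on_circle(1)[OF t]]
  have "((\<lambda>t. F t Y / F t 0) has_field_derivative
     (deriv (\<lambda>t. F t Y) t * F t 0 - F t Y * deriv (\<lambda>t. F t 0) t) / (F t 0 * F t 0)) (at t)"
    by (rule DERIV_divide[OF d[OF Y] d[OF 0] on_circle(2)[OF t]])
  from DERIV_chain2[OF has_field_derivative_Ln[OF ball_1_1[OF ratio(1)[OF t Y]]] this] show ?thesis
    unfolding L_def
    by (rule DERIV_cong) (use ratio(2)[OF t Y] on_circle(2)[OF t] in \<open>simp add: field_simps\<close>)
qed

text \<open>The product \<open>t^k * L Y t\<close> is single-valued along the circle, so its
  derivative integrates to 0. The substitution \<open>dt = 2 \<pi> i t d\<theta>\<close> then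
  restores the power \<open>t^k\<close> that appears in \<open>J\<close>.\<close>

lemma power_sum_difference:
  assumes Y: "Y \<in> ball 0 \<delta>"
  shows "contour_integral (circlepath 0 r) (\<lambda>t. deriv (\<lambda>t. F t Y) t * t ^ k / F t Y)
    - contour_integral (circlepath 0 r) (\<lambda>t. deriv (\<lambda>t. F t 0) t * t ^ k / F t 0) = 2 * pi * \<i> * J k Y"
proof -
  let ?c = "circlepath 0 r"
  let ?d = "\<lambda>Y t. deriv (\<lambda>t. F t Y) t * t ^ k / F t Y"
  have 0: "0 \<in> ball 0 \<delta>" using radii by simp
  have sph: "sphere 0 r \<subseteq> ball (0::complex) \<rho>" using radii by auto
  have cont: "continuous_on (path_image ?c) (?d Y)" if "Y \<in> ball 0 \<delta>" for Y
    using radii ratio(2) that holomorphic_on_imp_continuous_on[OF holF[OF that]]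
      holomorphic_on_imp_continuous_on[OF holomorphic_deriv[OF holF[OF that] open_ball]] sph
    by (auto intro!: continuous_intros elim: continuous_on_subset)
  then have int: "?d Y contour_integrable_on ?c" if "Y \<in> ball 0 \<delta>" for Y
    using that radii by (intro contour_integrable_continuous_circlepath) auto
  have diff: "((\<lambda>t. ?d Y t - ?d 0 t) has_contour_integral
      (contour_integral ?c (?d Y) - contour_integral ?c (?d 0))) ?c"
    by (intro has_contour_integral_diff has_contour_integral_integral int Y 0)
  have prim: "((\<lambda>t. of_nat k * t ^ (k - 1) * L Y t + (?d Y t - ?d 0 t)) has_contour_integral 0) ?c"
  proof -
    have "((\<lambda>t. t ^ k * L Y t) has_field_derivative
        of_nat k * t ^ (k - 1) * L Y t + (?d Y t - ?d 0 t)) (at t within sphere 0 r)"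
      if "t \<in> sphere 0 r" for t
    proof -
      have t: "cmod t = r" using that by simp
      have "((\<lambda>t. t ^ k * L Y t) has_field_derivative of_nat k * t ^ (k - 1) * L Y t +
        (deriv (\<lambda>t. F t Y) t / F t Y - deriv (\<lambda>t. F t 0) t / F t 0) * t ^ k) (at t)"
        using DERIV_mult[OF DERIV_power[OF DERIV_ident] L_has_derivative[OF t Y]] by simp
      then show ?thesis
        by (rule DERIV_cong[OF has_field_derivative_at_within]) (simp add: algebra_simps)
    qed
    from contour_integral_primitive[OF this, of ?c] show ?thesis
      using radii by simp
  qed
  have "((\<lambda>t. of_nat k * t ^ (k - 1) * L Y t) has_contour_integral
      (0 - (contour_integral ?c (?d Y) - contour_integral ?c (?d 0)))) ?c"
    using has_contour_integral_diff[OF prim diff] by simp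
  then have "((\<lambda>\<theta>. (of_nat k * ?c \<theta> ^ (k - 1) * L Y (?c \<theta>)) * vector_derivative ?c (at \<theta>))
      has_integral (- (contour_integral ?c (?d Y) - contour_integral ?c (?d 0)))) {0..1}"
    by (simp add: has_contour_integral)
  moreover have "(of_nat k * ?c \<theta> ^ (k - 1) * L Y (?c \<theta>)) * vector_derivative ?c (at \<theta>)
      = 2 * pi * \<i> * of_nat k * (?c \<theta> ^ k * L Y (?c \<theta>))" for \<theta>
  proof -
    have "vector_derivative ?c (at \<theta>) = 2 * pi * \<i> * ?c \<theta>"
      unfolding vector_derivative_circlepath by (simp add: circlepath)
    \<comment> \<open>For \<open>k = 0\<close> the truncated exponent \<open>k - 1\<close> does no
      harm, since the factor \<open>of_nat k\<close> vanishes.\<close>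
    then show ?thesis by (cases k) simp_all
  qed
  ultimately have "((\<lambda>\<theta>. 2 * pi * \<i> * of_nat k * (?c \<theta> ^ k * L Y (?c \<theta>)))
      has_integral (- (contour_integral ?c (?d Y) - contour_integral ?c (?d 0)))) {0..1}"
    by (simp only:)
  then have "integral {0..1} (\<lambda>\<theta>. 2 * pi * \<i> * of_nat k * (?c \<theta> ^ k * L Y (?c \<theta>)))
      = - (contour_integral ?c (?d Y) - contour_integral ?c (?d 0))"
    by (rule integral_unique)
  then show ?thesis by (simp add: J_def mult.assoc)
qed

text \<open>The summand \<open>4 * 0 ^ k\<close> is the power sum at \<open>Y = 0\<close>, where the
  origin is the only zero. For \<open>k = 0\<close>, where \<open>J\<close> vanishes, the equation
  says that the disc keeps four zeros.\<close>

lemma power_sums: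
  assumes Y: "Y \<in> ball 0 \<delta>"
  shows "(\<Sum>p\<in>{w \<in> ball 0 r. F w Y = 0}. of_int (zorder (\<lambda>t. F t Y) p) * p ^ k)
    = J k Y + 4 * 0 ^ k"
proof -
  have 0: "0 \<in> ball 0 \<delta>" using radii by simp
  have zeros0: "{w \<in> ball 0 r. F w 0 = 0} = {0}" using radii F0 Enz by auto
  have "zorder (\<lambda>t. F t 0) 0 = int 4"
    by (rule zorder_eqI[of "ball 0 \<rho>" _ E]) (use radii F0 Enz holE in auto)
  then have "contour_integral (circlepath 0 r) (\<lambda>t. deriv (\<lambda>t. F t 0) t * t ^ k / F t 0)
      = 2 * pi * \<i> * (4 * 0 ^ k)"
    using contour_integral_zeros_in_disc(2)[OF holF[OF 0] radii(1,2), of k] ratio(2)[OF _ 0] zeros0 by simp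
  moreover have "contour_integral (circlepath 0 r) (\<lambda>t. deriv (\<lambda>t. F t Y) t * t ^ k / F t Y)
      = 2 * pi * \<i> * (\<Sum>p\<in>{w \<in> ball 0 r. F w Y = 0}. of_int (zorder (\<lambda>t. F t Y) p) * p ^ k)"
    using contour_integral_zeros_in_disc(2)[OF holF[OF Y] radii(1,2), of k] ratio(2)[OF _ Y] by simp
  ultimately have "2 * pi * \<i> * (\<Sum>p\<in>{w \<in> ball 0 r. F w Y = 0}. of_int (zorder (\<lambda>t. F t Y) p) * p ^ k)
      = 2 * pi * \<i> * (J k Y + 4 * 0 ^ k)"
    using power_sum_difference[OF Y, of k] by (simp add: algebra_simps)
  then show ?thesis by simp
qed

lemma double_root:
  assumes Y: "Y \<in> ball 0 \<delta>" and t0: "t0 \<in> ball 0 r" "F t0 Y = 0" "deriv (\<lambda>t. F t Y) t0 = 0"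
  shows "\<exists>t1 t2. \<forall>k\<ge>1. J k Y = 2 * t0 ^ k + t1 ^ k + t2 ^ k"
proof -
  let ?Z = "{w \<in> ball 0 r. F w Y = 0}" and ?f = "\<lambda>t. F t Y"
  have fin: "finite ?Z"
    using contour_integral_zeros_in_disc(1)[OF holF[OF Y] radii(1,2)] ratio(2)[OF _ Y] by simp
  \<comment> \<open>A lower bound for \<open>zorder\<close> requires a point at which the function
    does not vanish; any point of the circle will do.\<close>
  have nz: "F (of_real r) Y \<noteq> 0" "of_real r \<in> ball (0::complex) \<rho>"
    using ratio(2)[of "of_real r"] Y radii by auto
  have ge: "zorder ?f p \<ge> n" if "p \<in> ?Z" "\<And>k. k < n \<Longrightarrow> (deriv ^^ k) ?f p = 0" for n p
    using that radii
    by (intro zorder_geI[OF _ holF[OF Y] open_ball _ _ nz(2,1)])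
      (auto intro!: holomorphic_on_imp_analytic_at[OF holF[OF Y]])
  have "\<exists>t1 t2. \<forall>k. (\<Sum>p\<in>?Z. of_int (zorder ?f p) * p ^ k) = 2 * t0 ^ k + t1 ^ k + t2 ^ k"
  proof (rule power_sums_double_root[OF fin])
    show "t0 \<in> ?Z" using t0 by simp
    show "zorder ?f p \<ge> 0" if "p \<in> ?Z" for p using ge[OF that, of 0] by simp
    have "(deriv ^^ k) ?f t0 = 0" if "k < 2" for k
      using that t0 by (auto simp: less_2_cases_iff)
    from ge[of t0 2, OF _ this] show "2 \<le> zorder ?f t0" using t0 by simp
    have "of_int (\<Sum>p\<in>?Z. zorder ?f p) = (of_int 4 :: complex)"
      using power_sums[OF Y, of 0] by (simp add: J_def)
    then show "(\<Sum>p\<in>?Z. zorder ?f p) = 4" by (simp only: of_int_eq_iff)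
  qed
  then obtain t1 t2 where "\<And>k. J k Y + 4 * 0 ^ k = 2 * t0 ^ k + t1 ^ k + t2 ^ k"
    using power_sums[OF Y] by auto
  then have "J k Y = 2 * t0 ^ k + t1 ^ k + t2 ^ k" if "k \<ge> 1" for k
    using that by (metis add.right_neutral mult_zero_right not_one_le_zero power_0_left)
  then show ?thesis by blast
qed

section \<open>Coefficients of the centred quartic as functions of the parameter\<close>

definition s :: "nat \<Rightarrow> 'a \<Rightarrow> real" where "s k Y = Re (J k Y)"

definition mean :: "'a \<Rightarrow> real" where "mean Y = s 1 Y / 4"

text \<open>The coefficients of the quartic translated by the mean of its roots, which Newton's
  identities express through the power sums.\<close>

definition e2 :: "'a \<Rightarrow> real" where "e2 Y = (s 1 Y ^ 2 / 4 - s 2 Y) / 2"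

definition e3 :: "'a \<Rightarrow> real" where
  "e3 Y = (s 3 Y - 3 / 4 * s 1 Y * s 2 Y + s 1 Y ^ 3 / 8) / 3"

definition e4 :: "'a \<Rightarrow> real" where
  "e4 Y = e2 Y ^ 2 / 2 - (s 4 Y - s 1 Y * s 3 Y + 3 / 8 * s 1 Y ^ 2 * s 2 Y - 3 / 64 * s 1 Y ^ 4) / 4"

lemma of_real_s: "Y \<in> ball 0 \<delta> \<Longrightarrow> of_real (s k Y) = J k Y"
  using J_real by (simp add: s_def)

lemma Ck_on_s: "Ck_on n (ball 0 \<delta>) (s k)"
  unfolding s_def by (rule Ck_on_bounded_linear[OF open_ball bounded_linear_Re Ck_on_J])

lemma Ck_on_coefficients:
  "Ck_on n (ball 0 \<delta>) mean" "Ck_on n (ball 0 \<delta>) e2" "Ck_on n (ball 0 \<delta>) e3" "Ck_on n (ball 0 \<delta>) e4"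
proof -
  note Ck = Ck_on_add Ck_on_diff Ck_on_mult Ck_on_const Ck_on_s open_ball
  show "Ck_on n (ball 0 \<delta>) mean" "Ck_on n (ball 0 \<delta>) e3"
    unfolding mean_def[abs_def] e3_def[abs_def] divide_inverse power2_eq_square power3_eq_cube
    by (intro Ck)+
  show 2: "Ck_on n (ball 0 \<delta>) e2"
    unfolding e2_def[abs_def] divide_inverse power2_eq_square by (intro Ck)
  then show "Ck_on n (ball 0 \<delta>) e4"
    unfolding e4_def[abs_def] divide_inverse power2_eq_square power4_eq_xxxx by (intro Ck)
qed

lemma s_0: "s k 0 = 0"
proof -
  have "L 0 (circlepath 0 r \<theta>) = 0" for \<theta>
    using on_circle(2)[OF norm_circlepath] by (simp add: L_def)
  then show ?thesis by (simp add: s_def J_def)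
qed

lemma coefficients_0: "mean 0 = 0" "e2 0 = 0" "e3 0 = 0" "e4 0 = 0"
  by (simp_all add: mean_def e2_def e3_def e4_def s_0)

text \<open>Near 0 the function \<open>J k\<close> agrees with its real part, so the derivative of
  \<open>s k\<close> still carries the full complex Taylor coefficient.\<close>

lemma s_has_derivative:
  assumes k: "1 \<le> k" "k \<le> 4"
  obtains s' where "(s k has_derivative s') (at 0)"
    "\<And>V. of_real (s' V) = - of_nat k * ((deriv ^^ (4 - k)) (\<lambda>t. D V t / E t) 0 / fact (4 - k))"
proof -
  define J' where "J' V = - of_nat k * ((deriv ^^ (4 - k)) (\<lambda>t. D V t / E t) 0 / fact (4 - k))" for V
  have J': "(J k has_derivative J') (at 0)"
    using J_has_derivative[OF k] by (simp add: J'_def[abs_def])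
  have s': "(s k has_derivative (\<lambda>V. Re (J' V))) (at 0)"
    unfolding s_def by (rule bounded_linear.has_derivative[OF bounded_linear_Re J'])
  then have "((\<lambda>Y. of_real (s k Y)) has_derivative (\<lambda>V. complex_of_real (Re (J' V)))) (at 0)"
    by (rule bounded_linear.has_derivative[OF bounded_linear_of_real])
  then have "(J k has_derivative (\<lambda>V. complex_of_real (Re (J' V)))) (at 0)"
    by (rule has_derivative_transform_within_open[OF _ open_ball, of _ _ _ _ 0 \<delta>])
      (use radii of_real_s in auto)
  from has_derivative_unique[OF this J'] have "of_real (Re (J' V)) = J' V" for V by metis
  with s' that show ?thesis by (simp add: J'_def)
qed

text \<open>All power sums vanish at 0, so only their linear occurrences survive:
  \<open>e2'\<close>, \<open>e3'\<close>, \<open>e4'\<close> are \<open>-1/2\<close>,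
  \<open>1/3\<close>, \<open>-1/4\<close> times the derivatives of \<open>s 2\<close>,
  \<open>s 3\<close>, \<open>s 4\<close>. These are multiples of the Taylor coefficients of
  \<open>D V / E\<close> of orders 2, 1 and 0.\<close>

lemma coefficients_have_derivative:
  obtains m' e2' e3' e4' where "(mean has_derivative m') (at 0)" "(e2 has_derivative e2') (at 0)"
    "(e3 has_derivative e3') (at 0)" "(e4 has_derivative e4') (at 0)"
    "\<And>V k. e2' V = 0 \<Longrightarrow> e3' V = 0 \<Longrightarrow> e4' V = 0 \<Longrightarrow> k \<le> 2 \<Longrightarrow> (deriv ^^ k) (\<lambda>t. D V t / E t) 0 = 0"
proof -
  obtain s1 where s1: "(s 1 has_derivative s1) (at 0)" using s_has_derivative[of 1] by auto
  obtain s2 where s2: "(s 2 has_derivative s2) (at 0)"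
    "\<And>V. of_real (s2 V) = - of_nat 2 * ((deriv ^^ 2) (\<lambda>t. D V t / E t) 0 / fact 2)"
    using s_has_derivative[of 2] by auto
  obtain s3 where s3: "(s 3 has_derivative s3) (at 0)"
    "\<And>V. of_real (s3 V) = - of_nat 3 * ((deriv ^^ 1) (\<lambda>t. D V t / E t) 0 / fact 1)"
    using s_has_derivative[of 3] by auto
  obtain s4 where s4: "(s 4 has_derivative s4) (at 0)"
    "\<And>V. of_real (s4 V) = - of_nat 4 * ((deriv ^^ 0) (\<lambda>t. D V t / E t) 0 / fact 0)"
    using s_has_derivative[of 4] by auto
  have e2': "(e2 has_derivative (\<lambda>V. - s2 V / 2)) (at 0)"
    unfolding e2_def[abs_def] by (rule derivative_eq_intros s1 s2(1) refl | simp add: s_0)+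
  show ?thesis
  proof
    show "(mean has_derivative (\<lambda>V. s1 V / 4)) (at 0)"
      unfolding mean_def[abs_def] by (rule derivative_eq_intros s1 refl | simp)+
    show "(e2 has_derivative (\<lambda>V. - s2 V / 2)) (at 0)" by (rule e2')
    show "(e3 has_derivative (\<lambda>V. s3 V / 3)) (at 0)"
      unfolding e3_def[abs_def] by (rule derivative_eq_intros s1 s2(1) s3(1) refl | simp add: s_0)+
    show "(e4 has_derivative (\<lambda>V. - s4 V / 4)) (at 0)"
      unfolding e4_def[abs_def]
      by (rule derivative_eq_intros s1 s2(1) s3(1) s4(1) e2' refl | simp add: s_0 coefficients_0)+
    fix V k
    assume "- s2 V / 2 = 0" "s3 V / 3 = 0" "- s4 V / 4 = 0" "k \<le> (2::nat)"
    moreover from this have "k = 0 \<or> k = 1 \<or> k = 2" by auto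
    ultimately show "(deriv ^^ k) (\<lambda>t. D V t / E t) 0 = 0"
      using s2(2)[of V] s3(2)[of V] s4(2)[of V] by auto
  qed
qed

text \<open>If the roots are \<open>t0, t0, t1, t2\<close>, the centred quartic is
  \<open>(t - u)\<^sup>2 (t\<^sup>2 + 2ut + q)\<close>; comparing coefficients gives the components of \<^const>\<open>f_sw\<close>.\<close>

lemma swallowtail_coefficients:
  assumes Y: "Y \<in> ball 0 \<delta>" and t0: "\<bar>t0\<bar> < r" "F (of_real t0) Y = 0" "deriv (\<lambda>t. F t Y) (of_real t0) = 0"
  defines "u \<equiv> t0 - mean Y"
  shows "e4 Y = 3 * u ^ 4 + u ^ 2 * e2 Y" "e3 Y = 4 * u ^ 3 + 2 * u * e2 Y"
proof -
  define t where "t = complex_of_real t0"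
  obtain t1 t2 where J: "\<And>k. k \<ge> 1 \<Longrightarrow> complex_of_real (s k Y) = 2 * t ^ k + t1 ^ k + t2 ^ k"
    using double_root[OF Y, of "of_real t0"] t0 of_real_s[OF Y] by (auto simp: t_def)
  have J1: "complex_of_real (s (Suc 0) Y) = 2 * t + t1 + t2" using J[of 1] by simp
  have "complex_of_real (e4 Y) = complex_of_real (3 * u ^ 4 + u ^ 2 * e2 Y)"
    unfolding e4_def e2_def u_def mean_def using J1
    by (simp add: J t_def[symmetric]) (simp add: field_simps, algebra)
  then show "e4 Y = 3 * u ^ 4 + u ^ 2 * e2 Y" by (simp only: of_real_eq_iff)
  have "complex_of_real (e3 Y) = complex_of_real (4 * u ^ 3 + 2 * u * e2 Y)"
    unfolding e3_def e2_def u_def mean_def using J1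
    by (simp add: J t_def[symmetric]) (simp add: field_simps, algebra)
  then show "e3 Y = 4 * u ^ 3 + 2 * u * e2 Y" by (simp only: of_real_eq_iff)
qed

end

section \<open>The normal form of a swallowtail germ\<close>

text \<open>For real \<open>t\<close> this is \<open>Re (f (c + it))\<close>; it extends that function holomorphically in \<open>t\<close>.\<close>

definition re_ext :: "(complex \<Rightarrow> complex) \<Rightarrow> real \<Rightarrow> complex \<Rightarrow> complex" where
  "re_ext f c t = (f (of_real c + \<i> * t) + cnj (f (of_real c + \<i> * cnj t))) / 2"

lemma re_ext_of_real: "re_ext f c (of_real t) = of_real (Re (f (Complex c t)))"
proof -
  have "of_real c + \<i> * of_real t = Complex c t" by (simp add: complex_eq_iff)
  then show ?thesis
    unfolding re_ext_def complex_cnj_complex_of_real by (simp add: complex_add_cnj)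
qed

lemma re_ext_cnj: "re_ext f c (cnj t) = cnj (re_ext f c t)"
  by (simp add: re_ext_def)

text \<open>The radius \<open>d / 2\<close> used from here on comes from this: two summands below
  \<open>d / 2\<close> stay below \<open>d\<close> together.\<close>

lemma strip_in_ball:
  assumes "\<bar>c\<bar> < d / 2" "t \<in> ball 0 (d / 2)"
  shows "of_real c + \<i> * t \<in> ball (0::complex) d" "of_real c + \<i> * cnj t \<in> ball (0::complex) d"
proof -
  have "cmod (of_real c + \<i> * w) < d" if "cmod w < d / 2" for w
    using norm_triangle_ineq[of "of_real c" "\<i> * w"] assms(1) that by (simp add: norm_mult)
  from this[of t] this[of "cnj t"] show "of_real c + \<i> * t \<in> ball (0::complex) d"
    "of_real c + \<i> * cnj t \<in> ball (0::complex) d" using assms(2) by auto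
qed

lemma re_ext_has_field_derivative:
  assumes "f holomorphic_on ball 0 d" "\<bar>c\<bar> < d / 2" "t \<in> ball 0 (d / 2)"
  shows "(re_ext f c has_field_derivative re_ext (\<lambda>z. \<i> * deriv f z) c t) (at t)"
proof -
  note b = strip_in_ball[OF assms(2,3)]
  let ?g = "\<lambda>t. f (of_real c + \<i> * t)"
  have g: "(?g has_field_derivative deriv f (of_real c + \<i> * w) * \<i>) (at w)"
    if "of_real c + \<i> * w \<in> ball 0 d" for w
    by (rule DERIV_chain2[where f = f and g = "\<lambda>t. of_real c + \<i> * t", OF holomorphic_derivI[OF assms(1) open_ball that]])
      (auto intro!: derivative_eq_intros)
  have "(cnj \<circ> ?g \<circ> cnj has_field_derivative cnj (deriv f (of_real c + \<i> * cnj t) * \<i>)) (at t)"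
    by (rule has_field_derivative_cnj_cnj[OF g[OF b(2)]])
  then have "((\<lambda>t. cnj (?g (cnj t))) has_field_derivative cnj (deriv f (of_real c + \<i> * cnj t) * \<i>)) (at t)"
    by (simp add: o_def)
  from DERIV_cdivide[OF DERIV_add[OF g[OF b(1)] this], of 2] show ?thesis
    by (simp add: re_ext_def[abs_def] mult.commute)
qed

lemma holomorphic_on_re_ext:
  assumes "f holomorphic_on ball 0 d" "\<bar>c\<bar> < d / 2"
  shows "re_ext f c holomorphic_on ball 0 (d / 2)"
  using re_ext_has_field_derivative[OF assms] unfolding holomorphic_on_open[OF open_ball] by blast

lemma higher_deriv_re_ext:
  assumes "f holomorphic_on ball 0 d" "\<bar>c\<bar> < d / 2" "t \<in> ball 0 (d / 2)"
  shows "(deriv ^^ k) (re_ext f c) t = re_ext (\<lambda>z. \<i> ^ k * (deriv ^^ k) f z) c t"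
  using assms(3)
proof (induction k arbitrary: t)
  case (Suc k)
  let ?f = "\<lambda>z. \<i> ^ k * (deriv ^^ k) f z"
  have hol: "(deriv ^^ k) f holomorphic_on ball 0 d"
    using assms(1) by (simp add: holomorphic_higher_deriv)
  have "(deriv ^^ Suc k) (re_ext f c) t = deriv (re_ext ?f c) t"
    by (simp, rule deriv_cong_ev[OF eventually_mono[OF eventually_nhds_in_open[OF open_ball Suc.prems]] refl])
      (rule Suc.IH)
  also have "\<dots> = re_ext (\<lambda>z. \<i> * deriv ?f z) c t"
    by (intro DERIV_imp_deriv re_ext_has_field_derivative[OF _ assms(2) Suc.prems]
        holomorphic_on_mult[OF holomorphic_on_const hol])
  also have "\<dots> = re_ext (\<lambda>z. \<i> ^ Suc k * (deriv ^^ Suc k) f z) c t"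
  proof -
    have "deriv ?f w = \<i> ^ k * (deriv ^^ Suc k) f w" if "w \<in> ball 0 d" for w
      using holomorphic_on_imp_differentiable_at[OF hol open_ball that] by simp
    then show ?thesis
      unfolding re_ext_def using strip_in_ball[OF assms(2) Suc.prems] by (simp add: mult.assoc)
  qed
  finally show ?case .
qed simp

text \<open>Each differentiation in \<open>t\<close> brings a factor \<open>i\<close>, so that odd
  derivatives see imaginary parts and even ones real parts.\<close>

lemma higher_deriv_re_ext_0:
  assumes "f holomorphic_on ball 0 d" "0 < d"
  shows "(deriv ^^ k) (re_ext f 0) 0 = of_real (Re (\<i> ^ k * (deriv ^^ k) f 0))"
proof -
  have "re_ext g 0 0 = of_real (Re (g 0))" for g
    by (simp add: re_ext_def complex_add_cnj)
  then show ?thesis using higher_deriv_re_ext[OF assms(1), of 0 0 k] assms(2) by simp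
qed

lemma re_ext_has_derivative_param:
  fixes Y :: "real ^ 'n"
  assumes "f holomorphic_on ball 0 d" "\<bar>Y $ j\<bar> < d / 2" "t \<in> ball 0 (d / 2)"
  shows "((\<lambda>Y. re_ext f (Y $ j) t) has_derivative (\<lambda>V. of_real (V $ j) * re_ext (deriv f) (Y $ j) t)) (at Y)"
proof -
  note b = strip_in_ball[OF assms(2,3)]
  have g: "((\<lambda>Y. f (of_real (Y $ j) + \<i> * w)) has_derivative
      (\<lambda>V. deriv f (of_real (Y $ j) + \<i> * w) * of_real (V $ j))) (at Y)"
    if "of_real (Y $ j) + \<i> * w \<in> ball 0 d" for w
  proof -
    have "((\<lambda>Y. of_real (Y $ j) + \<i> * w) has_derivative (\<lambda>V. of_real (V $ j))) (at Y)"
      by (auto intro!: derivative_eq_intros bounded_linear_imp_has_derivative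
          bounded_linear_compose[OF bounded_linear_of_real bounded_linear_vec_nth])
    from diff_chain_at[OF this holomorphic_derivI[OF assms(1) open_ball that,
          unfolded has_field_derivative_def]]
    show ?thesis by (simp add: o_def)
  qed
  have "((\<lambda>Y. (f (of_real (Y $ j) + \<i> * t) + cnj (f (of_real (Y $ j) + \<i> * cnj t))) / 2) has_derivative
    (\<lambda>V. (deriv f (of_real (Y $ j) + \<i> * t) * of_real (V $ j)
      + cnj (deriv f (of_real (Y $ j) + \<i> * cnj t) * of_real (V $ j))) / 2)) (at Y)"
    by (intro bounded_linear.has_derivative[OF bounded_linear_divide] has_derivative_add g b
        bounded_linear.has_derivative[OF bounded_linear_cnj])
  then show ?thesis by (simp add: re_ext_def field_simps)
qed

lemma Ck_on_re_ext:
  fixes j :: "'n::finite"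
  assumes f: "f holomorphic_on ball 0 d"
  shows "Ck_on k (ball (0::real ^ 'n) (d / 2) \<times> ball 0 (d / 2)) (\<lambda>p. re_ext f (fst p $ j) (snd p))"
proof -
  let ?S = "ball (0::real ^ 'n) (d / 2) \<times> ball (0::complex) (d / 2)"
  have o: "open ?S" by (simp add: open_Times)
  have c: "\<bar>fst p $ j\<bar> < d / 2" "snd p \<in> ball 0 (d / 2)" if "p \<in> ?S" for p
    using that component_le_norm_cart[of "fst p" j] by (auto simp del: mem_ball)
  have bl: "bounded_linear (\<lambda>p::(real ^ 'n) \<times> complex. complex_of_real (fst p $ j) + \<i> * snd p)"
    "bounded_linear (\<lambda>p::(real ^ 'n) \<times> complex. complex_of_real (fst p $ j) + \<i> * cnj (snd p))"
    by (intro bounded_linear_intros bounded_linear_compose[OF bounded_linear_of_real]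
        bounded_linear_compose[OF bounded_linear_vec_nth] bounded_linear_compose[OF bounded_linear_cnj])+
  have "Ck_on k ?S (\<lambda>p. f (of_real (fst p $ j) + \<i> * snd p))"
    "Ck_on k ?S (\<lambda>p. f (of_real (fst p $ j) + \<i> * cnj (snd p)))"
    using strip_in_ball[OF c]
    by (intro Ck_on_compose[OF o open_ball Ck_on_holomorphic[OF open_ball f] Ck_on_linear[OF o]] bl; blast)+
  then show ?thesis
    unfolding re_ext_def
    by (intro Ck_on_bounded_linear[OF o bounded_linear_divide] Ck_on_add o Ck_on_bounded_linear[OF o bounded_linear_cnj])
qed

text \<open>\<open>n1\<close> and \<open>n2\<close> depend on \<open>\<xi>\<close> and are rotated
  about the third axis so that their value at the base point is \<open>(1, 0)\<close>. The singular
  curve lies in the zero set of \<open>Im n2\<close>. Hence \<open>Re (deriv n2 0) = 0\<close> is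
  its tangency with the imaginary null direction, \<open>Im (deriv n2 0) \<noteq> 0\<close> the
  regularity of the normal, and the last hypothesis the simplicity of the tangency.\<close>

locale maxface_germ =
  fixes n1 n2 N1 N2 :: "complex \<Rightarrow> complex" and d :: real
  assumes d: "0 < d"
    and hol: "n1 holomorphic_on ball 0 d" "n2 holomorphic_on ball 0 d"
    and prim: "\<And>z. z \<in> ball 0 d \<Longrightarrow> (N1 has_field_derivative n1 z) (at z)"
      "\<And>z. z \<in> ball 0 d \<Longrightarrow> (N2 has_field_derivative n2 z) (at z)"
    and prim_0: "N1 0 = 0" "N2 0 = 0"
    and unit: "\<And>z. z \<in> ball 0 d \<Longrightarrow> (n1 z)\<^sup>2 + (n2 z)\<^sup>2 = 1"
    and n_0: "n1 0 = 1" "n2 0 = 0"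
    and n2': "Re (deriv n2 0) = 0" "Im (deriv n2 0) \<noteq> 0"
    and n2'': "Im ((deriv ^^ 2) n2 0) \<noteq> 0"
begin

definition surf :: "complex \<Rightarrow> real ^ 3" where
  "surf \<xi> = vector [Re (N1 \<xi>), Re (N2 \<xi>), Re \<xi>]"

text \<open>For real \<open>t\<close>, the section of the zero set of \<open>F t\<close> by \<open>Y $ 3 = c\<close> is the line tangent at
  \<open>surf (c + it)\<close> to the section of the maxface, which is thus an envelope.\<close>

definition F :: "complex \<Rightarrow> real ^ 3 \<Rightarrow> complex" where
  "F t Y = re_ext n1 (Y $ 3) t * (of_real (Y $ 1) - re_ext N1 (Y $ 3) t)
    + re_ext n2 (Y $ 3) t * (of_real (Y $ 2) - re_ext N2 (Y $ 3) t)"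

text \<open>The derivative of \<open>F t\<close> at the origin in direction \<open>V\<close>. The
  third coordinate enters through all four extended functions, and the squares arise because
  \<open>N1\<close>, \<open>N2\<close> have derivatives \<open>n1\<close>,
  \<open>n2\<close>.\<close>

definition D :: "real ^ 3 \<Rightarrow> complex \<Rightarrow> complex" where
  "D V t = of_real (V $ 1) * re_ext n1 0 t + of_real (V $ 2) * re_ext n2 0 t
    - of_real (V $ 3) * (re_ext (deriv n1) 0 t * re_ext N1 0 t + re_ext n1 0 t * re_ext n1 0 t
      + re_ext (deriv n2) 0 t * re_ext N2 0 t + re_ext n2 0 t * re_ext n2 0 t)"

section \<open>Taylor coefficients of the generating family at the origin\<close>

lemma holN: "N1 holomorphic_on ball 0 d" "N2 holomorphic_on ball 0 d"
  using prim unfolding holomorphic_on_open[OF open_ball] by blast+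

lemma deriv_N: "z \<in> ball 0 d \<Longrightarrow> deriv N1 z = n1 z" "z \<in> ball 0 d \<Longrightarrow> deriv N2 z = n2 z"
  using prim by (auto intro: DERIV_imp_deriv)

lemma higher_deriv_N: "(deriv ^^ Suc k) N1 0 = (deriv ^^ k) n1 0" "(deriv ^^ Suc k) N2 0 = (deriv ^^ k) n2 0"
proof -
  have "0 \<in> ball (0::complex) d" using d by simp
  note ev = eventually_mono[OF eventually_nhds_in_open[OF open_ball this]]
  have "(deriv ^^ k) (deriv N1) 0 = (deriv ^^ k) n1 0" "(deriv ^^ k) (deriv N2) 0 = (deriv ^^ k) n2 0"
    by (rule higher_deriv_cong_ev[OF ev refl], erule deriv_N)+
  then show "(deriv ^^ Suc k) N1 0 = (deriv ^^ k) n1 0" "(deriv ^^ Suc k) N2 0 = (deriv ^^ k) n2 0"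
    by (simp_all only: funpow_Suc_right o_def)
qed

text \<open>Leibniz' rule is applied to \<open>n1^2 + n2^2 = 1\<close> up to order three. As
  \<open>n1 0 = 1\<close> and \<open>n2 0 = 0\<close>, each order determines the top derivative of
  \<open>n1\<close> from lower derivatives of \<open>n2\<close>.\<close>

lemma n_derivs:
  "deriv n1 0 = 0" "(deriv ^^ 2) n1 0 = - (deriv n2 0)\<^sup>2"
  "(deriv ^^ 3) n1 0 = - 3 * deriv n2 0 * (deriv ^^ 2) n2 0"
proof -
  have 0: "0 \<in> ball (0::complex) d" using d by simp
  have hol2: "(\<lambda>z. n1 z * n1 z) holomorphic_on ball 0 d" "(\<lambda>z. n2 z * n2 z) holomorphic_on ball 0 d"
    using hol by (auto intro!: holomorphic_intros)
  have "(deriv ^^ k) (\<lambda>z. n1 z * n1 z + n2 z * n2 z) 0 = (deriv ^^ k) (\<lambda>z. 1) 0" for k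
    using unit by (intro higher_deriv_cong_ev eventually_mono[OF eventually_nhds_in_open[OF open_ball 0]])
      (auto simp: power2_eq_square)
  then have *: "(\<Sum>i = 0..k. of_nat (k choose i) * (deriv ^^ i) n1 0 * (deriv ^^ (k - i)) n1 0)
      + (\<Sum>i = 0..k. of_nat (k choose i) * (deriv ^^ i) n2 0 * (deriv ^^ (k - i)) n2 0) = 0" if "k > 0" for k
    using that by (simp add: higher_deriv_add[OF hol2 open_ball 0] higher_deriv_mult[OF hol(1) hol(1) open_ball 0]
        higher_deriv_mult[OF hol(2) hol(2) open_ball 0])
  show 1: "deriv n1 0 = 0" using *[of 1] by (simp add: n_0)
  show 2: "(deriv ^^ 2) n1 0 = - (deriv n2 0)\<^sup>2"
  proof -
    have "2 * (deriv ^^ 2) n1 0 + 2 * (deriv n2 0)\<^sup>2 = 0"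
      using *[of 2] by (simp add: n_0 1 numeral_2_eq_2 power2_eq_square algebra_simps)
    then have "2 * ((deriv ^^ 2) n1 0 + (deriv n2 0)\<^sup>2) = 0" by (simp only: distrib_left)
    then have "(deriv ^^ 2) n1 0 + (deriv n2 0)\<^sup>2 = 0" by (metis mult_eq_0_iff zero_neq_numeral)
    then show ?thesis by (simp add: eq_neg_iff_add_eq_0)
  qed
  show "(deriv ^^ 3) n1 0 = - 3 * deriv n2 0 * (deriv ^^ 2) n2 0"
  proof -
    have "2 * (deriv ^^ 3) n1 0 + 2 * (3 * (deriv n2 0 * (deriv ^^ 2) n2 0)) = 0"
      using *[of 3] by (simp add: n_0 1 numeral_2_eq_2 numeral_3_eq_3 algebra_simps)
    then have "2 * ((deriv ^^ 3) n1 0 + 3 * (deriv n2 0 * (deriv ^^ 2) n2 0)) = 0"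
      by (simp only: distrib_left)
    then have "(deriv ^^ 3) n1 0 + 3 * (deriv n2 0 * (deriv ^^ 2) n2 0) = 0"
      by (metis mult_eq_0_iff zero_neq_numeral)
    then show ?thesis by (simp add: eq_neg_iff_add_eq_0 mult.assoc)
  qed
qed

abbreviation "R1 \<equiv> re_ext n1 0"
abbreviation "R2 \<equiv> re_ext n2 0"
abbreviation "M1 \<equiv> re_ext N1 0"
abbreviation "M2 \<equiv> re_ext N2 0"

lemma R_derivs:
  "R1 0 = 1" "R2 0 = 0" "deriv R1 0 = 0" "deriv R2 0 = - of_real (Im (deriv n2 0))"
  "(deriv ^^ 2) R1 0 = - of_real ((Im (deriv n2 0))\<^sup>2)"
proof -
  note r = higher_deriv_re_ext_0[OF hol(1) d] higher_deriv_re_ext_0[OF hol(2) d]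
  show "R1 0 = 1" "R2 0 = 0" using r[of 0] by (simp_all add: n_0)
  show "deriv R1 0 = 0" using r(1)[of 1] by (simp add: n_derivs)
  show "deriv R2 0 = - of_real (Im (deriv n2 0))" using r(2)[of 1] by simp
  show "(deriv ^^ 2) R1 0 = - of_real ((Im (deriv n2 0))\<^sup>2)"
    using r(1)[of 2] by (simp add: n_derivs n2' power2_eq_square)
qed

text \<open>The section of the surface by the plane through the base point is the curve
  \<open>(M1 t, M2 t)\<close>, with velocity \<open>- Im n\<close>. It is a cusp: \<open>M2\<close>
  starts at order three and \<open>M1\<close> at order four.\<close>

lemma M_derivs:
  "M1 0 = 0" "M2 0 = 0" "deriv M1 0 = 0" "deriv M2 0 = 0"
  "(deriv ^^ 2) M1 0 = 0" "(deriv ^^ 2) M2 0 = 0" "(deriv ^^ 3) M1 0 = 0"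
  "(deriv ^^ 3) M2 0 = of_real (Im ((deriv ^^ 2) n2 0))"
  "(deriv ^^ 4) M1 0 = of_real (3 * Im (deriv n2 0) * Im ((deriv ^^ 2) n2 0))"
proof -
  note r = higher_deriv_re_ext_0[OF holN(1) d] higher_deriv_re_ext_0[OF holN(2) d]
  note s = higher_deriv_N[of 0] higher_deriv_N[of 1] higher_deriv_N[of 2] higher_deriv_N[of 3]
  show "M1 0 = 0" "M2 0 = 0" using r[of 0] by (simp_all add: prim_0)
  show "deriv M1 0 = 0" "deriv M2 0 = 0" using r[of 1] s by (simp_all add: n_0)
  show "(deriv ^^ 2) M1 0 = 0" "(deriv ^^ 2) M2 0 = 0"
    using r[of 2] s by (simp_all add: n_derivs n2' numeral_2_eq_2)
  show "(deriv ^^ 3) M1 0 = 0" "(deriv ^^ 3) M2 0 = of_real (Im ((deriv ^^ 2) n2 0))"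
    using r[of 3] s(5,6) n_derivs(2) n2' by (simp_all add: eval_nat_numeral)
  have "\<i> ^ 4 = (1::complex)" by (simp add: eval_nat_numeral)
  moreover have "(deriv ^^ 4) N1 0 = (deriv ^^ 3) n1 0"
  proof -
    have "4 = Suc 3" by simp
    then show ?thesis using higher_deriv_N(1)[of 3] by metis
  qed
  ultimately show "(deriv ^^ 4) M1 0 = of_real (3 * Im (deriv n2 0) * Im ((deriv ^^ 2) n2 0))"
    using r(1)[of 4] by (simp add: n_derivs(3) n2')
qed

lemma nonneg_half: "\<bar>0\<bar> < d / 2" using d by simp

lemma holRM:
  "R1 holomorphic_on ball 0 (d / 2)" "R2 holomorphic_on ball 0 (d / 2)"
  "M1 holomorphic_on ball 0 (d / 2)" "M2 holomorphic_on ball 0 (d / 2)"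
  using holomorphic_on_re_ext[OF _ nonneg_half] hol holN by auto

lemma F_at_0: "F t 0 = - (R1 t * M1 t + R2 t * M2 t)"
  by (simp add: F_def)

text \<open>With \<open>a = Im (deriv n2 0)\<close> and \<open>b = Im ((deriv ^^ 2) n2 0)\<close>,
  just two Leibniz terms of order four survive: \<open>3ab\<close> from the fourth derivative of
  \<open>M1\<close>, and \<open>-4ab\<close> from the first of \<open>R2\<close> times the third of
  \<open>M2\<close>. The sign in \<open>F_at_0\<close> turns their sum into
  \<open>ab\<close>.\<close>

lemma F_derivs_0:
  "k < 4 \<Longrightarrow> (deriv ^^ k) (\<lambda>t. F t 0) 0 = 0"
  "(deriv ^^ 4) (\<lambda>t. F t 0) 0 = of_real (Im (deriv n2 0) * Im ((deriv ^^ 2) n2 0))"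
proof -
  have 0: "0 \<in> ball (0::complex) (d / 2)" using d by simp
  have 1: "(\<lambda>t. R1 t * M1 t) holomorphic_on ball 0 (d / 2)" "(\<lambda>t. R2 t * M2 t) holomorphic_on ball 0 (d / 2)"
    using holRM by (auto intro: holomorphic_on_mult)
  then have 2: "(\<lambda>t. R1 t * M1 t + R2 t * M2 t) holomorphic_on ball 0 (d / 2)"
    by (rule holomorphic_on_add)
  have *: "(deriv ^^ k) (\<lambda>t. F t 0) 0
      = - ((\<Sum>i = 0..k. of_nat (k choose i) * (deriv ^^ i) R1 0 * (deriv ^^ (k - i)) M1 0)
        + (\<Sum>i = 0..k. of_nat (k choose i) * (deriv ^^ i) R2 0 * (deriv ^^ (k - i)) M2 0))" for k
    unfolding F_at_0
    by (simp only: higher_deriv_uminus[OF 2 open_ball 0] higher_deriv_add[OF 1 open_ball 0]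
        higher_deriv_mult[OF holRM(1,3) open_ball 0] higher_deriv_mult[OF holRM(2,4) open_ball 0])
  note d = R_derivs M_derivs
  show "(deriv ^^ k) (\<lambda>t. F t 0) 0 = 0" if "k < 4" for k
  proof -
    have "k = 0 \<or> k = 1 \<or> k = 2 \<or> k = 3" using that by auto
    then show ?thesis
    using *[of 0] *[of 1] *[of 2] *[of 3] d
    by (auto simp: numeral_2_eq_2 numeral_3_eq_3)
  qed
  have sum4: "(\<Sum>i = 0..4. f i) = f 0 + f 1 + f 2 + f 3 + f (4::nat)" for f :: "nat \<Rightarrow> complex"
    by (simp add: eval_nat_numeral)
  have choose: "4 choose 1 = (4::nat)" "4 choose 3 = (4::nat)" "4 choose 2 = (6::nat)"
    by (simp_all add: eval_nat_numeral)
  show "(deriv ^^ 4) (\<lambda>t. F t 0) 0 = of_real (Im (deriv n2 0) * Im ((deriv ^^ 2) n2 0))"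
    using d unfolding *[of 4] sum4 choose by (simp add: algebra_simps)
qed

lemma F_cnj: "F (cnj t) Y = cnj (F t Y)"
  by (simp add: F_def re_ext_cnj)

lemma abs_nth_less: "Y \<in> ball (0::real ^ 3) e \<Longrightarrow> \<bar>Y $ 3\<bar> < e"
  using component_le_norm_cart[of Y 3] by simp

lemma F_holomorphic:
  assumes "Y \<in> ball 0 (d / 2)"
  shows "(\<lambda>t. F t Y) holomorphic_on ball 0 (d / 2)"
  unfolding F_def
  by (intro holomorphic_intros holomorphic_on_re_ext hol holN abs_nth_less assms)

lemma F_smooth: "Ck_on k (ball 0 (d / 2) \<times> ball 0 (d / 2)) (\<lambda>p. F (snd p) (fst p))"
proof -
  have o: "open (ball (0::real ^ 3) (d / 2) \<times> ball (0::complex) (d / 2))" by (simp add: open_Times)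
  have bl: "bounded_linear (\<lambda>p::(real ^ 3) \<times> complex. complex_of_real (fst p $ j))" for j
    by (intro bounded_linear_compose[OF bounded_linear_of_real]
        bounded_linear_compose[OF bounded_linear_vec_nth] bounded_linear_fst)
  show ?thesis
    unfolding F_def
    by (intro Ck_on_add Ck_on_diff Ck_on_mult Ck_on_re_ext hol holN Ck_on_linear bl o)
qed

lemma F_has_derivative:
  assumes "t \<in> ball 0 (d / 2)"
  shows "((\<lambda>Y. F t Y) has_derivative (\<lambda>V. D V t)) (at 0)"
proof -
  have c: "\<bar>(0::real ^ 3) $ 3\<bar> < d / 2" using d by simp
  have N: "re_ext (deriv N1) 0 t = R1 t" "re_ext (deriv N2) 0 t = R2 t"
    unfolding re_ext_def using strip_in_ball[OF nonneg_half assms] deriv_N by simp_all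
  have co: "((\<lambda>Y::real ^ 3. complex_of_real (Y $ j)) has_derivative (\<lambda>V. complex_of_real (V $ j))) (at 0)" for j
    by (intro bounded_linear_imp_has_derivative bounded_linear_compose[OF bounded_linear_of_real]
        bounded_linear_vec_nth)
  note r = re_ext_has_derivative_param[OF _ c assms]
  show ?thesis
    unfolding F_def
    by (rule derivative_eq_intros r hol holN co refl)+
      (simp add: fun_eq_iff D_def N algebra_simps)
qed

lemma D_holomorphic: "D V holomorphic_on ball 0 (d / 2)"
  unfolding D_def[abs_def]
  by (intro holomorphic_intros holRM holomorphic_on_re_ext[OF _ nonneg_half] holomorphic_deriv hol open_ball)

text \<open>Order one isolates \<open>V $ 2\<close>, order two then \<open>V $ 1\<close>, and order
  zero leaves \<open>V $ 3\<close>. The coefficient \<open>G\<close> of \<open>V $ 3\<close> has the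
  2-jet of the constant 1: so does \<open>R1^2 + R2^2\<close>, and the other products contain
  \<open>M1\<close> or \<open>M2\<close>, which start at order three or later.\<close>

lemma D_jets:
  assumes "\<And>k. k \<le> 2 \<Longrightarrow> (deriv ^^ k) (D V) 0 = 0"
  shows "V = 0"
proof -
  let ?S = "ball (0::complex) (d / 2)"
  have 0: "0 \<in> ?S" using d by simp
  let ?A1 = "re_ext (deriv n1) 0" and ?A2 = "re_ext (deriv n2) 0"
  have holA: "?A1 holomorphic_on ?S" "?A2 holomorphic_on ?S"
    by (intro holomorphic_on_re_ext[OF _ nonneg_half] holomorphic_deriv hol open_ball)+
  have h: "(\<lambda>t. ?A1 t * M1 t) holomorphic_on ?S" "(\<lambda>t. R1 t * R1 t) holomorphic_on ?S"
    "(\<lambda>t. ?A2 t * M2 t) holomorphic_on ?S" "(\<lambda>t. R2 t * R2 t) holomorphic_on ?S"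
    using holRM holA by (auto intro: holomorphic_on_mult)
  note h12 = holomorphic_on_add[OF h(1,2)] and h123 = holomorphic_on_add[OF holomorphic_on_add[OF h(1,2)] h(3)]
  define G where "G t = ?A1 t * M1 t + R1 t * R1 t + ?A2 t * M2 t + R2 t * R2 t" for t
  have holG: "G holomorphic_on ?S"
    unfolding G_def[abs_def] using holomorphic_on_add[OF h123 h(4)] .
  have "(deriv ^^ k) G 0 = (\<Sum>i = 0..k. of_nat (k choose i) * (deriv ^^ i) ?A1 0 * (deriv ^^ (k - i)) M1 0)
     + (\<Sum>i = 0..k. of_nat (k choose i) * (deriv ^^ i) R1 0 * (deriv ^^ (k - i)) R1 0)
     + (\<Sum>i = 0..k. of_nat (k choose i) * (deriv ^^ i) ?A2 0 * (deriv ^^ (k - i)) M2 0)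
     + (\<Sum>i = 0..k. of_nat (k choose i) * (deriv ^^ i) R2 0 * (deriv ^^ (k - i)) R2 0)" for k
    unfolding G_def[abs_def]
    by (simp add: higher_deriv_add[OF h123 h(4) open_ball 0] higher_deriv_add[OF h12 h(3) open_ball 0]
        higher_deriv_add[OF h(1,2) open_ball 0] higher_deriv_mult[OF holA(1) holRM(3) open_ball 0]
        higher_deriv_mult[OF holA(2) holRM(4) open_ball 0] higher_deriv_mult[OF holRM(1,1) open_ball 0]
        higher_deriv_mult[OF holRM(2,2) open_ball 0])
  from this[of 0] this[of 1] this[of 2] have G: "G 0 = 1" "deriv G 0 = 0" "(deriv ^^ 2) G 0 = 0"
    using R_derivs M_derivs by (simp_all add: numeral_2_eq_2 power2_eq_square)
  have c: "(\<lambda>t. of_real (V $ 1) * R1 t) holomorphic_on ?S" "(\<lambda>t. of_real (V $ 2) * R2 t) holomorphic_on ?S"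
    "(\<lambda>t. of_real (V $ 3) * G t) holomorphic_on ?S"
    using holRM holG by (auto intro: holomorphic_on_mult)
  have D: "D V = (\<lambda>t. of_real (V $ 1) * R1 t + of_real (V $ 2) * R2 t - of_real (V $ 3) * G t)"
    by (simp add: fun_eq_iff D_def G_def)
  have *: "of_real (V $ 1) * (deriv ^^ k) R1 0 + of_real (V $ 2) * (deriv ^^ k) R2 0
     - of_real (V $ 3) * (deriv ^^ k) G 0 = 0" if "k \<le> 2" for k
    using assms[OF that] unfolding D
    by (simp add: higher_deriv_diff[OF holomorphic_on_add[OF c(1,2)] c(3) open_ball 0]
        higher_deriv_add[OF c(1,2) open_ball 0] higher_deriv_cmult[OF _ 0 open_ball] holRM holG)
  have "V $ 2 = 0" using *[of 1] R_derivs G n2' by simp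
  moreover have "V $ 1 = 0" using *[of 2] R_derivs G n2' calculation by simp
  moreover have "V $ 3 = 0" using *[of 0] R_derivs G calculation by simp
  ultimately show "V = 0" by (simp add: vec_eq_iff forall_3)
qed

text \<open>On the surface the factors that contain \<open>Y\<close> vanish. The
  \<open>t\<close>-derivative is thus reduced to \<open>Re n \<bullet> Im n\<close>, half the
  imaginary part of \<open>n1^2 + n2^2 = 1\<close>.\<close>

lemma envelope:
  assumes "\<xi> \<in> ball 0 (d / 2)"
  shows "F (of_real (Im \<xi>)) (surf \<xi>) = 0" "deriv (\<lambda>t. F t (surf \<xi>)) (of_real (Im \<xi>)) = 0"
proof -
  let ?c = "Re \<xi>" and ?t = "complex_of_real (Im \<xi>)"
  have c: "\<bar>?c\<bar> < d / 2" and t: "?t \<in> ball 0 (d / 2)"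
    using assms abs_Re_le_cmod[of \<xi>] abs_Im_le_cmod[of \<xi>] by auto
  have xi: "\<xi> \<in> ball 0 d" using assms d by auto
  have s: "surf \<xi> $ 1 = Re (N1 \<xi>)" "surf \<xi> $ 2 = Re (N2 \<xi>)" "surf \<xi> $ 3 = ?c"
    by (simp_all add: surf_def)
  show "F ?t (surf \<xi>) = 0" by (simp add: F_def s re_ext_of_real)
  note r = re_ext_has_field_derivative[OF _ c t]
  have "((\<lambda>t. F t (surf \<xi>)) has_field_derivative
     of_real (Re (n1 \<xi>) * Im (n1 \<xi>) + Re (n2 \<xi>) * Im (n2 \<xi>))) (at ?t)"
    unfolding F_def s
    by (rule derivative_eq_intros r hol holN refl)+
      (simp add: re_ext_of_real deriv_N[OF xi])
  moreover have "Re (n1 \<xi>) * Im (n1 \<xi>) + Re (n2 \<xi>) * Im (n2 \<xi>) = 0"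
    using arg_cong[OF unit[OF xi], of Im] by (simp add: power2_eq_square) algebra
  ultimately show "deriv (\<lambda>t. F t (surf \<xi>)) ?t = 0" by (auto intro: DERIV_imp_deriv)
qed

lemma surf_0: "surf 0 = 0"
  by (simp add: surf_def prim_0 vec_eq_iff forall_3)

lemma Ck_on_surf: "Ck_on k (ball 0 d) surf"
proof (rule Ck_on_vec_componentwise[OF open_ball])
  fix i :: 3
  have "Ck_on k (ball 0 d) (\<lambda>\<xi>. Re (N1 \<xi>))" "Ck_on k (ball 0 d) (\<lambda>\<xi>. Re (N2 \<xi>))" "Ck_on k (ball 0 d) Re"
    by (intro Ck_on_bounded_linear[OF open_ball bounded_linear_Re] Ck_on_holomorphic holN open_ball
        Ck_on_linear bounded_linear_Re)+
  then show "Ck_on k (ball 0 d) (\<lambda>\<xi>. surf \<xi> $ i)"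
    using exhaust_3[of i] by (auto simp: surf_def)
qed

lemma surf_has_derivative: "(surf has_derivative (\<lambda>h. vector [Re h, 0, Re h])) (at 0)"
proof -
  have 0: "0 \<in> ball (0::complex) d" using d by simp
  have c: "((\<lambda>\<xi>. Re (N1 \<xi>)) has_derivative Re) (at 0)" "((\<lambda>\<xi>. Re (N2 \<xi>)) has_derivative (\<lambda>h. 0)) (at 0)"
    using bounded_linear.has_derivative[OF bounded_linear_Re, of N1 "(*) (n1 0)" "at 0"]
      bounded_linear.has_derivative[OF bounded_linear_Re, of N2 "(*) (n2 0)" "at 0"] prim[OF 0]
    by (simp_all add: has_field_derivative_def n_0)
  have R: "(Re has_derivative Re) (at 0)"
    by (rule bounded_linear_imp_has_derivative[OF bounded_linear_Re])
  have "((\<lambda>\<xi>. surf \<xi> $ i) has_derivative (\<lambda>h. vector [Re h, 0, Re h] $ i)) (at 0)" for i :: 3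
    using exhaust_3[of i] c R by (auto simp: surf_def)
  then show ?thesis by (subst has_derivative_componentwise_within) (auto simp: Basis_vec_def inner_axis)
qed

lemma quartic_family_exists: "\<exists>E \<rho> \<delta> r. quartic_family F E D \<rho> \<delta> r \<and> \<rho> \<le> d / 2 \<and> \<delta> \<le> d / 2"
proof -
  have d2: "0 < d / 2" using d by simp
  have 0: "0 \<in> ball (0::complex) (d / 2)" "0 \<in> ball (0::real ^ 3) (d / 2)" using d by simp_all
  have "(deriv ^^ 4) (\<lambda>t. F t 0) 0 \<noteq> 0" using F_derivs_0(2) n2' n2'' by simp
  then obtain E e where e: "0 < e" "E holomorphic_on ball 0 e"
    and E: "\<And>w. w \<in> ball 0 e \<Longrightarrow> F w 0 - F 0 0 = (w - 0) ^ 4 * E w" "\<And>w. w \<in> ball 0 e \<Longrightarrow> E w \<noteq> 0"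
    using holomorphic_factor_order_of_zero[OF F_holomorphic[OF 0(2)] open_ball 0(1), of 4] F_derivs_0(1)
    by (metis zero_less_numeral)
  have F00: "F 0 0 = 0" using F_derivs_0(1)[of 0] by simp
  define \<rho> where "\<rho> = min e (d / 2)"
  define r where "r = \<rho> / 2"
  have \<rho>: "0 < r" "r < \<rho>" "\<rho> \<le> e" "\<rho> \<le> d / 2" using e(1) d2 by (auto simp: \<rho>_def r_def)
  \<comment> \<open>Rouche's condition comes from compactness: \<open>F\<close> is uniformly
    continuous on \<open>K\<close>, and \<open>t1\<close> realises the least modulus of
    \<open>F t 0\<close> on the circle, which is positive.\<close>
  define K where "K = cball (0::real ^ 3) (d / 4) \<times> sphere (0::complex) r"
  have contF: "continuous_on (ball (0::real ^ 3) (d / 2) \<times> ball 0 (d / 2)) (\<lambda>p. F (snd p) (fst p))"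
    by (rule Ck_on_imp_continuous[OF F_smooth])
  have "compact K" by (simp add: K_def compact_Times)
  moreover have "continuous_on K (\<lambda>p. F (snd p) (fst p))"
    by (rule continuous_on_subset[OF contF]) (use \<rho> d in \<open>auto simp: K_def\<close>)
  ultimately have uc: "uniformly_continuous_on K (\<lambda>p. F (snd p) (fst p))"
    by (rule compact_uniformly_continuous[rotated])
  have F0: "F t 0 = t ^ 4 * E t" if "t \<in> ball 0 \<rho>" for t using E(1)[of t] that \<rho> F00 by simp
  have Enz: "E t \<noteq> 0" if "t \<in> ball 0 \<rho>" for t using E(2)[of t] that \<rho> by simp
  have "continuous_on (sphere 0 r) (\<lambda>t. cmod (F t 0))"
    using \<rho> holomorphic_on_imp_continuous_on[OF F_holomorphic[OF 0(2)]]
    by (intro continuous_on_norm) (auto elim!: continuous_on_subset)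
  moreover have "sphere (0::complex) r \<noteq> {}" using \<rho> by simp
  ultimately obtain t1 where t1: "t1 \<in> sphere 0 r" "\<And>t. t \<in> sphere 0 r \<Longrightarrow> cmod (F t1 0) \<le> cmod (F t 0)"
    using continuous_attains_inf[of "sphere 0 r" "\<lambda>t. cmod (F t 0)"] by auto
  have "0 < cmod (F t1 0)" using t1(1) \<rho> F0[of t1] Enz[of t1] by auto
  then obtain \<delta>1 where \<delta>1: "0 < \<delta>1" "\<And>p q. p \<in> K \<Longrightarrow> q \<in> K \<Longrightarrow> dist q p < \<delta>1 \<Longrightarrow>
      dist (F (snd q) (fst q)) (F (snd p) (fst p)) < cmod (F t1 0)"
    using uc unfolding uniformly_continuous_on_def by metis
  \<comment> \<open>The bound \<open>d / 4\<close> keeps \<open>Y\<close> in \<open>K\<close>, whose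
    first factor is a compact ball inside the domain of radius \<open>d / 2\<close>.\<close>
  define \<delta> where "\<delta> = min \<delta>1 (d / 4)"
  have \<delta>: "0 < \<delta>" "\<delta> \<le> d / 2" "\<delta> \<le> \<delta>1" "\<delta> \<le> d / 4" using \<delta>1(1) d by (auto simp: \<delta>_def)
  have "quartic_family F E D \<rho> \<delta> r"
  proof
    show "0 < r" "r < \<rho>" "0 < \<delta>" by fact+
    show "(\<lambda>t. F t Y) holomorphic_on ball 0 \<rho>" if "Y \<in> ball 0 \<delta>" for Y
      using that \<delta> \<rho> by (intro holomorphic_on_subset[OF F_holomorphic]) auto
    show "E holomorphic_on ball 0 \<rho>" using e(2) \<rho> by (auto intro: holomorphic_on_subset)
    show "E t \<noteq> 0" "F t 0 = t ^ 4 * E t" if "t \<in> ball 0 \<rho>" for t using Enz F0 that by auto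
    show "Ck_on k (ball 0 \<delta> \<times> ball 0 \<rho>) (\<lambda>p. F (snd p) (fst p))" for k
      using \<delta> \<rho> by (intro Ck_on_subset[OF F_smooth] Sigma_mono) auto
    show "F (cnj t) Y = cnj (F t Y)" for t Y by (rule F_cnj)
    show "((\<lambda>Y. F t Y) has_derivative (\<lambda>V. D V t)) (at 0)" if "t \<in> ball 0 \<rho>" for t
      using that \<rho> by (intro F_has_derivative) auto
    show "D V holomorphic_on ball 0 \<rho>" for V
      using \<rho> by (intro holomorphic_on_subset[OF D_holomorphic]) auto
    show "cmod (F t Y - F t 0) < cmod (F t 0)" if "cmod t = r" "Y \<in> ball 0 \<delta>" for t Y
    proof -
      have "dist (F t Y) (F t 0) < cmod (F t1 0)"
        using \<delta>1(2)[of "(0, t)" "(Y, t)"] that \<delta> d by (simp add: K_def dist_Pair_Pair)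
      also have "\<dots> \<le> cmod (F t 0)" using t1(2)[of t] that by simp
      finally show ?thesis by (simp add: dist_norm)
    qed
  qed
  then show ?thesis using \<rho> \<delta> by blast
qed

theorem swallowtail_normal_form:
  obtains \<epsilon> \<delta> \<eta> \<Psi> where "0 < \<epsilon>" "\<epsilon> \<le> d" "0 < \<delta>" "Cinf_on (ball 0 \<epsilon>) \<eta>" "\<eta> 0 = 0"
    "inj (frechet_derivative \<eta> (at 0))"
    "Cinf_on (ball 0 \<delta>) \<Psi>" "\<Psi> 0 = 0" "inj (frechet_derivative \<Psi> (at 0))"
    "\<And>\<xi>. \<xi> \<in> ball 0 \<epsilon> \<Longrightarrow> surf \<xi> \<in> ball 0 \<delta> \<and> \<Psi> (surf \<xi>) = f_sw (\<eta> \<xi>)"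
proof -
  obtain E \<rho> \<delta> r where Q: "quartic_family F E D \<rho> \<delta> r" and le: "\<rho> \<le> d / 2" "\<delta> \<le> d / 2"
    using quartic_family_exists by auto
  interpret quartic_family F E D \<rho> \<delta> r by fact
  obtain m' e2' e3' e4' where der: "(mean has_derivative m') (at 0)" "(e2 has_derivative e2') (at 0)"
    "(e3 has_derivative e3') (at 0)" "(e4 has_derivative e4') (at 0)"
    and jets: "\<And>V k. e2' V = 0 \<Longrightarrow> e3' V = 0 \<Longrightarrow> e4' V = 0 \<Longrightarrow> k \<le> 2 \<Longrightarrow>
      (deriv ^^ k) (\<lambda>t. D V t / E t) 0 = 0"
    by (rule coefficients_have_derivative) blast
  \<comment> \<open>Multiplication by \<open>E\<close> does not create terms of order at most two
    when the quotient has none.\<close>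
  have jetsD: "V = 0" if "e2' V = 0" "e3' V = 0" "e4' V = 0" for V
  proof (rule D_jets)
    fix k :: nat assume k: "k \<le> 2"
    have 0: "0 \<in> ball (0::complex) \<rho>" using radii by simp
    have hq: "(\<lambda>t. D V t / E t) holomorphic_on ball 0 \<rho>"
      using holD holE Enz by (intro holomorphic_on_divide)
    have "(deriv ^^ k) (D V) 0 = (deriv ^^ k) (\<lambda>t. D V t / E t * E t) 0"
      using Enz by (intro higher_deriv_cong_ev eventually_mono[OF eventually_nhds_in_open[OF open_ball 0]]) auto
    also have "\<dots> = (\<Sum>i = 0..k. of_nat (k choose i) * (deriv ^^ i) (\<lambda>t. D V t / E t) 0 * (deriv ^^ (k - i)) E 0)"
      by (rule higher_deriv_mult[OF hq holE open_ball 0])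
    also have "\<dots> = 0" using jets[OF that] k by (intro sum.neutral) auto
    finally show "(deriv ^^ k) (D V) 0 = 0" .
  qed
  define \<Psi> :: "real ^ 3 \<Rightarrow> real ^ 3" where "\<Psi> Y = vector [e4 Y, e3 Y, e2 Y]" for Y
  \<comment> \<open>By the envelope property \<open>Im \<xi>\<close> is a double root of the quartic
    at \<open>surf \<xi>\<close>; it is measured from the mean of the roots.\<close>
  define \<eta> :: "complex \<Rightarrow> real ^ 2" where "\<eta> \<xi> = vector [Im \<xi> - mean (surf \<xi>), e2 (surf \<xi>)]" for \<xi>
  have \<Psi>': "(\<Psi> has_derivative (\<lambda>V. vector [e4' V, e3' V, e2' V])) (at 0)"
  proof -
    have "((\<lambda>Y. \<Psi> Y $ i) has_derivative (\<lambda>V. vector [e4' V, e3' V, e2' V] $ i)) (at 0)" for i :: 3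
      using exhaust_3[of i] der by (auto simp: \<Psi>_def)
    then show ?thesis by (subst has_derivative_componentwise_within) (auto simp: Basis_vec_def inner_axis)
  qed
  have inj_if: "inj f" if "linear f" "\<And>x. f x = 0 \<Longrightarrow> x = 0" for f :: "'x::real_vector \<Rightarrow> 'y::real_vector"
    using that linear_injective_0 by blast
  have inj\<Psi>: "inj (frechet_derivative \<Psi> (at 0))"
  proof (rule inj_if)
    show "linear (frechet_derivative \<Psi> (at 0))"
      using has_derivative_linear[OF \<Psi>'] frechet_derivative_at[OF \<Psi>'] by simp
    fix V assume "frechet_derivative \<Psi> (at 0) V = 0"
    then have "vector [e4' V, e3' V, e2' V] = (0 :: real ^ 3)"
      using fun_cong[OF frechet_derivative_at[OF \<Psi>'], of V] by simp
    then show "V = 0" by (intro jetsD) (simp_all add: vec_eq_iff forall_3)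
  qed
  let ?W = "\<lambda>h. vector [Re h, 0, Re h] :: real ^ 3"
  have chain: "((\<lambda>\<xi>. f (surf \<xi>)) has_derivative (\<lambda>h. f' (?W h))) (at 0)" if "(f has_derivative f') (at 0)"
    for f f' :: "real ^ 3 \<Rightarrow> real"
    using diff_chain_at[OF surf_has_derivative, of f f'] that by (simp add: surf_0 o_def)
  have \<eta>': "(\<eta> has_derivative (\<lambda>h. vector [Im h - m' (?W h), e2' (?W h)])) (at 0)"
  proof -
    have "(Im has_derivative Im) (at 0)" by (rule bounded_linear_imp_has_derivative[OF bounded_linear_Im])
    then have "((\<lambda>Y. \<eta> Y $ i) has_derivative (\<lambda>h. vector [Im h - m' (?W h), e2' (?W h)] $ i)) (at 0)" for i :: 2
      using exhaust_2[of i] has_derivative_diff[OF _ chain[OF der(1)], of Im Im] chain[OF der(2)]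
      by (auto simp: \<eta>_def)
    then show ?thesis by (subst has_derivative_componentwise_within) (auto simp: Basis_vec_def inner_axis)
  qed
  have "isCont surf 0"
    using surf_has_derivative by (rule has_derivative_continuous)
  then obtain \<epsilon>1 where \<epsilon>1: "0 < \<epsilon>1" "\<And>\<xi>. \<xi> \<in> ball 0 \<epsilon>1 \<Longrightarrow> surf \<xi> \<in> ball 0 \<delta>"
    using radii(3) unfolding continuous_at_eps_delta surf_0 by (auto simp: dist_commute)
  define \<epsilon> where "\<epsilon> = min \<epsilon>1 r"
  have \<epsilon>: "0 < \<epsilon>" "\<epsilon> \<le> \<epsilon>1" "\<epsilon> \<le> r" "\<epsilon> \<le> d / 2" using \<epsilon>1 radii le by (auto simp: \<epsilon>_def)
  have in_ball: "surf \<xi> \<in> ball 0 \<delta>" if "\<xi> \<in> ball 0 \<epsilon>" for \<xi> using \<epsilon>1(2)[of \<xi>] that \<epsilon> by simp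
  have sw: "e4 (surf \<xi>) = 3 * (Im \<xi> - mean (surf \<xi>)) ^ 4 + (Im \<xi> - mean (surf \<xi>)) ^ 2 * e2 (surf \<xi>)"
    "e3 (surf \<xi>) = 4 * (Im \<xi> - mean (surf \<xi>)) ^ 3 + 2 * (Im \<xi> - mean (surf \<xi>)) * e2 (surf \<xi>)"
    if "\<xi> \<in> ball 0 \<epsilon>" for \<xi>
  proof -
    have "\<xi> \<in> ball 0 (d / 2)" "\<bar>Im \<xi>\<bar> < r" using that \<epsilon> abs_Im_le_cmod[of \<xi>] by auto
    then show "e4 (surf \<xi>) = 3 * (Im \<xi> - mean (surf \<xi>)) ^ 4 + (Im \<xi> - mean (surf \<xi>)) ^ 2 * e2 (surf \<xi>)"
      "e3 (surf \<xi>) = 4 * (Im \<xi> - mean (surf \<xi>)) ^ 3 + 2 * (Im \<xi> - mean (surf \<xi>)) * e2 (surf \<xi>)"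
      using swallowtail_coefficients[OF in_ball[OF that]] envelope by blast+
  qed
  have inj\<eta>: "inj (frechet_derivative \<eta> (at 0))"
  proof (rule inj_if)
    show "linear (frechet_derivative \<eta> (at 0))"
      using has_derivative_linear[OF \<eta>'] frechet_derivative_at[OF \<eta>'] by simp
    fix h assume "frechet_derivative \<eta> (at 0) h = 0"
    then have "vector [Im h - m' (?W h), e2' (?W h)] = (0 :: real ^ 2)"
      using fun_cong[OF frechet_derivative_at[OF \<eta>'], of h] by simp
    then have h: "Im h - m' (?W h) = 0" "e2' (?W h) = 0" by (simp_all add: vec_eq_iff forall_2)
    \<comment> \<open>By \<open>sw\<close>, \<open>e3\<close> and \<open>e4\<close> along the
      surface have vanishing derivative at 0, since every term of the right-hand sides has degree at
      least two. A kernel vector of the derivative of \<open>\<eta>\<close> thus annihilates all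
      three coefficients, and \<open>jetsD\<close> applies to its image in space.\<close>
    have I: "(Im has_derivative Im) (at 0)" by (rule bounded_linear_imp_has_derivative[OF bounded_linear_Im])
    note c = chain[OF der(1)] chain[OF der(2)]
    have "((\<lambda>\<xi>. 3 * (Im \<xi> - mean (surf \<xi>)) ^ 4 + (Im \<xi> - mean (surf \<xi>)) ^ 2 * e2 (surf \<xi>))
        has_derivative (\<lambda>h. 0)) (at 0)"
      by (rule derivative_eq_intros c I refl | simp add: surf_0 coefficients_0)+
    then have "((\<lambda>\<xi>. e4 (surf \<xi>)) has_derivative (\<lambda>h. 0)) (at 0)"
      by (rule has_derivative_transform_within_open[OF _ open_ball, of _ _ _ _ 0 \<epsilon>]) (use \<epsilon> sw in auto)
    from fun_cong[OF has_derivative_unique[OF this chain[OF der(4)]], of h] have 4: "e4' (?W h) = 0" by simp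
    have "((\<lambda>\<xi>. 4 * (Im \<xi> - mean (surf \<xi>)) ^ 3 + 2 * (Im \<xi> - mean (surf \<xi>)) * e2 (surf \<xi>))
        has_derivative (\<lambda>h. 0)) (at 0)"
      by (rule derivative_eq_intros c I refl | simp add: surf_0 coefficients_0)+
    then have "((\<lambda>\<xi>. e3 (surf \<xi>)) has_derivative (\<lambda>h. 0)) (at 0)"
      by (rule has_derivative_transform_within_open[OF _ open_ball, of _ _ _ _ 0 \<epsilon>]) (use \<epsilon> sw in auto)
    from fun_cong[OF has_derivative_unique[OF this chain[OF der(3)]], of h] have 3: "e3' (?W h) = 0" by simp
    have "?W h = 0" using jetsD[OF h(2) 3 4] .
    then have "Re h = 0" by (simp add: vec_eq_iff forall_3)
    moreover have "m' 0 = 0" using has_derivative_linear[OF der(1)] by (rule linear_0)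
    ultimately show "h = 0" using h(1) \<open>?W h = 0\<close> by (simp add: complex_eq_iff)
  qed
  have Ck\<Psi>: "Ck_on k (ball 0 \<delta>) \<Psi>" for k
  proof (rule Ck_on_vec_componentwise[OF open_ball])
    show "Ck_on k (ball 0 \<delta>) (\<lambda>Y. \<Psi> Y $ i)" for i
      using exhaust_3[of i] Ck_on_coefficients by (auto simp: \<Psi>_def)
  qed
  have Ck_comp: "Ck_on k (ball 0 \<epsilon>) (\<lambda>\<xi>. f (surf \<xi>))" if "Ck_on k (ball 0 \<delta>) f" for k and f :: "real ^ 3 \<Rightarrow> real"
    using in_ball \<epsilon> d
    by (intro Ck_on_compose[OF open_ball open_ball that Ck_on_subset[OF Ck_on_surf]]) auto
  have Ck\<eta>: "Ck_on k (ball 0 \<epsilon>) \<eta>" for k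
  proof (rule Ck_on_vec_componentwise[OF open_ball])
    have "Ck_on k (ball 0 \<epsilon>) (\<lambda>\<xi>. Im \<xi> - mean (surf \<xi>))" "Ck_on k (ball 0 \<epsilon>) (\<lambda>\<xi>. e2 (surf \<xi>))"
      by (intro Ck_on_diff Ck_comp Ck_on_coefficients Ck_on_linear bounded_linear_Im open_ball)+
    then show "Ck_on k (ball 0 \<epsilon>) (\<lambda>\<xi>. \<eta> \<xi> $ i)" for i
      using exhaust_2[of i] by (auto simp: \<eta>_def)
  qed
  show ?thesis
  proof
    show "0 < \<epsilon>" "\<epsilon> \<le> d" "0 < \<delta>" using \<epsilon> d radii by auto
    show "Cinf_on (ball 0 \<epsilon>) \<eta>" "Cinf_on (ball 0 \<delta>) \<Psi>" using Ck\<eta> Ck\<Psi> by (auto simp: Cinf_on_def)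
    show "\<eta> 0 = 0" "\<Psi> 0 = 0"
      by (simp_all add: \<eta>_def \<Psi>_def surf_0 coefficients_0 vec_eq_iff forall_2 forall_3)
    show "inj (frechet_derivative \<eta> (at 0))" "inj (frechet_derivative \<Psi> (at 0))" by fact+
    show "surf \<xi> \<in> ball 0 \<delta> \<and> \<Psi> (surf \<xi>) = f_sw (\<eta> \<xi>)" if "\<xi> \<in> ball 0 \<epsilon>" for \<xi>
      using in_ball[OF that] sw[OF that] by (simp add: \<Psi>_def \<eta>_def f_sw_def Let_def)
  qed
qed

end

section \<open>Singular Bjoerling data at a point\<close>

lemma has_vector_derivative_imp_quotient:
  assumes "(f has_vector_derivative D) (at t within I)"
  shows "((\<lambda>s. (f s - f t) /\<^sub>R (s - t)) \<longlongrightarrow> D) (at t within I)"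
proof -
  have "((\<lambda>s. norm ((f s - f t) - (s - t) *\<^sub>R D) / norm (s - t)) \<longlongrightarrow> 0) (at t within I)"
    using assms by (simp add: has_vector_derivative_def has_derivative_iff_norm)
  then have "((\<lambda>s. norm ((f s - f t) /\<^sub>R (s - t) - D)) \<longlongrightarrow> 0) (at t within I)"
  proof (rule Lim_transform_eventually)
    have "norm ((f s - f t) - (s - t) *\<^sub>R D) / norm (s - t) = norm ((f s - f t) /\<^sub>R (s - t) - D)"
      if "s \<noteq> t" for s
    proof -
      have "(f s - f t) /\<^sub>R (s - t) - D = ((f s - f t) - (s - t) *\<^sub>R D) /\<^sub>R (s - t)"
        using that by (simp add: scaleR_diff_right)
      then show ?thesis by (simp add: divide_inverse)
    qed
    then show "\<forall>\<^sub>F s in at t within I. norm ((f s - f t) - (s - t) *\<^sub>R D) / norm (s - t)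
        = norm ((f s - f t) /\<^sub>R (s - t) - D)"
      by (auto simp: eventually_at_filter)
  qed
  then show ?thesis by (simp add: tendsto_norm_zero_iff LIM_zero_iff)
qed

lemma Im_vector_derivative_eq_0:
  fixes f :: "real \<Rightarrow> complex"
  assumes "(f has_vector_derivative D) (at t within I)" "at t within I \<noteq> bot"
    and "\<forall>\<^sub>F s in at t within I. Im (f s) = 0" "Im (f t) = 0" "t \<in> I"
  shows "Im D = 0"
proof -
  have "((\<lambda>s. Im (f s)) has_vector_derivative Im D) (at t within I)"
    using bounded_linear.has_vector_derivative[OF bounded_linear_Im assms(1)] .
  moreover have "((\<lambda>s. Im (f s)) has_vector_derivative 0) (at t within I)"
  proof -
    have "((\<lambda>s. 0) has_derivative (\<lambda>h. 0)) (at t within I)" by simp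
    then have "((\<lambda>s. Im (f s)) has_derivative (\<lambda>h. 0)) (at t within I)"
      by (rule has_derivative_transform_eventually) (use assms(3-5) in \<open>auto elim: eventually_mono\<close>)
    then show ?thesis by (simp add: has_vector_derivative_def)
  qed
  ultimately show ?thesis by (rule vector_derivative_unique_within[OF assms(2)])
qed

locale bjorling_point =
  fixes I :: "real set" and lam :: "real \<Rightarrow> complex" and \<alpha> \<beta> :: "real \<Rightarrow> real ^ 3"
    and \<Omega> :: "complex set" and \<phi> :: "complex \<Rightarrow> complex ^ 3"
    and X :: "complex \<Rightarrow> real ^ 3" and t0 t :: real
  assumes data: "singular_bjorling_data I lam \<alpha> \<beta>"
    and sol: "bjorling_solution I lam \<alpha> \<beta> \<Omega> \<phi> t0 X"
    and t: "t \<in> I"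
begin

abbreviation "p \<equiv> lam t"
text \<open>\<open>a\<close> and \<open>l'\<close> are functions of the parameter because they are
  differentiated once more; the three that follow are values at \<open>t\<close>.\<close>

definition "a s = curve_deriv I \<alpha> s"
definition "l' s = curve_deriv I lam s"
definition "l'' = (curve_deriv I ^^ 2) lam t"
definition "a' = (curve_deriv I ^^ 2) \<alpha> t"
definition "b' = curve_deriv I \<beta> t"

lemma Omega: "open \<Omega>" "connected \<Omega>" "s \<in> I \<Longrightarrow> lam s \<in> \<Omega>"
  and phi_holomorphic: "(\<lambda>z. \<phi> z $ j) holomorphic_on \<Omega>"
  and phi_lam: "s \<in> I \<Longrightarrow> \<phi> (lam s) $ j = of_real (a s $ j) - \<i> * of_real (\<beta> s $ j)"
  using sol by (auto simp: bjorling_solution_def bjorling_extension_def a_def)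

lemma p_in_Omega: "p \<in> \<Omega>" using Omega(3) t .

text \<open>Uniqueness of one-sided limits and derivatives, also at an end point, rests on
  this.\<close>

lemma nontrivial_within:
  assumes "s \<in> I" shows "at s within I \<noteq> bot"
proof -
  have "is_interval I" "interior I \<noteq> {}" using data by (auto simp: singular_bjorling_data_def)
  then have "connected I" "\<nexists>x. I = {x}"
    by (auto simp: is_interval_connected_1 interior_singleton)
  then have "s islimpt I" using connected_imp_perfect assms by blast
  then show ?thesis by (simp add: trivial_limit_within)
qed

lemmas nontrivial = nontrivial_within[OF t]

lemma smooth_curve_derivs:
  assumes "smooth_curve_on I c" "s \<in> I"
  shows "(c has_vector_derivative curve_deriv I c s) (at s within I)"
    "(curve_deriv I c has_vector_derivative (curve_deriv I ^^ 2) c s) (at s within I)"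
proof -
  have "(curve_deriv I ^^ 0) c differentiable (at s within I)" "(curve_deriv I ^^ 1) c differentiable (at s within I)"
    using assms unfolding smooth_curve_on_def by blast+
  then show "(c has_vector_derivative curve_deriv I c s) (at s within I)"
    "(curve_deriv I c has_vector_derivative (curve_deriv I ^^ 2) c s) (at s within I)"
    by (simp_all add: vector_derivative_works[symmetric] numeral_2_eq_2 curve_deriv_def[of I c]
        curve_deriv_def[of I "curve_deriv I c"])
qed

lemma curve_derivatives:
  "s \<in> I \<Longrightarrow> (lam has_vector_derivative l' s) (at s within I)"
  "(l' has_vector_derivative l'') (at t within I)"
  "(a has_vector_derivative a') (at t within I)"
  "(\<beta> has_vector_derivative b') (at t within I)"
  using data smooth_curve_derivs[of lam] smooth_curve_derivs[of \<alpha> t] smooth_curve_derivs[of \<beta> t] t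
  by (auto simp: singular_bjorling_data_def l'_def[abs_def] l''_def a_def[abs_def] a'_def b'_def)

lemma l'_nonzero: "s \<in> I \<Longrightarrow> l' s \<noteq> 0"
  using data by (auto simp: singular_bjorling_data_def l'_def)

lemma lam_continuous: "(lam \<longlongrightarrow> p) (at t within I)"
  using has_vector_derivative_continuous[OF curve_derivatives(1)[OF t]] by (simp add: continuous_within)

lemma null_vectors:
  assumes "s \<in> I"
  shows "(a s $ 1)\<^sup>2 + (a s $ 2)\<^sup>2 = (a s $ 3)\<^sup>2" "(\<beta> s $ 1)\<^sup>2 + (\<beta> s $ 2)\<^sup>2 = (\<beta> s $ 3)\<^sup>2"
    "a s $ 1 * \<beta> s $ 1 + a s $ 2 * \<beta> s $ 2 = a s $ 3 * \<beta> s $ 3" "a s \<noteq> 0 \<or> \<beta> s \<noteq> 0"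
  using data assms by (auto simp: singular_bjorling_data_def minkowski_def a_def power2_eq_square)

lemma null_vector_eq_0: "x $ 1 ^ 2 + x $ 2 ^ 2 = x $ 3 ^ 2 \<Longrightarrow> x = 0 \<longleftrightarrow> x $ 3 = 0" for x :: "real ^ 3"
  by (auto simp: vec_eq_iff forall_3)

lemma phi3_nonzero: "s \<in> I \<Longrightarrow> \<phi> (lam s) $ 3 \<noteq> 0"
  using null_vectors[of s] null_vector_eq_0[of "a s"] null_vector_eq_0[of "\<beta> s"]
  by (auto simp: phi_lam complex_eq_iff)

text \<open>The \<open>n\<^sub>j\<close> of the overview as functions of \<open>z\<close>;
  \<open>n1\<close> and \<open>n2\<close> below are their rotated versions in the coordinate
  \<open>\<xi>\<close>.\<close>

definition "m j z = \<phi> z $ j / \<phi> z $ 3"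

text \<open>\<open>\<alpha>'\<close> and \<open>\<beta>\<close> are parallel, being orthogonal null vectors.\<close>

lemma parallel:
  assumes "s \<in> I" "j = 1 \<or> j = 2"
  shows "a s $ j * \<beta> s $ 3 = \<beta> s $ j * a s $ 3"
proof -
  note n = null_vectors(1-3)[OF assms(1)]
  have "(a s $ 1 * \<beta> s $ 3 - \<beta> s $ 1 * a s $ 3)\<^sup>2 + (a s $ 2 * \<beta> s $ 3 - \<beta> s $ 2 * a s $ 3)\<^sup>2
    = (\<beta> s $ 3)\<^sup>2 * ((a s $ 1)\<^sup>2 + (a s $ 2)\<^sup>2) + (a s $ 3)\<^sup>2 * ((\<beta> s $ 1)\<^sup>2 + (\<beta> s $ 2)\<^sup>2)
      - 2 * a s $ 3 * \<beta> s $ 3 * (a s $ 1 * \<beta> s $ 1 + a s $ 2 * \<beta> s $ 2)"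
    by (simp add: power2_eq_square algebra_simps)
  also have "\<dots> = 0" unfolding n by (simp add: power2_eq_square algebra_simps)
  finally show ?thesis using assms(2) by (auto simp: sum_power2_eq_zero_iff)
qed

lemma m_real:
  assumes "s \<in> I" "j = 1 \<or> j = 2"
  shows "Im (m j (lam s)) = 0"
    "a s $ j = Re (m j (lam s)) * a s $ 3" "\<beta> s $ j = Re (m j (lam s)) * \<beta> s $ 3"
proof -
  note par = parallel[OF assms]
  \<comment> \<open>Which of the two third components is nonzero may change along the curve;
    clearing denominators with the sum of their squares covers all cases at once.\<close>
  have nz: "(a s $ 3)\<^sup>2 + (\<beta> s $ 3)\<^sup>2 \<noteq> 0"
    using phi3_nonzero[OF assms(1)] by (auto simp: phi_lam[OF assms(1)] sum_power2_eq_zero_iff complex_eq_iff)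
  have m: "m j (lam s) = Complex (a s $ j) (- \<beta> s $ j) / Complex (a s $ 3) (- \<beta> s $ 3)"
    unfolding m_def phi_lam[OF assms(1)] by (simp add: Complex_eq)
  show "Im (m j (lam s)) = 0" unfolding m using par by (simp add: Im_divide)
  have "a s $ j * ((a s $ 3)\<^sup>2 + (\<beta> s $ 3)\<^sup>2) = (a s $ j * a s $ 3 + \<beta> s $ j * \<beta> s $ 3) * a s $ 3"
    "\<beta> s $ j * ((a s $ 3)\<^sup>2 + (\<beta> s $ 3)\<^sup>2) = (a s $ j * a s $ 3 + \<beta> s $ j * \<beta> s $ 3) * \<beta> s $ 3"
    using par by (simp_all add: power2_eq_square algebra_simps)
  then show "a s $ j = Re (m j (lam s)) * a s $ 3" "\<beta> s $ j = Re (m j (lam s)) * \<beta> s $ 3"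
    unfolding m using nz by (simp_all add: Re_divide field_simps)
qed

lemma m_unit_lam: "s \<in> I \<Longrightarrow> (Re (m 1 (lam s)))\<^sup>2 + (Re (m 2 (lam s)))\<^sup>2 = 1"
proof -
  assume s: "s \<in> I"
  let ?x = "Re (m 1 (lam s))" and ?y = "Re (m 2 (lam s))"
  have "(a s $ 3)\<^sup>2 * (?x\<^sup>2 + ?y\<^sup>2) = (a s $ 3)\<^sup>2" "(\<beta> s $ 3)\<^sup>2 * (?x\<^sup>2 + ?y\<^sup>2) = (\<beta> s $ 3)\<^sup>2"
    using null_vectors(1,2)[OF s] m_real(2,3)[OF s, of 1] m_real(2,3)[OF s, of 2]
    by (simp_all add: power_mult_distrib algebra_simps)
  moreover have "a s $ 3 \<noteq> 0 \<or> \<beta> s $ 3 \<noteq> 0"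
    using phi3_nonzero[OF s] by (auto simp: phi_lam[OF s])
  ultimately show ?thesis by auto
qed

text \<open>The equation is known on the trace, and the identity theorem extends it to
  \<open>\<Omega>\<close>. Since \<open>lam\<close> has nonzero velocity, \<open>p\<close> is a
  limit point of the trace.\<close>

lemma phi_null:
  assumes "z \<in> \<Omega>" shows "(\<phi> z $ 1)\<^sup>2 + (\<phi> z $ 2)\<^sup>2 = (\<phi> z $ 3)\<^sup>2"
proof -
  have "(\<phi> z $ 1)\<^sup>2 + (\<phi> z $ 2)\<^sup>2 - (\<phi> z $ 3)\<^sup>2 = 0"
  proof (rule analytic_continuation[of "\<lambda>z. (\<phi> z $ 1)\<^sup>2 + (\<phi> z $ 2)\<^sup>2 - (\<phi> z $ 3)\<^sup>2" \<Omega> "lam ` I" p])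
    show "(\<lambda>z. (\<phi> z $ 1)\<^sup>2 + (\<phi> z $ 2)\<^sup>2 - (\<phi> z $ 3)\<^sup>2) holomorphic_on \<Omega>"
      by (intro holomorphic_intros phi_holomorphic)
    have "\<forall>\<^sub>F s in at t within I. lam s \<noteq> p"
    proof -
      have "\<forall>\<^sub>F s in at t within I. (lam s - p) /\<^sub>R (s - t) \<noteq> 0"
        by (rule tendsto_imp_eventually_ne[OF has_vector_derivative_imp_quotient[OF curve_derivatives(1)[OF t]]
              l'_nonzero[OF t]])
      then show ?thesis by eventually_elim auto
    qed
    moreover have "\<forall>\<^sub>F s in at t within I. s \<in> I" by (simp add: eventually_at_filter)
    ultimately have "\<exists>s. s \<in> I \<and> lam s \<in> S \<and> lam s \<noteq> p" if "open S" "p \<in> S" for S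
      using topological_tendstoD[OF lam_continuous that] nontrivial
      by (intro eventually_happens'[OF nontrivial]) (auto elim: eventually_elim2 simp: eventually_conj_iff)
    then show "p islimpt lam ` I" unfolding islimpt_def by blast
    fix w assume "w \<in> lam ` I"
    then obtain s where s: "s \<in> I" "w = lam s" by auto
    have "\<phi> w $ j = of_real (Re (m j w)) * \<phi> w $ 3" if "j = 1 \<or> j = 2" for j
      using m_real[OF s(1) that] by (simp add: s phi_lam[OF s(1)] algebra_simps)
    then show "(\<phi> w $ 1)\<^sup>2 + (\<phi> w $ 2)\<^sup>2 - (\<phi> w $ 3)\<^sup>2 = 0"
      using arg_cong[OF m_unit_lam[OF s(1)], of complex_of_real]
      by (simp add: s(2) power_mult_distrib flip: distrib_right)
  qed (use Omega p_in_Omega assms in auto)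
  then show ?thesis by simp
qed

text \<open>Turns the definition of \<open>X\<close> by integrals from the distant point
  \<open>lam t0\<close> into local primitives. The real weights \<open>c\<close> serve single
  components and rotated ones alike.\<close>

lemma X_increment:
  assumes B: "ball q \<epsilon> \<subseteq> \<Omega>" and z: "z \<in> ball q \<epsilon>"
    and g: "\<And>w. w \<in> ball q \<epsilon> \<Longrightarrow> (g has_field_derivative (\<Sum>j\<in>UNIV. of_real (c j) * \<phi> w $ j)) (at w)"
  shows "Re (g z - g q) = (\<Sum>j\<in>UNIV. c j * (X z $ j - X q $ j))"
proof -
  have "0 < \<epsilon>" using z by (metis ball_eq_empty empty_iff not_le)
  then have q: "q \<in> ball q \<epsilon>" by simp
  let ?L = "linepath q z"
  have seg: "closed_segment q z \<subseteq> ball q \<epsilon>" using q z by (simp add: closed_segment_subset)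
  have t0: "lam t0 \<in> \<Omega>" using sol Omega(3) by (simp add: bjorling_solution_def)
  \<comment> \<open>Both \<open>\<gamma>\<close> and \<open>\<gamma>\<close> followed by the segment
    start at \<open>lam t0\<close>, so their difference isolates the integral over the
    segment.\<close>
  obtain \<gamma> where \<gamma>: "polynomial_function \<gamma>" "path_image \<gamma> \<subseteq> \<Omega>" "pathstart \<gamma> = lam t0" "pathfinish \<gamma> = q"
    using connected_open_polynomial_connected[OF Omega(1,2) t0, of q] B q by blast
  have v: "valid_path \<gamma>" using \<gamma>(1) by (rule valid_path_polynomial_function)
  have X: "valid_path g \<Longrightarrow> path_image g \<subseteq> \<Omega> \<Longrightarrow> pathstart g = lam t0 \<Longrightarrow> X (pathfinish g) = Re_integral \<phi> g" for g
    using sol by (simp add: bjorling_solution_def is_Re_integral_from_def)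
  have int: "(\<lambda>w. \<phi> w $ j) contour_integrable_on g" if "valid_path g" "path_image g \<subseteq> \<Omega>" for g j
    using contour_integrable_holomorphic_simple[OF phi_holomorphic Omega(1) that] .
  have L: "valid_path ?L" "path_image ?L \<subseteq> \<Omega>" using seg B by auto
  have "X z $ j - X q $ j = Re (contour_integral ?L (\<lambda>w. \<phi> w $ j))" for j
    using X[OF v \<gamma>(2,3)] X[of "\<gamma> +++ ?L"] v L \<gamma> int[OF v \<gamma>(2)] int[OF L]
    by (simp add: Re_integral_def path_image_join contour_integral_join)
  moreover have "contour_integral ?L (\<lambda>w. \<Sum>j\<in>UNIV. of_real (c j) * \<phi> w $ j) = g z - g q"
    using contour_integral_primitive[of "ball q \<epsilon>" g _ ?L, OF has_field_derivative_at_within[OF g]] seg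
    by (intro contour_integral_unique) simp
  moreover have "contour_integral ?L (\<lambda>w. \<Sum>j\<in>UNIV. of_real (c j) * \<phi> w $ j)
      = (\<Sum>j\<in>UNIV. of_real (c j) * contour_integral ?L (\<lambda>w. \<phi> w $ j))"
    by (subst contour_integral_sum)
      (auto intro!: contour_integrable_lmul int[OF L] sum.cong contour_integral_lmul)
  ultimately have "Re (g z - g q) = Re (\<Sum>j\<in>UNIV. of_real (c j) * contour_integral ?L (\<lambda>w. \<phi> w $ j))"
    by simp
  also have "\<dots> = (\<Sum>j\<in>UNIV. c j * (X z $ j - X q $ j))"
    using \<open>\<And>j. X z $ j - X q $ j = Re (contour_integral ?L (\<lambda>w. \<phi> w $ j))\<close> by simp
  finally show ?thesis .
qed

lemma X_has_derivative:
  assumes "q \<in> \<Omega>"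
  shows "(X has_derivative (\<lambda>v. \<chi> j. Re (\<phi> q $ j * v))) (at q)"
proof -
  obtain \<epsilon> where \<epsilon>: "0 < \<epsilon>" "ball q \<epsilon> \<subseteq> \<Omega>" using Omega(1) assms by (meson openE)
  have "((\<lambda>z. X z $ j) has_derivative (\<lambda>v. Re (\<phi> q $ j * v))) (at q)" for j
  proof -
    obtain g where g: "\<And>w. w \<in> ball q \<epsilon> \<Longrightarrow> (g has_field_derivative \<phi> w $ j) (at w within ball q \<epsilon>)"
      using holomorphic_convex_primitive'[OF convex_ball open_ball holomorphic_on_subset[OF phi_holomorphic \<epsilon>(2)]]
      by metis
    then have g': "(g has_field_derivative \<phi> w $ j) (at w)" if "w \<in> ball q \<epsilon>" for w
      using that by (metis at_within_open open_ball)
    have "Re (g z - g q) = X z $ j - X q $ j" if "z \<in> ball q \<epsilon>" for z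
      using X_increment[OF \<epsilon>(2) that, of g "\<lambda>i. if i = j then 1 else 0"] g'
      by (simp add: if_distrib[of of_real] if_distrib[of "\<lambda>c. c * _"] cong: if_cong)
    then have eq: "Re (g z) + (X q $ j - Re (g q)) = X z $ j" if "z \<in> ball q \<epsilon>" for z
      using that by force
    have q: "q \<in> ball q \<epsilon>" using \<epsilon>(1) by simp
    have "((\<lambda>z. Re (g z) + (X q $ j - Re (g q))) has_derivative (\<lambda>v. Re (\<phi> q $ j * v))) (at q)"
      using has_derivative_add[OF bounded_linear.has_derivative[OF bounded_linear_Re
            g'[OF q, unfolded has_field_derivative_def]] has_derivative_const[of "X q $ j - Re (g q)"]]
      by simp
    then show ?thesis
      by (rule has_derivative_transform_within_open[OF _ open_ball q eq])
  qed
  then show ?thesis by (subst has_derivative_componentwise_within) (auto simp: Basis_vec_def inner_axis)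
qed

text \<open>The velocity of the trace in the coordinate \<open>\<xi>\<close>. The real parts of
  \<open>h t\<close> and of its derivative \<open>h'\<close> are the expressions in the first two
  conditions.\<close>

definition "h s = \<phi> (lam s) $ 3 * l' s"
definition "h' = (of_real (a' $ 3) - \<i> * of_real (b' $ 3)) * l' t + \<phi> p $ 3 * l''"

lemma h_has_derivative: "(h has_vector_derivative h') (at t within I)"
proof -
  have c: "((\<lambda>s. of_real (a s $ 3) - \<i> * of_real (\<beta> s $ 3)) has_vector_derivative
      (of_real (a' $ 3) - \<i> * of_real (b' $ 3))) (at t within I)"
    using curve_derivatives(3,4)
    by (intro has_vector_derivative_diff has_vector_derivative_mult_right has_vector_derivative_of_real)
      (auto intro: bounded_linear.has_vector_derivative[OF bounded_linear_vec_nth]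
         simp: has_real_derivative_iff_has_vector_derivative)
  have "((\<lambda>s. (of_real (a s $ 3) - \<i> * of_real (\<beta> s $ 3)) * l' s) has_vector_derivative
      (of_real (a t $ 3) - \<i> * of_real (\<beta> t $ 3)) * l'' + (of_real (a' $ 3) - \<i> * of_real (b' $ 3)) * l' t)
      (at t within I)"
    by (rule has_vector_derivative_mult[OF c curve_derivatives(2)])
  then show ?thesis
    unfolding h'_def phi_lam[OF t]
    by (subst (asm) add.commute)
      (rule has_vector_derivative_transform[OF t], auto simp: h_def phi_lam)
qed

lemma Re_h: "Re (h t) = a t $ 3 * Re (l' t) + \<beta> t $ 3 * Im (l' t)"
  by (simp add: h_def phi_lam[OF t])

lemma Re_h': "Re h' = Re l'' * a t $ 3 + Re (l' t) * a' $ 3 + Im (l' t) * b' $ 3 + Im l'' * \<beta> t $ 3"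
  by (simp add: h'_def phi_lam[OF t] algebra_simps)

section \<open>The normalised coefficients and their velocity along the curve\<close>

lemma m_holomorphic: "m j holomorphic_on \<Omega> \<inter> {z. \<phi> z $ 3 \<noteq> 0}"
  unfolding m_def[abs_def]
  by (intro holomorphic_intros holomorphic_on_subset[OF phi_holomorphic]) auto

lemma open_phi3: "open (\<Omega> \<inter> {z. \<phi> z $ 3 \<noteq> 0})"
proof -
  have "open (\<Omega> \<inter> (\<lambda>z. \<phi> z $ 3) -` (- {0}))"
    by (intro continuous_open_preimage holomorphic_on_imp_continuous_on phi_holomorphic Omega(1)) auto
  moreover have "(\<lambda>z. \<phi> z $ 3) -` (- {0}) = {z. \<phi> z $ 3 \<noteq> 0}" by auto
  ultimately show ?thesis by simp
qed

lemma m_deriv: "(m j has_field_derivative deriv (m j) p) (at p)"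
  using p_in_Omega phi3_nonzero[OF t] by (intro holomorphic_derivI[OF m_holomorphic open_phi3]) auto

lemma m_lam_has_derivative:
  assumes "j = 1 \<or> j = 2"
  shows "((\<lambda>s. Re (m j (lam s))) has_vector_derivative Re (deriv (m j) p * l' t)) (at t within I)"
    "Im (deriv (m j) p * l' t) = 0"
proof -
  have d: "((\<lambda>s. m j (lam s)) has_vector_derivative deriv (m j) p * l' t) (at t within I)"
    using field_vector_diff_chain_within[OF curve_derivatives(1)[OF t] has_field_derivative_at_within[OF m_deriv]]
    by (simp add: o_def mult.commute)
  then show "((\<lambda>s. Re (m j (lam s))) has_vector_derivative Re (deriv (m j) p * l' t)) (at t within I)"
    by (rule bounded_linear.has_vector_derivative[OF bounded_linear_Re])
  show "Im (deriv (m j) p * l' t) = 0"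
    using m_real(1)[OF _ assms] t
    by (intro Im_vector_derivative_eq_0[OF d nontrivial _ _ t]) (auto simp: eventually_at_filter)
qed

lemma m_lam_derivative_orthogonal:
  "Re (m 1 p) * Re (deriv (m 1) p * l' t) + Re (m 2 p) * Re (deriv (m 2) p * l' t) = 0"
proof -
  note d = m_lam_has_derivative(1)[of 1, simplified] m_lam_has_derivative(1)[of 2, simplified]
  have "((\<lambda>s. (Re (m 1 (lam s)))\<^sup>2 + (Re (m 2 (lam s)))\<^sup>2) has_vector_derivative
     2 * (Re (m 1 p) * Re (deriv (m 1) p * l' t) + Re (m 2 p) * Re (deriv (m 2) p * l' t))) (at t within I)"
    unfolding power2_eq_square
    using has_vector_derivative_add[OF has_vector_derivative_mult[OF d(1) d(1)] has_vector_derivative_mult[OF d(2) d(2)]]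
    by (simp add: algebra_simps)
  moreover have "((\<lambda>s. (Re (m 1 (lam s)))\<^sup>2 + (Re (m 2 (lam s)))\<^sup>2) has_vector_derivative 0) (at t within I)"
    by (rule has_vector_derivative_transform[OF t _ has_vector_derivative_const[of 1]]) (simp add: m_unit_lam)
  ultimately have "2 * (Re (m 1 p) * Re (deriv (m 1) p * l' t) + Re (m 2 p) * Re (deriv (m 2) p * l' t)) = 0"
    by (rule vector_derivative_unique_within[OF nontrivial])
  then show ?thesis by simp
qed

text \<open>Stated for a general multiple \<open>f\<close> of \<open>(m 1, m 2, 1)\<close> so that
  it covers both the velocity of \<open>\<alpha>\<close> and \<open>\<beta>\<close>. The derivative
  of the factor \<open>f $ 3\<close> cancels, which leaves the angular velocity of
  \<open>m\<close>.\<close>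

lemma wronskian:
  fixes f :: "real \<Rightarrow> real ^ 3" and f' :: "real ^ 3"
  assumes f: "(f has_vector_derivative f') (at t within I)"
    and par: "\<And>s j. s \<in> I \<Longrightarrow> j = 1 \<or> j = 2 \<Longrightarrow> f s $ j = Re (m j (lam s)) * f s $ 3"
  shows "f t $ 1 * f' $ 2 - f t $ 2 * f' $ 1 = (f t $ 3)\<^sup>2 *
    (Re (m 1 p) * Re (deriv (m 2) p * l' t) - Re (m 2 p) * Re (deriv (m 1) p * l' t))"
proof -
  have fj: "((\<lambda>s. f s $ j) has_vector_derivative f' $ j) (at t within I)" for j
    by (rule bounded_linear.has_vector_derivative[OF bounded_linear_vec_nth f])
  have "f' $ j = Re (m j p) * f' $ 3 + Re (deriv (m j) p * l' t) * f t $ 3" if j: "j = 1 \<or> j = 2" for j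
  proof -
    have "((\<lambda>s. f s $ j) has_vector_derivative Re (m j p) * f' $ 3 + Re (deriv (m j) p * l' t) * f t $ 3) (at t within I)"
      by (rule has_vector_derivative_transform[OF t _ has_vector_derivative_mult[OF m_lam_has_derivative(1)[OF j] fj[of 3]]])
        (simp add: par[OF _ j])
    with fj show ?thesis by (rule vector_derivative_unique_within[OF nontrivial])
  qed
  then have f': "f' $ 1 = Re (m 1 p) * f' $ 3 + Re (deriv (m 1) p * l' t) * f t $ 3"
    "f' $ 2 = Re (m 2 p) * f' $ 3 + Re (deriv (m 2) p * l' t) * f t $ 3" by auto
  show ?thesis
    unfolding f' par[OF t, of 1, simplified] par[OF t, of 2, simplified]
    by (simp add: power2_eq_square algebra_simps)
qed

text \<open>\<open>m \<circ> lam\<close> moves on the unit circle, so the Wronskian vanishes iff its velocity does.\<close>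

lemma nondegenerate_iff:
  "(a t \<noteq> 0 \<longrightarrow> a t $ 1 * a' $ 2 - a t $ 2 * a' $ 1 \<noteq> 0) \<and>
   (\<beta> t \<noteq> 0 \<longrightarrow> \<beta> t $ 1 * b' $ 2 - \<beta> t $ 2 * b' $ 1 \<noteq> 0)
   \<longleftrightarrow> deriv (m 1) p \<noteq> 0 \<or> deriv (m 2) p \<noteq> 0"
proof -
  let ?x = "Re (m 1 p)" and ?y = "Re (m 2 p)"
  let ?x' = "Re (deriv (m 1) p * l' t)" and ?y' = "Re (deriv (m 2) p * l' t)"
  have zero: "deriv (m j) p = 0 \<longleftrightarrow> Re (deriv (m j) p * l' t) = 0" if "j = 1 \<or> j = 2" for j
  proof -
    have "deriv (m j) p = 0 \<longleftrightarrow> deriv (m j) p * l' t = 0" using l'_nonzero[OF t] by simp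
    also have "\<dots> \<longleftrightarrow> Re (deriv (m j) p * l' t) = 0"
      using m_lam_has_derivative(2)[OF that] by (simp only: complex_eq_iff zero_complex.sel) simp
    finally show ?thesis .
  qed
  have id: "(?x * ?y' - ?y * ?x')\<^sup>2 + (?x * ?x' + ?y * ?y')\<^sup>2 = (?x\<^sup>2 + ?y\<^sup>2) * (?x'\<^sup>2 + ?y'\<^sup>2)"
    by (simp add: power2_eq_square algebra_simps)
  have "?x * ?y' - ?y * ?x' = 0 \<longleftrightarrow> ?x' = 0 \<and> ?y' = 0"
    using id unfolding m_lam_derivative_orthogonal m_unit_lam[OF t] by (auto simp: sum_power2_eq_zero_iff)
  then have W: "?x * ?y' - ?y * ?x' \<noteq> 0 \<longleftrightarrow> deriv (m 1) p \<noteq> 0 \<or> deriv (m 2) p \<noteq> 0"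
    using zero[of 1] zero[of 2] by auto
  have a: "a t $ 1 * a' $ 2 - a t $ 2 * a' $ 1 = (a t $ 3)\<^sup>2 * (?x * ?y' - ?y * ?x')"
    by (rule wronskian[OF curve_derivatives(3) m_real(2)])
  have b: "\<beta> t $ 1 * b' $ 2 - \<beta> t $ 2 * b' $ 1 = (\<beta> t $ 3)\<^sup>2 * (?x * ?y' - ?y * ?x')"
    by (rule wronskian[OF curve_derivatives(4) m_real(3)])
  show ?thesis
    unfolding a b W[symmetric]
    using null_vectors[OF t] null_vector_eq_0[of "a t"] null_vector_eq_0[of "\<beta> t"] by auto
qed

end

section \<open>Sufficiency\<close>

context bjorling_point begin

lemma swallowtail_if:
  assumes h: "Re (h t) = 0" "Re h' \<noteq> 0" and nondeg: "deriv (m 1) p \<noteq> 0 \<or> deriv (m 2) p \<noteq> 0"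
  shows "has_swallowtail X p"
proof -
  define S0 where "S0 = \<Omega> \<inter> {z. \<phi> z $ 3 \<noteq> 0}"
  have oS0: "open S0" using open_phi3 by (simp add: S0_def)
  have lam_S0: "lam s \<in> S0" if "s \<in> I" for s using Omega(3) phi3_nonzero that by (simp add: S0_def)
  obtain \<epsilon> where \<epsilon>: "0 < \<epsilon>" "ball p \<epsilon> \<subseteq> S0" using oS0 lam_S0[OF t] by (meson openE)
  have \<epsilon>\<Omega>: "ball p \<epsilon> \<subseteq> \<Omega>" using \<epsilon>(2) by (auto simp: S0_def)
  obtain P where P: "\<And>w. w \<in> ball p \<epsilon> \<Longrightarrow> (P has_field_derivative \<phi> w $ 3) (at w within ball p \<epsilon>)"
    using holomorphic_convex_primitive'[OF convex_ball open_ball holomorphic_on_subset[OF phi_holomorphic \<epsilon>\<Omega>]]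
    by metis
  define \<xi> where "\<xi> z = P z - P p" for z
  have \<xi>': "(\<xi> has_field_derivative \<phi> w $ 3) (at w)" if "w \<in> ball p \<epsilon>" for w
  proof -
    have "(P has_field_derivative \<phi> w $ 3) (at w)" using P[OF that] at_within_open[OF that open_ball] by simp
    then show ?thesis unfolding \<xi>_def[abs_def] by (auto intro!: derivative_eq_intros)
  qed
  have \<xi>p: "\<xi> p = 0" by (simp add: \<xi>_def)
  have hol\<xi>: "\<xi> holomorphic_on ball p \<epsilon>"
    using \<xi>' unfolding holomorphic_on_open[OF open_ball] by blast
  have p\<epsilon>: "p \<in> ball p \<epsilon>" using \<epsilon> by simp
  have "deriv \<xi> p \<noteq> 0" using DERIV_imp_deriv[OF \<xi>'[OF p\<epsilon>]] phi3_nonzero[OF t] by simp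
  then obtain r where r: "0 < r" "ball p r \<subseteq> ball p \<epsilon>" "inj_on \<xi> (ball p r)"
    using has_complex_derivative_locally_injective[OF hol\<xi> p\<epsilon> open_ball] by metis
  have hol\<xi>r: "\<xi> holomorphic_on ball p r" using holomorphic_on_subset[OF hol\<xi> r(2)] .
  obtain \<omega> where \<omega>: "\<omega> holomorphic_on \<xi> ` ball p r" "\<And>z. z \<in> ball p r \<Longrightarrow> \<omega> (\<xi> z) = z"
    using holomorphic_has_inverse[OF hol\<xi>r open_ball r(3)] by metis
  have "open (\<xi> ` ball p r)" by (rule open_mapping_thm3[OF hol\<xi>r open_ball r(3)])
  moreover have "0 \<in> \<xi> ` ball p r" using \<xi>p r(1) by (metis centre_in_ball image_eqI)
  ultimately obtain d where d: "0 < d" "ball 0 d \<subseteq> \<xi> ` ball p r" by (meson openE)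
  have \<omega>d: "\<omega> w \<in> ball p r" "\<xi> (\<omega> w) = w" if w: "w \<in> ball 0 d" for w
  proof -
    obtain z where "z \<in> ball p r" "w = \<xi> z" using d(2) w by blast
    then show "\<omega> w \<in> ball p r" "\<xi> (\<omega> w) = w" using \<omega>(2)[of z] by simp_all
  qed
  have \<omega>0: "\<omega> 0 = p" using \<omega>(2)[of p] \<xi>p r(1) by simp
  \<comment> \<open>Cosine and sine of the rotation about the third axis that takes
    \<open>(m 1 p, m 2 p)\<close> to \<open>(1, 0)\<close>.\<close>
  define c0 where "c0 = Re (m 1 p)"
  define s0 where "s0 = Re (m 2 p)"
  have unit0: "c0\<^sup>2 + s0\<^sup>2 = 1" using m_unit_lam[OF t] by (simp add: c0_def s0_def)
  have mp: "m 1 p = of_real c0" "m 2 p = of_real s0"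
    using m_real(1)[OF t] by (simp_all add: c0_def s0_def complex_eq_iff)
  define M1 where "M1 z = of_real c0 * m 1 z + of_real s0 * m 2 z" for z
  define M2 where "M2 z = of_real c0 * m 2 z - of_real s0 * m 1 z" for z
  have holm: "m j holomorphic_on S0" for j using m_holomorphic by (simp add: S0_def)
  have holM: "M1 holomorphic_on S0" "M2 holomorphic_on S0"
    unfolding M1_def[abs_def] M2_def[abs_def] by (intro holomorphic_intros holm)+
  have Mphi: "M1 z * \<phi> z $ 3 = of_real c0 * \<phi> z $ 1 + of_real s0 * \<phi> z $ 2"
    "M2 z * \<phi> z $ 3 = of_real c0 * \<phi> z $ 2 - of_real s0 * \<phi> z $ 1" if "z \<in> S0" for z
    using that by (simp_all add: M1_def M2_def m_def S0_def field_simps)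
  have Munit: "(M1 z)\<^sup>2 + (M2 z)\<^sup>2 = 1" if "z \<in> S0" for z
  proof -
    have "(M1 z)\<^sup>2 + (M2 z)\<^sup>2 = of_real (c0\<^sup>2 + s0\<^sup>2) * ((m 1 z)\<^sup>2 + (m 2 z)\<^sup>2)"
      by (simp add: M1_def M2_def power2_eq_square algebra_simps)
    also have "(m 1 z)\<^sup>2 + (m 2 z)\<^sup>2 = 1"
      using phi_null[of z] that by (simp add: m_def S0_def power_divide flip: add_divide_distrib)
    finally show ?thesis by (simp add: unit0)
  qed
  define n1 where "n1 = M1 \<circ> \<omega>"
  define n2 where "n2 = M2 \<circ> \<omega>"
  have \<omega>S0: "\<omega> ` ball 0 d \<subseteq> S0" using \<omega>d(1) r(2) \<epsilon>(2) by blast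
  have hol\<omega>: "\<omega> holomorphic_on ball 0 d" using \<omega>(1) d(2) by (rule holomorphic_on_subset)
  have holn: "n1 holomorphic_on ball 0 d" "n2 holomorphic_on ball 0 d"
    unfolding n1_def n2_def by (rule holomorphic_on_compose_gen[OF hol\<omega> _ \<omega>S0], rule holM)+
  obtain Q1 where Q1: "\<And>w. w \<in> ball 0 d \<Longrightarrow> (Q1 has_field_derivative n1 w) (at w within ball 0 d)"
    using holomorphic_convex_primitive'[OF convex_ball open_ball holn(1)] by metis
  obtain Q2 where Q2: "\<And>w. w \<in> ball 0 d \<Longrightarrow> (Q2 has_field_derivative n2 w) (at w within ball 0 d)"
    using holomorphic_convex_primitive'[OF convex_ball open_ball holn(2)] by metis
  define N1 where "N1 w = Q1 w - Q1 0" for w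
  define N2 where "N2 w = Q2 w - Q2 0" for w
  have N': "(N1 has_field_derivative n1 w) (at w)" "(N2 has_field_derivative n2 w) (at w)" if "w \<in> ball 0 d" for w
  proof -
    have "(Q1 has_field_derivative n1 w) (at w)" "(Q2 has_field_derivative n2 w) (at w)"
      using Q1[OF that] Q2[OF that] at_within_open[OF that open_ball] by simp_all
    then show "(N1 has_field_derivative n1 w) (at w)" "(N2 has_field_derivative n2 w) (at w)"
      unfolding N1_def[abs_def] N2_def[abs_def] by (auto intro!: derivative_eq_intros)
  qed
  have n\<xi>: "n1 (\<xi> z) = M1 z" "n2 (\<xi> z) = M2 z" if "z \<in> ball p r" for z
    using \<omega>(2)[OF that] by (simp_all add: n1_def n2_def)
  have cont\<xi>: "continuous_on (ball p r) \<xi>" by (rule holomorphic_on_imp_continuous_on[OF hol\<xi>r])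
  obtain r2 where r2: "0 < r2" "r2 \<le> r" "\<And>z. z \<in> ball p r2 \<Longrightarrow> \<xi> z \<in> ball 0 d"
  proof -
    have "open (ball p r \<inter> \<xi> -` ball 0 d)" by (rule continuous_open_preimage[OF cont\<xi> open_ball open_ball])
    moreover have "p \<in> ball p r \<inter> \<xi> -` ball 0 d" using r(1) d(1) \<xi>p by simp
    ultimately obtain r2 where "0 < r2" "ball p r2 \<subseteq> ball p r \<inter> \<xi> -` ball 0 d" by (meson openE)
    then show ?thesis using that[of "min r2 r"] r(1) by (auto simp: subset_iff)
  qed
  have r2r: "z \<in> ball p r" "z \<in> S0" "z \<in> ball p \<epsilon>" if "z \<in> ball p r2" for z
    using that r2 r \<epsilon> by (auto simp: subset_iff)
  define \<zeta> where "\<zeta> s = \<xi> (lam s)" for s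
  have \<zeta>t: "\<zeta> t = 0" by (simp add: \<zeta>_def \<xi>p)
  \<comment> \<open>The velocity of \<open>M2\<close> along the trace, expressed in the coordinate
    \<open>\<xi>\<close>. It is real because \<open>M2\<close> is real there; this fact at
    \<open>t\<close>, and its derivative at \<open>t\<close>, yield the hypotheses on
    \<open>n2\<close>.\<close>
  define K where "K s = deriv n2 (\<zeta> s) * h s" for s
  have K: "K s = deriv M2 (lam s) * l' s" if "s \<in> I" "lam s \<in> ball p r2" for s
  proof -
    have "(n2 has_field_derivative deriv n2 (\<xi> (lam s))) (at (\<xi> (lam s)))"
      using r2(3)[OF that(2)] by (intro holomorphic_derivI[OF holn(2) open_ball])
    from DERIV_chain2[OF this \<xi>'[OF r2r(3)[OF that(2)]]]
    have "((\<lambda>z. n2 (\<xi> z)) has_field_derivative deriv n2 (\<zeta> s) * \<phi> (lam s) $ 3) (at (lam s))"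
      by (simp add: \<zeta>_def)
    then have "(M2 has_field_derivative deriv n2 (\<zeta> s) * \<phi> (lam s) $ 3) (at (lam s))"
      by (rule has_field_derivative_transform_within_open[OF _ open_ball that(2)])
        (use n\<xi>(2) r2r in blast)
    then show ?thesis by (simp add: K_def h_def DERIV_imp_deriv)
  qed
  have Im_M2: "Im (M2 (lam s)) = 0" if "s \<in> I" for s
    using m_real(1)[OF that] by (simp add: M2_def)
  have Im_K: "Im (K s) = 0" if "s \<in> I" "lam s \<in> ball p r2" for s
  proof -
    have "(M2 has_field_derivative deriv M2 (lam s)) (at (lam s))"
      by (rule holomorphic_derivI[OF holM(2) oS0 lam_S0[OF that(1)]])
    from field_vector_diff_chain_within[OF curve_derivatives(1)[OF that(1)] has_field_derivative_at_within[OF this]]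
    have "((\<lambda>s. M2 (lam s)) has_vector_derivative K s) (at s within I)"
      by (simp add: o_def K[OF that] mult.commute)
    then show ?thesis
      by (rule Im_vector_derivative_eq_0[OF _ nontrivial_within])
        (use that in \<open>auto simp: eventually_at_filter Im_M2\<close>)
  qed
  have p2: "p \<in> ball p r2" using r2 by simp
  have d0: "0 \<in> ball (0::complex) d" using d by simp
  have holn': "deriv n2 holomorphic_on ball 0 d" by (rule holomorphic_deriv[OF holn(2) open_ball])
  have \<zeta>': "(\<zeta> has_vector_derivative h t) (at t within I)"
    using field_vector_diff_chain_within[OF curve_derivatives(1)[OF t] has_field_derivative_at_within[OF \<xi>'[OF p\<epsilon>]]]
    by (simp add: o_def \<zeta>_def[abs_def] h_def mult.commute)
  have "(deriv n2 has_field_derivative deriv (deriv n2) (\<zeta> t)) (at (\<zeta> t))"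
    using holomorphic_derivI[OF holn' open_ball d0] by (simp add: \<zeta>t)
  from field_vector_diff_chain_within[OF \<zeta>' has_field_derivative_at_within[OF this]]
  have "((\<lambda>s. deriv n2 (\<zeta> s)) has_vector_derivative h t * deriv (deriv n2) 0) (at t within I)"
    by (simp add: o_def \<zeta>t)
  from has_vector_derivative_mult[OF this h_has_derivative]
  have "(K has_vector_derivative deriv n2 0 * h' + h t * deriv (deriv n2) 0 * h t) (at t within I)"
    by (simp add: K_def[abs_def] \<zeta>t)
  then have Im2: "Im (deriv n2 0 * h' + h t * deriv (deriv n2) 0 * h t) = 0"
  proof (rule Im_vector_derivative_eq_0[OF _ nontrivial])
    show "Im (K t) = 0" "t \<in> I" using Im_K[OF t p2] t by simp_all
    have "\<forall>\<^sub>F s in at t within I. s \<in> I" by (simp add: eventually_at_filter)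
    then show "\<forall>\<^sub>F s in at t within I. Im (K s) = 0"
      using topological_tendstoD[OF lam_continuous open_ball p2] by eventually_elim (rule Im_K)
  qed
  have ht: "h t = \<i> * of_real (Im (h t))" "Im (h t) \<noteq> 0"
  proof -
    have "h t \<noteq> 0" using l'_nonzero[OF t] phi3_nonzero[OF t] by (simp add: h_def)
    then show "h t = \<i> * of_real (Im (h t))" "Im (h t) \<noteq> 0" using h(1) by (auto simp: complex_eq_iff)
  qed
  \<comment> \<open>\<open>h t\<close> is purely imaginary by the first condition, so reality of
    \<open>K t\<close> forces \<open>deriv n2 0\<close> to be imaginary too.\<close>
  have "Im (K t) = Im (h t) * Re (deriv n2 0)" by (subst K_def, subst ht(1)) (simp add: \<zeta>t)
  then have Re_n2': "Re (deriv n2 0) = 0" using Im_K[OF t p2] ht(2) by simp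
  have Im_n2': "Im (deriv n2 0) \<noteq> 0"
  proof
    assume "Im (deriv n2 0) = 0"
    with Re_n2' have "K t = 0" by (simp add: K_def \<zeta>t complex_eq_iff)
    then have "deriv M2 p * l' t = 0" using K[OF t p2] by simp
    moreover have "deriv M2 p = of_real c0 * deriv (m 2) p - of_real s0 * deriv (m 1) p"
      unfolding M2_def[abs_def] by (intro DERIV_imp_deriv DERIV_diff DERIV_cmult m_deriv)
    ultimately have "(of_real c0 * deriv (m 2) p - of_real s0 * deriv (m 1) p) * l' t = 0" by (simp only:)
    then have "Re ((of_real c0 * deriv (m 2) p - of_real s0 * deriv (m 1) p) * l' t) = 0"
      by (simp only: zero_complex.sel)
    then have 1: "c0 * Re (deriv (m 2) p * l' t) - s0 * Re (deriv (m 1) p * l' t) = 0"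
      by (simp add: algebra_simps)
    have 2: "c0 * Re (deriv (m 1) p * l' t) + s0 * Re (deriv (m 2) p * l' t) = 0"
      using m_lam_derivative_orthogonal by (simp add: c0_def s0_def)
    \<comment> \<open>The velocity of \<open>m\<close> would vanish both along
      \<open>(c0, s0)\<close>, by orthogonality, and across it: it would have no component
      left.\<close>
    have "(c0 * y - s0 * x)\<^sup>2 + (c0 * x + s0 * y)\<^sup>2 = (c0\<^sup>2 + s0\<^sup>2) * (x\<^sup>2 + y\<^sup>2)" for x y
      by (simp add: power2_eq_square algebra_simps)
    from this[of "Re (deriv (m 2) p * l' t)" "Re (deriv (m 1) p * l' t)"]
    have "Re (deriv (m 1) p * l' t) = 0" "Re (deriv (m 2) p * l' t) = 0"
      unfolding 1 2 unit0 by (simp_all add: sum_power2_eq_zero_iff)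
    then have "deriv (m 1) p * l' t = 0" "deriv (m 2) p * l' t = 0"
      using m_lam_has_derivative(2)[of 1] m_lam_has_derivative(2)[of 2] by (simp_all only: complex_eq_iff) simp_all
    then show False using nondeg l'_nonzero[OF t] by simp
  qed
  have Im_n2'': "Im ((deriv ^^ 2) n2 0) \<noteq> 0"
  proof
    assume 0: "Im ((deriv ^^ 2) n2 0) = 0"
    \<comment> \<open>As \<open>h t\<close> and \<open>deriv n2 0\<close> are imaginary,
      \<open>Im2\<close> says that \<open>Im (deriv n2 0) * Re h'\<close> equals
      \<open>(Im (h t))^2\<close> times the imaginary part of the second derivative of
      \<open>n2\<close>.\<close>
    have "Im (h t * deriv (deriv n2) 0 * h t) = 0"
      using 0 by (subst (1 2) ht(1)) (simp add: numeral_2_eq_2)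
    then have "Im (deriv n2 0) * Re h' = 0" using Im2 Re_n2' by simp
    then show False using Im_n2' h(2) by simp
  qed
  interpret maxface_germ n1 n2 N1 N2 d
  proof
    show "0 < d" by fact
    show "n1 holomorphic_on ball 0 d" "n2 holomorphic_on ball 0 d" by fact+
    show "(N1 has_field_derivative n1 z) (at z)" "(N2 has_field_derivative n2 z) (at z)" if "z \<in> ball 0 d" for z
      using N'[OF that] .
    show "N1 0 = 0" "N2 0 = 0" by (simp_all add: N1_def N2_def)
    show "(n1 z)\<^sup>2 + (n2 z)\<^sup>2 = 1" if "z \<in> ball 0 d" for z
    proof -
      have "\<omega> z \<in> S0" using \<omega>S0 that by blast
      then show ?thesis using Munit by (simp add: n1_def n2_def)
    qed
    have "n1 0 = of_real (c0\<^sup>2 + s0\<^sup>2)" by (simp add: n1_def \<omega>0 M1_def mp power2_eq_square)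
    then show "n1 0 = 1" by (simp add: unit0)
    show "n2 0 = 0" by (simp add: n2_def \<omega>0 M2_def mp)
    show "Re (deriv n2 0) = 0" "Im (deriv n2 0) \<noteq> 0" "Im ((deriv ^^ 2) n2 0) \<noteq> 0" by fact+
  qed
  \<comment> \<open>The same rotation acting on space; it turns \<open>X - X p\<close> into the germ
    \<open>surf\<close>.\<close>
  define R :: "real ^ 3 \<Rightarrow> real ^ 3" where
    "R v = vector [c0 * v $ 1 + s0 * v $ 2, c0 * v $ 2 - s0 * v $ 1, v $ 3]" for v
  have linR: "linear R"
    by (rule linearI) (simp_all add: R_def vec_eq_iff forall_3 algebra_simps)
  then have blR: "bounded_linear R" by (simp add: linear_conv_bounded_linear)
  have injR: "inj R"
  proof -
    have "v = 0" if "R v = 0" for v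
    proof -
      have v: "c0 * v $ 1 + s0 * v $ 2 = 0" "c0 * v $ 2 - s0 * v $ 1 = 0" "v $ 3 = 0"
        using that by (simp_all add: R_def vec_eq_iff forall_3)
      have "(c0 * v $ 1 + s0 * v $ 2)\<^sup>2 + (c0 * v $ 2 - s0 * v $ 1)\<^sup>2 = (c0\<^sup>2 + s0\<^sup>2) * ((v $ 1)\<^sup>2 + (v $ 2)\<^sup>2)"
        by (simp add: power2_eq_square algebra_simps)
      then have "v $ 1 = 0" "v $ 2 = 0" unfolding v unit0 by (simp_all add: sum_power2_eq_zero_iff)
      with v(3) show ?thesis by (simp add: vec_eq_iff forall_3)
    qed
    then show ?thesis using linR linear_injective_0 by blast
  qed
  have surf: "surf (\<xi> z) = R (X z - X p)" if z: "z \<in> ball p r2" for z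
  proof -
    have sub: "ball p r2 \<subseteq> \<Omega>" using r2r \<epsilon>\<Omega> by blast
    have d: "((\<lambda>z. N1 (\<xi> z)) has_field_derivative of_real c0 * \<phi> w $ 1 + of_real s0 * \<phi> w $ 2) (at w)"
      "((\<lambda>z. N2 (\<xi> z)) has_field_derivative of_real c0 * \<phi> w $ 2 - of_real s0 * \<phi> w $ 1) (at w)"
      if "w \<in> ball p r2" for w
    proof -
      note b = r2r[OF that]
      have "n1 (\<xi> w) * \<phi> w $ 3 = of_real c0 * \<phi> w $ 1 + of_real s0 * \<phi> w $ 2"
        "n2 (\<xi> w) * \<phi> w $ 3 = of_real c0 * \<phi> w $ 2 - of_real s0 * \<phi> w $ 1"
        by (simp_all only: n\<xi>[OF b(1)] Mphi[OF b(2)])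
      with DERIV_chain2[OF N'(1)[OF r2(3)[OF that]] \<xi>'[OF b(3)]] DERIV_chain2[OF N'(2)[OF r2(3)[OF that]] \<xi>'[OF b(3)]]
      show "((\<lambda>z. N1 (\<xi> z)) has_field_derivative of_real c0 * \<phi> w $ 1 + of_real s0 * \<phi> w $ 2) (at w)"
        "((\<lambda>z. N2 (\<xi> z)) has_field_derivative of_real c0 * \<phi> w $ 2 - of_real s0 * \<phi> w $ 1) (at w)"
        by (simp_all only:)
    qed
    have "Re (N1 (\<xi> z) - N1 (\<xi> p)) = (\<Sum>j\<in>UNIV. vector [c0, s0, 0] $ j * (X z $ j - X p $ j))"
      by (rule X_increment[OF sub z, of "\<lambda>z. N1 (\<xi> z)" "\<lambda>j. vector [c0, s0, 0] $ j"], rule DERIV_cong, erule d)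
        (simp add: sum_3)
    moreover have "Re (N2 (\<xi> z) - N2 (\<xi> p)) = (\<Sum>j\<in>UNIV. vector [- s0, c0, 0] $ j * (X z $ j - X p $ j))"
      by (rule X_increment[OF sub z, of "\<lambda>z. N2 (\<xi> z)" "\<lambda>j. vector [- s0, c0, 0] $ j"], rule DERIV_cong, erule d)
        (simp add: sum_3)
    moreover have "Re (\<xi> z - \<xi> p) = (\<Sum>j\<in>UNIV. vector [0, 0, 1] $ j * (X z $ j - X p $ j))"
      by (rule X_increment[OF sub z, of \<xi> "\<lambda>j. vector [0, 0, 1] $ j"], rule DERIV_cong, erule \<xi>'[OF r2r(3)])
        (simp add: sum_3)
    ultimately show ?thesis
      by (simp add: surf_def R_def vec_eq_iff forall_3 sum_3 \<xi>p prim_0)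
  qed
  obtain \<epsilon>' \<delta> \<eta> \<Psi> where nf: "0 < \<epsilon>'" "\<epsilon>' \<le> d" "0 < \<delta>" "Cinf_on (ball 0 \<epsilon>') \<eta>" "\<eta> 0 = 0"
    "inj (frechet_derivative \<eta> (at 0))"
    "Cinf_on (ball 0 \<delta>) \<Psi>" "\<Psi> 0 = 0" "inj (frechet_derivative \<Psi> (at 0))"
    "\<And>\<xi>. \<xi> \<in> ball 0 \<epsilon>' \<Longrightarrow> surf \<xi> \<in> ball 0 \<delta> \<and> \<Psi> (surf \<xi>) = f_sw (\<eta> \<xi>)"
    by (rule swallowtail_normal_form) (rule that; assumption)
  define S where "S = ball p r2 \<inter> \<xi> -` ball 0 \<epsilon>'"
  have oS: "open S"
    unfolding S_def using r2(2) by (intro continuous_open_preimage open_ball continuous_on_subset[OF cont\<xi>]) auto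
  have pS: "p \<in> S" using r2 nf(1) by (simp add: S_def \<xi>p)
  define T where "T = (\<lambda>Y. R (Y - X p)) -` ball 0 \<delta>"
  have R': "((\<lambda>Y. R (Y - X p)) has_derivative R) (at Y)" for Y
    using bounded_linear.has_derivative[OF blR has_derivative_diff[OF has_derivative_ident has_derivative_const]]
    by simp
  have "continuous_on UNIV (\<lambda>Y. R (Y - X p))"
    using has_derivative_continuous[OF R'] by (simp add: continuous_on_eq_continuous_at)
  then have oT: "open T" unfolding T_def by (intro open_vimage open_ball)
  have R0: "R 0 = 0" using linR by (rule linear_0)
  show ?thesis
  proof (rule has_swallowtailI)
    show "open S" "p \<in> S" "open T" by fact+
    show "X p \<in> T" using nf(3) by (simp add: T_def R0)
    show "Cinf_on S (\<lambda>z. \<eta> (\<xi> z))"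
      unfolding Cinf_on_def
    proof
      fix k
      have c: "Ck_on k (ball 0 \<epsilon>') \<eta>" using nf(4) by (simp add: Cinf_on_def)
      have "\<xi> holomorphic_on S"
        using r2r by (intro holomorphic_on_subset[OF hol\<xi>]) (auto simp: S_def)
      then show "Ck_on k S (\<lambda>z. \<eta> (\<xi> z))"
        by (rule Ck_on_compose[OF oS open_ball c Ck_on_holomorphic[OF oS]]) (auto simp: S_def)
    qed
    show "Cinf_on T (\<lambda>Y. \<Psi> (R (Y - X p)))"
      unfolding Cinf_on_def
    proof
      fix k
      have c1: "Ck_on k (ball 0 \<delta>) \<Psi>" using nf(7) by (simp add: Cinf_on_def)
      have c2: "Ck_on k T (\<lambda>Y. R (Y - X p))"
        by (intro Ck_on_bounded_linear[OF oT blR] Ck_on_diff Ck_on_const oT Ck_on_linear bounded_linear_ident)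
      show "Ck_on k T (\<lambda>Y. \<Psi> (R (Y - X p)))"
        by (rule Ck_on_compose[OF oT open_ball c1 c2]) (auto simp: T_def)
    qed
    show "\<eta> (\<xi> p) = 0" "\<Psi> (R (X p - X p)) = 0" by (simp_all add: \<xi>p nf R0)
    have "Ck_on (Suc 0) (ball 0 \<epsilon>') \<eta>" using nf(4) unfolding Cinf_on_def by blast
    from Ck_on_Suc_derivative[OF open_ball this, of "\<xi> p"]
    have "(\<eta> has_derivative frechet_derivative \<eta> (at (\<xi> p))) (at (\<xi> p))"
      using nf(1) by (simp add: \<xi>p)
    from diff_chain_at[OF \<xi>'[OF p\<epsilon>, unfolded has_field_derivative_def] this]
    have eq: "frechet_derivative \<eta> (at 0) \<circ> (*) (\<phi> p $ 3) = frechet_derivative (\<eta> \<circ> \<xi>) (at p)"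
      unfolding \<xi>p by (rule frechet_derivative_at)
    have "inj ((*) (\<phi> p $ 3))" using phi3_nonzero[OF t] by (simp add: inj_on_def)
    with nf(6) have "inj (frechet_derivative (\<eta> \<circ> \<xi>) (at p))"
      unfolding eq[symmetric] by (rule inj_compose)
    then show "inj (frechet_derivative (\<lambda>z. \<eta> (\<xi> z)) (at p))" by (simp add: comp_def)
    have "Ck_on (Suc 0) (ball 0 \<delta>) \<Psi>" using nf(7) unfolding Cinf_on_def by blast
    from Ck_on_Suc_derivative[OF open_ball this, of "R (X p - X p)"]
    have "(\<Psi> has_derivative frechet_derivative \<Psi> (at (R (X p - X p)))) (at (R (X p - X p)))"
      using nf(3) by (simp add: R0)
    from diff_chain_at[OF R' this]
    have eq: "frechet_derivative \<Psi> (at 0) \<circ> R = frechet_derivative (\<Psi> \<circ> (\<lambda>Y. R (Y - X p))) (at (X p))"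
      unfolding R0 diff_self by (rule frechet_derivative_at)
    from nf(9) injR have "inj (frechet_derivative (\<Psi> \<circ> (\<lambda>Y. R (Y - X p))) (at (X p)))"
      unfolding eq[symmetric] by (rule inj_compose)
    then show "inj (frechet_derivative (\<lambda>Y. \<Psi> (R (Y - X p))) (at (X p)))" by (simp add: comp_def)
    show "isCont X p" using X_has_derivative[OF p_in_Omega] by (rule has_derivative_continuous)
    have "\<Psi> (R (X z - X p)) = f_sw (\<eta> (\<xi> z))" if "z \<in> S" for z
      using that surf[of z] nf(10)[of "\<xi> z"] by (simp add: S_def)
    then show "\<forall>\<^sub>F z in nhds p. \<Psi> (R (X z - X p)) = f_sw (\<eta> (\<xi> z))"
      using oS pS by (auto simp: eventually_nhds)
  qed
qed

end

section \<open>Necessity\<close>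

lemma f_sw_nth: "f_sw w $ 1 = 3 * (w $ 1) ^ 4 + (w $ 1)\<^sup>2 * w $ 2"
  "f_sw w $ 2 = 4 * (w $ 1) ^ 3 + 2 * w $ 1 * w $ 2" "f_sw w $ 3 = w $ 2"
  by (simp_all add: f_sw_def Let_def)

definition f_sw' :: "real ^ 2 \<Rightarrow> real ^ 2 \<Rightarrow> real ^ 3" where
  "f_sw' w k = vector [(12 * (w $ 1) ^ 3 + 2 * w $ 1 * w $ 2) * k $ 1 + (w $ 1)\<^sup>2 * k $ 2,
     (12 * (w $ 1)\<^sup>2 + 2 * w $ 2) * k $ 1 + 2 * w $ 1 * k $ 2, k $ 2]"

lemma f_sw_has_derivative: "(f_sw has_derivative f_sw' w) (at w)"
proof -
  have c: "((\<lambda>w::real ^ 2. w $ j) has_derivative (\<lambda>k. k $ j)) (at w)" for j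
    by (rule bounded_linear_imp_has_derivative[OF bounded_linear_vec_nth])
  have "((\<lambda>w. f_sw w $ 1) has_derivative (\<lambda>k. f_sw' w k $ 1)) (at w)"
    unfolding f_sw_nth by (rule derivative_eq_intros c refl)+ (simp add: fun_eq_iff f_sw'_def algebra_simps)
  moreover have "((\<lambda>w. f_sw w $ 2) has_derivative (\<lambda>k. f_sw' w k $ 2)) (at w)"
    unfolding f_sw_nth by (rule derivative_eq_intros c refl)+ (simp add: fun_eq_iff f_sw'_def algebra_simps)
  moreover have "((\<lambda>w. f_sw w $ 3) has_derivative (\<lambda>k. f_sw' w k $ 3)) (at w)"
    using c[of 2] by (simp add: f_sw_nth f_sw'_def)
  ultimately have "((\<lambda>w. f_sw w $ i) has_derivative (\<lambda>k. f_sw' w k $ i)) (at w)" for i :: 3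
    using exhaust_3[of i] by metis
  then show ?thesis by (subst has_derivative_componentwise_within) (auto simp: Basis_vec_def inner_axis)
qed

lemma diffeomorphism_derivative:
  assumes "diffeomorphism U V f g" "x \<in> U"
  shows "(f has_derivative frechet_derivative f (at x)) (at x)"
proof -
  have "open U" "Ck_on (Suc 0) U f"
    using assms(1) by (simp_all add: diffeomorphism_def Cinf_on_def del: Ck_on.simps)
  then show ?thesis using assms(2) by (rule Ck_on_Suc_derivative)
qed

lemma diffeomorphism_sym: "diffeomorphism U V f g \<Longrightarrow> diffeomorphism V U g f"
  using homeomorphism_sym[of U V f g] by (simp add: diffeomorphism_def)

lemma diffeomorphism_mem: "diffeomorphism U V f g \<Longrightarrow> x \<in> U \<Longrightarrow> f x \<in> V"
  "diffeomorphism U V f g \<Longrightarrow> x \<in> U \<Longrightarrow> g (f x) = x"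
  by (auto simp: diffeomorphism_def homeomorphism_def)

lemma diffeomorphism_derivative_inj:
  assumes "diffeomorphism U V f g" "x \<in> U" "frechet_derivative f (at x) v = 0"
  shows "v = 0"
proof -
  have U: "open U" using assms(1) by (simp add: diffeomorphism_def)
  have "(g has_derivative frechet_derivative g (at (f x))) (at (f x))"
    by (rule diffeomorphism_derivative[OF diffeomorphism_sym[OF assms(1)] diffeomorphism_mem(1)[OF assms(1,2)]])
  from diff_chain_at[OF diffeomorphism_derivative[OF assms(1,2)] this]
  have "(g \<circ> f has_derivative frechet_derivative g (at (f x)) \<circ> frechet_derivative f (at x)) (at x)" .
  moreover have "(g \<circ> f has_derivative (\<lambda>v. v)) (at x)"
    by (rule has_derivative_transform_within_open[OF has_derivative_ident U assms(2)])
      (use diffeomorphism_mem(2)[OF assms(1)] in auto)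
  ultimately have "frechet_derivative g (at (f x)) (frechet_derivative f (at x) v) = v"
    using fun_cong[OF has_derivative_unique, of "g \<circ> f" _ x _ v] by (simp add: o_def)
  moreover have "frechet_derivative g (at (f x)) 0 = 0"
    using has_derivative_linear[OF \<open>(g has_derivative frechet_derivative g (at (f x))) (at (f x))\<close>]
    by (rule linear_0)
  ultimately show ?thesis using assms(3) by simp
qed

lemma diffeomorphism_continuous_derivative:
  assumes "diffeomorphism U V f g" "x \<in> U"
  shows "isCont (\<lambda>x. frechet_derivative f (at x) v) x"
proof -
  have "open U" "Ck_on (Suc 0) U f"
    using assms(1) by (simp_all add: diffeomorphism_def Cinf_on_def del: Ck_on.simps)
  then show ?thesis using assms(2) continuous_on_eq_continuous_at by auto
qed

text \<open>The Taylor remainder is small compared with \<open>y\<close>, hence with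
  \<open>q\<close>. For quadratic \<open>q\<close> this transports the acceleration of a curve at a
  point of zero velocity by a first derivative alone.\<close>

lemma has_derivative_quotient_limit:
  assumes "(f has_derivative f') (at 0)" "(y \<longlongrightarrow> 0) G"
    and "((\<lambda>s. y s /\<^sub>R q s) \<longlongrightarrow> y0) G"
  shows "((\<lambda>s. (f (y s) - f 0) /\<^sub>R q s) \<longlongrightarrow> f' y0) G"
proof -
  have bl: "bounded_linear f'" using assms(1) by (rule has_derivative_bounded_linear)
  \<comment> \<open>At \<open>z = 0\<close> the division by zero yields 0, which makes
    \<open>e\<close> continuous there, so parameters with \<open>y s = 0\<close> need no separate
    limit.\<close>
  define e where "e z = norm (f z - f 0 - f' z) / norm z" for z
  have "(e \<longlongrightarrow> 0) (at 0)"
    using assms(1) by (simp add: has_derivative_iff_norm e_def[abs_def])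
  then have "isCont e 0" by (simp add: isCont_def e_def)
  then have "((\<lambda>s. e (y s)) \<longlongrightarrow> 0) G"
    using isCont_tendsto_compose[OF _ assms(2), of e] by (simp add: e_def)
  moreover have "((\<lambda>s. norm (y s /\<^sub>R q s)) \<longlongrightarrow> norm y0) G" using assms(3) by (rule tendsto_norm)
  ultimately have "((\<lambda>s. e (y s) * norm (y s /\<^sub>R q s)) \<longlongrightarrow> 0) G"
    using tendsto_mult by fastforce
  moreover have "(\<lambda>s. e (y s) * norm (y s /\<^sub>R q s)) = (\<lambda>s. norm ((f (y s) - f 0 - f' (y s)) /\<^sub>R q s))"
  proof
    show "e (y s) * norm (y s /\<^sub>R q s) = norm ((f (y s) - f 0 - f' (y s)) /\<^sub>R q s)" for s
      using linear_0[of f'] bl by (cases "y s = 0") (simp_all add: e_def bounded_linear.linear)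
  qed
  ultimately have "((\<lambda>s. norm ((f (y s) - f 0 - f' (y s)) /\<^sub>R q s)) \<longlongrightarrow> 0) G"
    by (simp only:)
  then have "((\<lambda>s. (f (y s) - f 0 - f' (y s)) /\<^sub>R q s) \<longlongrightarrow> 0) G"
    by (rule tendsto_norm_zero_cancel)
  moreover have "((\<lambda>s. f' (y s /\<^sub>R q s)) \<longlongrightarrow> f' y0) G"
    using bounded_linear.tendsto[OF bl assms(3)] .
  ultimately have "((\<lambda>s. (f (y s) - f 0 - f' (y s)) /\<^sub>R q s + f' (y s /\<^sub>R q s)) \<longlongrightarrow> 0 + f' y0) G"
    by (rule tendsto_add)
  then show ?thesis
    using bl by (simp add: linear_simps scaleR_diff_right)
qed

section \<open>Consequences of a swallowtail chart\<close>

locale swallowtail_chart = bjorling_point I lam \<alpha> \<beta> \<Omega> \<phi> X t0 t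
  for I lam \<alpha> \<beta> \<Omega> \<phi> X t0 t +
  fixes U :: "complex set" and V :: "(real ^ 2) set" and \<eta> \<eta>' and A B :: "(real ^ 3) set" and \<Psi> \<Psi>'
  assumes eta: "diffeomorphism U V \<eta> \<eta>'" "p \<in> U" "\<eta> p = 0"
    and psi: "diffeomorphism A B \<Psi> \<Psi>'" "X p \<in> A" "\<Psi> (X p) = 0"
    and chart: "\<forall>\<^sub>F w in nhds 0. X (\<eta>' w) \<in> A \<and> (\<Psi> \<circ> X \<circ> \<eta>') w = f_sw w"
begin

abbreviation "\<eta>D z \<equiv> frechet_derivative \<eta> (at z)"
abbreviation "\<Psi>D Y \<equiv> frechet_derivative \<Psi> (at Y)"

lemma eta'_0: "\<eta>' 0 = p" using diffeomorphism_mem(2)[OF eta(1,2)] eta(3) by simp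

lemma psi'_0: "\<Psi>' 0 = X p" using diffeomorphism_mem(2)[OF psi(1,2)] psi(3) by simp

lemma neighbourhood:
  obtains N where "open N" "p \<in> N" "N \<subseteq> U" "N \<subseteq> \<Omega>" "\<And>z. z \<in> N \<Longrightarrow> \<phi> z $ 3 \<noteq> 0"
    "\<And>z. z \<in> N \<Longrightarrow> X z \<in> A" "\<And>z. z \<in> N \<Longrightarrow> \<Psi> (X z) = f_sw (\<eta> z)"
proof -
  obtain W where W: "open W" "0 \<in> W" "\<And>w. w \<in> W \<Longrightarrow> X (\<eta>' w) \<in> A \<and> \<Psi> (X (\<eta>' w)) = f_sw w"
    using chart by (auto simp: eventually_nhds)
  have oU: "open U" and "continuous_on U \<eta>" using eta(1) by (auto simp: diffeomorphism_def homeomorphism_def)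
  then have o: "open (U \<inter> \<eta> -` W)" using W(1) by (intro continuous_open_preimage)
  show ?thesis
  proof
    show "open (U \<inter> \<eta> -` W \<inter> (\<Omega> \<inter> {z. \<phi> z $ 3 \<noteq> 0}))" by (intro open_Int o open_phi3)
    show "p \<in> U \<inter> \<eta> -` W \<inter> (\<Omega> \<inter> {z. \<phi> z $ 3 \<noteq> 0})"
      using eta W(2) p_in_Omega phi3_nonzero[OF t] by simp
    show "X z \<in> A" "\<Psi> (X z) = f_sw (\<eta> z)" if "z \<in> U \<inter> \<eta> -` W \<inter> (\<Omega> \<inter> {z. \<phi> z $ 3 \<noteq> 0})" for z
      using W(3)[of "\<eta> z"] diffeomorphism_mem(2)[OF eta(1), of z] that by auto
  qed auto
qed

text \<open>One neighbourhood is fixed for the whole context; on it the chart equation is available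
  at \<open>z\<close> instead of at \<open>w = \<eta> z\<close>.\<close>

definition "N = (SOME N. open N \<and> p \<in> N \<and> N \<subseteq> U \<and> N \<subseteq> \<Omega> \<and>
  (\<forall>z\<in>N. \<phi> z $ 3 \<noteq> 0 \<and> X z \<in> A \<and> \<Psi> (X z) = f_sw (\<eta> z)))"

lemma N: "open N" "p \<in> N" "z \<in> N \<Longrightarrow> z \<in> U" "z \<in> N \<Longrightarrow> z \<in> \<Omega>" "z \<in> N \<Longrightarrow> \<phi> z $ 3 \<noteq> 0"
  "z \<in> N \<Longrightarrow> X z \<in> A" "z \<in> N \<Longrightarrow> \<Psi> (X z) = f_sw (\<eta> z)"
proof -
  have "\<exists>N. open N \<and> p \<in> N \<and> N \<subseteq> U \<and> N \<subseteq> \<Omega> \<and>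
      (\<forall>z\<in>N. \<phi> z $ 3 \<noteq> 0 \<and> X z \<in> A \<and> \<Psi> (X z) = f_sw (\<eta> z))"
    by (rule neighbourhood) blast
  from someI_ex[OF this, folded N_def]
  show "open N" "p \<in> N" "z \<in> N \<Longrightarrow> z \<in> U" "z \<in> N \<Longrightarrow> z \<in> \<Omega>" "z \<in> N \<Longrightarrow> \<phi> z $ 3 \<noteq> 0"
    "z \<in> N \<Longrightarrow> X z \<in> A" "z \<in> N \<Longrightarrow> \<Psi> (X z) = f_sw (\<eta> z)" by blast+
qed

lemma chain_rule:
  assumes z: "z \<in> N"
  shows "\<Psi>D (X z) (\<chi> j. Re (\<phi> z $ j * v)) = f_sw' (\<eta> z) (\<eta>D z v)"
proof -
  have 1: "(\<Psi> \<circ> X has_derivative \<Psi>D (X z) \<circ> (\<lambda>v. \<chi> j. Re (\<phi> z $ j * v))) (at z)"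
    by (rule diff_chain_at[OF X_has_derivative[OF N(4)[OF z]] diffeomorphism_derivative[OF psi(1) N(6)[OF z]]])
  have "(f_sw \<circ> \<eta> has_derivative f_sw' (\<eta> z) \<circ> \<eta>D z) (at z)"
    by (rule diff_chain_at[OF diffeomorphism_derivative[OF eta(1) N(3)[OF z]] f_sw_has_derivative])
  then have 2: "(\<Psi> \<circ> X has_derivative f_sw' (\<eta> z) \<circ> \<eta>D z) (at z)"
    by (rule has_derivative_transform_within_open[OF _ N(1) z]) (simp add: N(7))
  show ?thesis using fun_cong[OF has_derivative_unique[OF 1 2], of v] by simp
qed

text \<open>On the trace of \<open>lam\<close> the direction \<open>i / \<phi>\<^sub>3\<close> spans the kernel of the differential of \<open>X\<close>.\<close>

lemma kernel_direction:
  assumes z: "z \<in> N"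
  shows "(\<chi> j. Re (\<phi> z $ j * (\<i> / \<phi> z $ 3))) = (vector [- Im (m 1 z), - Im (m 2 z), 0] :: real ^ 3)"
proof -
  have "\<phi> z $ j * (\<i> / \<phi> z $ 3) = \<i> * m j z" for j by (simp add: m_def)
  moreover have "m 3 z = 1" using N(5)[OF z] by (simp add: m_def)
  ultimately show ?thesis
    by (simp only: vec_eq_iff forall_3 vec_lambda_beta vector_3) simp
qed

text \<open>The image under \<open>\<eta>\<close> of the kernel direction is a nonzero vector killed
  by \<open>f_sw'\<close>. The third component makes this vector horizontal; the second then gives
  \<open>12 u^2 + 2 v = 0\<close>.\<close>

lemma singular_curve:
  assumes s: "s \<in> I" "lam s \<in> N"
  shows "\<eta> (lam s) $ 2 = - 6 * (\<eta> (lam s) $ 1)\<^sup>2"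
proof -
  let ?z = "lam s" and ?k = "\<eta>D (lam s) (\<i> / \<phi> (lam s) $ 3)"
  have "?k \<noteq> 0"
    using diffeomorphism_derivative_inj[OF eta(1) N(3)[OF s(2)]] N(5)[OF s(2)] by fastforce
  have "vector [- Im (m 1 ?z), - Im (m 2 ?z), 0] = (0 :: real ^ 3)"
    using m_real(1)[OF s(1)] by (simp add: vec_eq_iff forall_3)
  then have "f_sw' (\<eta> ?z) ?k = \<Psi>D (X ?z) 0"
    using chain_rule[OF s(2)] kernel_direction[OF s(2)] by metis
  also have "\<dots> = 0"
    using has_derivative_linear[OF diffeomorphism_derivative[OF psi(1) N(6)[OF s(2)]]] by (rule linear_0)
  finally have 0: "f_sw' (\<eta> ?z) ?k $ i = 0" for i by simp
  have k2: "?k $ 2 = 0" using 0[of 3] by (simp add: f_sw'_def)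
  have "(12 * (\<eta> ?z $ 1)\<^sup>2 + 2 * \<eta> ?z $ 2) * ?k $ 1 = 0"
    using 0[of 2] unfolding f_sw'_def vector_3 k2 by simp
  moreover have "?k $ 1 \<noteq> 0" using \<open>?k \<noteq> 0\<close> k2 by (simp add: vec_eq_iff forall_2)
  ultimately show ?thesis by auto
qed

lemma eventually_on_curve: "\<forall>\<^sub>F s in at t within I. s \<in> I \<and> lam s \<in> N"
proof -
  have "\<forall>\<^sub>F s in at t within I. s \<in> I" by (simp add: eventually_at_filter)
  then show ?thesis using topological_tendstoD[OF lam_continuous N(1,2)] by eventually_elim simp
qed

text \<open>On \<open>v = -6u^2\<close> the standard swallowtail equals
  \<open>(-3u^4, -8u^3, -6u^2)\<close>. The curve \<open>\<eta> \<circ> lam\<close> has nonzero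
  velocity, which is horizontal at the origin as the parabola is, so \<open>u\<close> grows linearly
  in \<open>s - t\<close> and the last entry is of exact order two. The quotient limit carries this
  over to \<open>X\<close> by the derivative of \<open>\<Psi>'\<close>.\<close>

lemma curve_quotient_limit:
  obtains Q where "Q \<noteq> 0" "((\<lambda>s. (X (lam s) - X p) /\<^sub>R (s - t)\<^sup>2) \<longlongrightarrow> Q) (at t within I)"
proof -
  define w where "w s = \<eta> (lam s)" for s
  define k where "k = \<eta>D p (l' t)"
  have "(\<eta> \<circ> lam has_derivative \<eta>D p \<circ> (\<lambda>x. x *\<^sub>R l' t)) (at t within I)"
    using curve_derivatives(1)[OF t] diffeomorphism_derivative[OF eta(1,2)]
    by (intro diff_chain_within) (auto simp: has_vector_derivative_def intro: has_derivative_at_withinI)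
  moreover have "linear (\<eta>D p)"
    using diffeomorphism_derivative[OF eta(1,2)] by (rule has_derivative_linear)
  ultimately have w': "(w has_vector_derivative k) (at t within I)"
    by (simp add: has_vector_derivative_def o_def w_def[abs_def] k_def linear_scale)
  have wt: "w t = 0" by (simp add: w_def eta)
  have wj: "((\<lambda>s. w s $ j) has_vector_derivative k $ j) (at t within I)" for j
    by (rule bounded_linear.has_vector_derivative[OF bounded_linear_vec_nth w'])
  have w2: "\<forall>\<^sub>F s in at t within I. w s $ 2 = - 6 * (w s $ 1)\<^sup>2"
    using eventually_on_curve by eventually_elim (simp add: w_def singular_curve)
  have "k $ 2 = 0"
  proof -
    have "((\<lambda>s. - 6 * (w s $ 1 * w s $ 1)) has_vector_derivative - 6 * (w t $ 1 * k $ 1 + k $ 1 * w t $ 1)) (at t within I)"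
      by (intro has_vector_derivative_mult_right has_vector_derivative_mult wj)
    then have "((\<lambda>s. w s $ 2) has_vector_derivative - 6 * (w t $ 1 * k $ 1 + k $ 1 * w t $ 1)) (at t within I)"
      unfolding has_vector_derivative_def
      by (rule has_derivative_transform_eventually)
        (use w2 t in \<open>auto simp: wt power2_eq_square elim: eventually_mono\<close>)
    from vector_derivative_unique_within[OF nontrivial wj this] show ?thesis by (simp add: wt)
  qed
  moreover have "k \<noteq> 0"
    using diffeomorphism_derivative_inj[OF eta(1,2)] l'_nonzero[OF t] by (auto simp: k_def)
  ultimately have k1: "k $ 1 \<noteq> 0" by (simp add: vec_eq_iff forall_2)
  define u where "u s = w s $ 1" for s
  have "((\<lambda>s. u s) \<longlongrightarrow> 0) (at t within I)"
    using has_vector_derivative_continuous[OF wj[of 1]] by (simp add: continuous_within wt u_def)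
  note u0 = this
  have uq: "((\<lambda>s. u s / (s - t)) \<longlongrightarrow> k $ 1) (at t within I)"
    using has_vector_derivative_imp_quotient[OF wj[of 1]] by (simp add: wt u_def divide_inverse mult.commute)
  define y where "y s = (vector [- 3 * u s ^ 4, - 8 * u s ^ 3, - 6 * u s ^ 2] :: real ^ 3)" for s
  define y0 where "y0 = (vector [0, 0, - 6 * (k $ 1)\<^sup>2] :: real ^ 3)"
  have y: "\<forall>\<^sub>F s in at t within I. X (lam s) = \<Psi>' (y s)"
    using eventually_on_curve
  proof eventually_elim
    case (elim s)
    then have "\<Psi> (X (lam s)) = f_sw (w s)" using N(7) by (simp add: w_def)
    also have "\<dots> = y s"
      using singular_curve[of s] elim
      by (simp add: vec_eq_iff forall_3 f_sw_nth y_def u_def w_def power2_eq_square power3_eq_cube power4_eq_xxxx)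
    finally show ?case using diffeomorphism_mem(2)[OF psi(1) N(6)] elim by metis
  qed
  have ylim: "(y \<longlongrightarrow> 0) (at t within I)"
  proof (rule vec_tendstoI)
    fix i :: 3
    have "((\<lambda>s. - 3 * u s ^ 4) \<longlongrightarrow> - 3 * 0 ^ 4) (at t within I)" "((\<lambda>s. - 8 * u s ^ 3) \<longlongrightarrow> - 8 * 0 ^ 3) (at t within I)"
      "((\<lambda>s. - 6 * u s ^ 2) \<longlongrightarrow> - 6 * 0 ^ 2) (at t within I)"
      by (intro tendsto_intros u0)+
    then show "((\<lambda>s. y s $ i) \<longlongrightarrow> 0 $ i) (at t within I)"
      using exhaust_3[of i] by (auto simp: y_def)
  qed
  have yq: "((\<lambda>s. y s /\<^sub>R (s - t)\<^sup>2) \<longlongrightarrow> y0) (at t within I)"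
  proof (rule vec_tendstoI)
    fix i :: 3
    have "((\<lambda>s. - 3 * (u s / (s - t))\<^sup>2 * (u s)\<^sup>2) \<longlongrightarrow> - 3 * (k $ 1)\<^sup>2 * 0\<^sup>2) (at t within I)"
      "((\<lambda>s. - 8 * (u s / (s - t))\<^sup>2 * u s) \<longlongrightarrow> - 8 * (k $ 1)\<^sup>2 * 0) (at t within I)"
      "((\<lambda>s. - 6 * (u s / (s - t))\<^sup>2) \<longlongrightarrow> - 6 * (k $ 1)\<^sup>2) (at t within I)"
      by (intro tendsto_intros u0 uq)+
    then show "((\<lambda>s. (y s /\<^sub>R (s - t)\<^sup>2) $ i) \<longlongrightarrow> y0 $ i) (at t within I)"
      using exhaust_3[of i]
      by (auto simp: y_def y0_def divide_inverse power2_eq_square power3_eq_cube power4_eq_xxxx mult_ac)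
  qed
  let ?L = "frechet_derivative \<Psi>' (at 0)"
  have 0: "0 \<in> B" using diffeomorphism_mem(1)[OF psi(1,2)] psi(3) by simp
  have "((\<lambda>s. (\<Psi>' (y s) - \<Psi>' 0) /\<^sub>R (s - t)\<^sup>2) \<longlongrightarrow> ?L y0) (at t within I)"
    by (rule has_derivative_quotient_limit[OF diffeomorphism_derivative[OF diffeomorphism_sym[OF psi(1)] 0] ylim yq])
  then have "((\<lambda>s. (X (lam s) - X p) /\<^sub>R (s - t)\<^sup>2) \<longlongrightarrow> ?L y0) (at t within I)"
    by (rule Lim_transform_eventually) (use y in \<open>auto simp: psi'_0 elim: eventually_mono\<close>)
  moreover have "?L y0 \<noteq> 0"
  proof
    assume "?L y0 = 0"
    then have "y0 = 0" by (rule diffeomorphism_derivative_inj[OF diffeomorphism_sym[OF psi(1)] 0])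
    then show False using k1 by (simp add: y0_def vec_eq_iff forall_3)
  qed
  ultimately show ?thesis using that by blast
qed

lemma X_lam_has_derivative:
  assumes "s \<in> I"
  shows "((\<lambda>s. X (lam s)) has_vector_derivative
    Re (h s) *\<^sub>R vector [Re (m 1 (lam s)), Re (m 2 (lam s)), 1]) (at s within I)"
proof -
  have "(X \<circ> lam has_derivative (\<lambda>v. \<chi> j. Re (\<phi> (lam s) $ j * v)) \<circ> (\<lambda>x. x *\<^sub>R l' s)) (at s within I)"
    using curve_derivatives(1)[OF assms] X_has_derivative[OF Omega(3)[OF assms]]
    by (intro diff_chain_within) (auto simp: has_vector_derivative_def intro: has_derivative_at_withinI)
  moreover have E: "(\<chi> j. Re (\<phi> (lam s) $ j * (x *\<^sub>R l' s)))
      = x *\<^sub>R Re (h s) *\<^sub>R (vector [Re (m 1 (lam s)), Re (m 2 (lam s)), 1] :: real ^ 3)" for x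
  proof -
    have "\<phi> (lam s) $ j * l' s = of_real (Re (m j (lam s))) * h s" if "j = 1 \<or> j = 2" for j
      using m_real(1)[OF assms that] phi3_nonzero[OF assms]
      by (simp add: h_def m_def complex_is_Real_iff[symmetric] of_real_Re)
    then have "Re (\<phi> (lam s) $ j * l' s) = Re (m j (lam s)) * Re (h s)" if "j = 1 \<or> j = 2" for j
      using that by (metis Re_complex_of_real Im_complex_of_real times_complex.sel(1) mult_zero_left diff_zero)
    from this[of 1] this[of 2]
    have "Re (\<phi> (lam s) $ 1 * l' s) = Re (m 1 (lam s)) * Re (h s)"
      "Re (\<phi> (lam s) $ 2 * l' s) = Re (m 2 (lam s)) * Re (h s)"
      "Re (\<phi> (lam s) $ 3 * l' s) = Re (h s)" by (simp_all add: h_def)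
    moreover have "Re (\<phi> (lam s) $ j * (x *\<^sub>R l' s)) = x * Re (\<phi> (lam s) $ j * l' s)" for j
      by (simp add: algebra_simps)
    ultimately show ?thesis
      by (simp only: vec_eq_iff forall_3 vec_lambda_beta vector_3 vector_scaleR_component) simp
  qed
  ultimately show ?thesis unfolding has_vector_derivative_def o_def E by simp
qed

lemma velocity_vanishes: "Re (h t) = 0"
proof -
  obtain Q where Q: "((\<lambda>s. (X (lam s) - X p) /\<^sub>R (s - t)\<^sup>2) \<longlongrightarrow> Q) (at t within I)"
    using curve_quotient_limit by blast
  have "((\<lambda>s. s - t) \<longlongrightarrow> t - t) (at t within I)" by (intro tendsto_intros)
  then have "((\<lambda>s. (s - t) *\<^sub>R ((X (lam s) - X p) /\<^sub>R (s - t)\<^sup>2)) \<longlongrightarrow> 0) (at t within I)"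
    using tendsto_scaleR[OF _ Q] by fastforce
  then have "((\<lambda>s. (X (lam s) - X p) /\<^sub>R (s - t)) \<longlongrightarrow> 0) (at t within I)"
    by (rule Lim_transform_eventually) (auto simp: eventually_at_filter power2_eq_square)
  from tendsto_unique[OF nontrivial has_vector_derivative_imp_quotient[OF X_lam_has_derivative[OF t]] this]
  show ?thesis by (simp add: vec_eq_iff forall_3)
qed

text \<open>If \<open>Re h'\<close> were 0, the velocity of \<open>X \<circ> lam\<close> would be
  \<open>o(s - t)\<close>, because the vector it multiplies is bounded. The mean value inequality
  would make the increment \<open>o((s - t)^2)\<close>, against \<open>Q \<noteq> 0\<close>.\<close>

lemma acceleration_nonzero: "Re h' \<noteq> 0"
proof
  assume "Re h' = 0"
  obtain Q where Q: "Q \<noteq> 0" "((\<lambda>s. (X (lam s) - X p) /\<^sub>R (s - t)\<^sup>2) \<longlongrightarrow> Q) (at t within I)"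
    using curve_quotient_limit by blast
  have "((\<lambda>s. Re (h s)) has_vector_derivative 0) (at t within I)"
    using bounded_linear.has_vector_derivative[OF bounded_linear_Re h_has_derivative] \<open>Re h' = 0\<close> by simp
  from has_vector_derivative_imp_quotient[OF this]
  have lim: "((\<lambda>s. Re (h s) / (s - t)) \<longlongrightarrow> 0) (at t within I)"
    by (simp add: velocity_vanishes divide_inverse mult.commute)
  have "((\<lambda>s. (X (lam s) - X p) /\<^sub>R (s - t)\<^sup>2) \<longlongrightarrow> 0) (at t within I)"
  proof (rule tendstoI)
    fix e :: real assume e: "0 < e"
    \<comment> \<open>The vector \<open>(m 1, m 2, 1)\<close> has norm at most 2 on the trace, so
      \<open>e / 4\<close> here becomes \<open>e / 2\<close> in the mean value inequality.\<close>
    have "\<forall>\<^sub>F s in at t within I. dist (Re (h s) / (s - t)) 0 < e / 4"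
      using e by (intro tendstoD[OF lim]) simp
    then obtain d where d: "0 < d" "\<And>s. s \<in> I \<Longrightarrow> s \<noteq> t \<Longrightarrow> dist s t < d \<Longrightarrow> dist (Re (h s) / (s - t)) 0 < e / 4"
      unfolding eventually_at by blast
    have h: "\<bar>Re (h s)\<bar> \<le> e / 4 * \<bar>s - t\<bar>" if "s \<in> I" "dist s t < d" for s
      using d(2)[OF that(1) _ that(2)] velocity_vanishes
      by (cases "s = t") (auto simp: field_simps dist_real_def abs_divide)
    have "dist ((X (lam s) - X p) /\<^sub>R (s - t)\<^sup>2) 0 < e" if s: "s \<in> I" "s \<noteq> t" "dist s t < d" for s
    proof -
      let ?D = "\<lambda>x. Re (h x) *\<^sub>R (vector [Re (m 1 (lam x)), Re (m 2 (lam x)), 1] :: real ^ 3)"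
      have seg: "closed_segment t s \<subseteq> I"
      proof (rule closed_segment_subset[OF t s(1)])
        show "convex I" using data by (simp add: singular_bjorling_data_def is_interval_convex_1)
      qed
      have "norm ((X (lam s)) - X (lam t)) \<le> (e / 2 * \<bar>s - t\<bar>) * norm (s - t)"
      proof (rule differentiable_bound[OF convex_closed_segment])
        fix x assume x: "x \<in> closed_segment t s"
        then have xI: "x \<in> I" and xt: "\<bar>x - t\<bar> \<le> \<bar>s - t\<bar>"
          using seg segment_bound1[of x t s] by auto
        show "((\<lambda>x. X (lam x)) has_derivative (\<lambda>k. k *\<^sub>R ?D x)) (at x within closed_segment t s)"
          using X_lam_has_derivative[OF xI] seg
          by (auto simp: has_vector_derivative_def intro: has_derivative_subset)
        have "norm (vector [Re (m 1 (lam x)), Re (m 2 (lam x)), 1] :: real ^ 3) \<le> 2"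
          using m_unit_lam[OF xI] by (simp add: norm_vec_def L2_set_def sum_3 real_le_lsqrt)
        then have "norm (?D x) \<le> \<bar>Re (h x)\<bar> * 2" by (simp add: mult_left_mono)
        also have "\<dots> \<le> (e / 4 * \<bar>x - t\<bar>) * 2"
          using h[OF xI] xt s(3) by (intro mult_right_mono) (auto simp: dist_real_def)
        also have "\<dots> \<le> e / 2 * \<bar>s - t\<bar>" using xt e by simp
        finally have D: "norm (?D x) \<le> e / 2 * \<bar>s - t\<bar>" .
        show "onorm (\<lambda>k. k *\<^sub>R ?D x) \<le> e / 2 * \<bar>s - t\<bar>"
        proof (rule onorm_le)
          show "norm (k *\<^sub>R ?D x) \<le> e / 2 * \<bar>s - t\<bar> * norm k" for k
            unfolding norm_scaleR[of k] real_norm_def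
            by (subst mult.commute[of _ "\<bar>k\<bar>"]) (rule mult_left_mono[OF D abs_ge_zero])
        qed
      qed auto
      then have "norm (X (lam s) - X p) \<le> e / 2 * (s - t)\<^sup>2"
        by (simp add: power2_eq_square mult.assoc)
      moreover have "0 < (s - t)\<^sup>2" using s(2) by simp
      ultimately have "norm (X (lam s) - X p) / (s - t)\<^sup>2 \<le> e / 2" by (simp add: divide_le_eq)
      moreover have "dist ((X (lam s) - X p) /\<^sub>R (s - t)\<^sup>2) 0 = inverse ((s - t)\<^sup>2) * norm (X (lam s) - X p)"
        by simp
      then have "dist ((X (lam s) - X p) /\<^sub>R (s - t)\<^sup>2) 0 = norm (X (lam s) - X p) / (s - t)\<^sup>2"
        by (metis divide_inverse mult.commute)
      ultimately show ?thesis using e by linarith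
    qed
    then show "\<forall>\<^sub>F s in at t within I. dist ((X (lam s) - X p) /\<^sub>R (s - t)\<^sup>2) 0 < e"
      using d(1) unfolding eventually_at by blast
  qed
  from tendsto_unique[OF nontrivial Q(2) this] show False using Q(1) by simp
qed

text \<open>At \<open>(0, \<tau>)\<close> the derivative \<open>f_sw'\<close> sends \<open>k\<close>
  to \<open>(0, 2 \<tau> k1, k2)\<close>. The differential of \<open>X\<close> sends the direction
  \<open>i / \<phi>\<^sub>3\<close> to a vector made of \<open>Im m\<close>, which would be
  \<open>o(\<tau>)\<close> if \<open>m\<close> had zero derivative. Division by
  \<open>\<tau>\<close> would then drive the image \<open>q \<tau>\<close> of that direction under
  \<open>\<eta>D\<close> to 0, although its limit is the image of a nonzero vector at
  \<open>p\<close>.\<close>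

lemma gauss_map_regular: "deriv (m 1) p \<noteq> 0 \<or> deriv (m 2) p \<noteq> 0"
proof (rule ccontr)
  assume "\<not> ?thesis"
  then have m': "deriv (m j) p = 0" if "j = 1 \<or> j = 2" for j using that by auto
  define w where "w \<tau> = (vector [0, \<tau>] :: real ^ 2)" for \<tau>
  define z where "z \<tau> = \<eta>' (w \<tau>)" for \<tau>
  define v where "v \<tau> = \<i> / \<phi> (z \<tau>) $ 3" for \<tau>
  define q where "q \<tau> = \<eta>D (z \<tau>) (v \<tau>)" for \<tau>
  have V0: "0 \<in> V" using diffeomorphism_mem(1)[OF eta(1,2)] eta(3) by simp
  have w0: "w 0 = 0" by (simp add: w_def vec_eq_iff forall_2)
  have z0: "z 0 = p" by (simp add: z_def w0 eta'_0)
  have "linear w" by (rule linearI) (simp_all add: w_def vec_eq_iff forall_2)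
  then have wD: "(w has_derivative w) (at 0)"
    by (intro bounded_linear_imp_has_derivative) (simp add: linear_conv_bounded_linear)
  let ?g = "frechet_derivative \<eta>' (at 0)"
  have g: "(\<eta>' has_derivative ?g) (at 0)"
    by (rule diffeomorphism_derivative[OF diffeomorphism_sym[OF eta(1)] V0])
  have "(\<eta>' \<circ> w has_derivative ?g \<circ> w) (at 0)"
    using g by (intro diff_chain_at[OF wD]) (simp add: w0)
  then have zD: "(z has_derivative (\<lambda>x. ?g (w x))) (at 0)" by (simp add: z_def[abs_def] o_def)
  have zlim: "(z \<longlongrightarrow> p) (at 0)"
    using has_derivative_continuous[OF zD] by (simp add: isCont_def z0)
  have zN: "\<forall>\<^sub>F \<tau> in at 0. z \<tau> \<in> N" using topological_tendstoD[OF zlim N(1,2)] .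
  have wV: "\<forall>\<^sub>F \<tau> in at 0. w \<tau> \<in> V"
  proof -
    have "(w \<longlongrightarrow> 0) (at 0)" using has_derivative_continuous[OF wD] by (simp add: isCont_def w0)
    then show ?thesis using eta(1) V0 by (intro topological_tendstoD) (auto simp: diffeomorphism_def)
  qed
  have mlim: "((\<lambda>\<tau>. Im (m j (z \<tau>)) / \<tau>) \<longlongrightarrow> 0) (at 0)" if j: "j = 1 \<or> j = 2" for j
  proof -
    have "(m j has_derivative (*) 0) (at (z 0))"
      using m_deriv[of j] m'[OF j] by (simp add: has_field_derivative_def z0)
    from diff_chain_at[OF zD this] have "((\<lambda>\<tau>. m j (z \<tau>)) has_derivative (\<lambda>x. 0)) (at 0)"
      by (simp add: o_def)
    then have "((\<lambda>\<tau>. Im (m j (z \<tau>))) has_derivative (\<lambda>x. 0)) (at 0)"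
      using bounded_linear.has_derivative[OF bounded_linear_Im] by fastforce
    then have "((\<lambda>\<tau>. Im (m j (z \<tau>))) has_vector_derivative 0) (at 0)"
      by (simp add: has_vector_derivative_def)
    from has_vector_derivative_imp_quotient[OF this] m_real(1)[OF t j] show ?thesis
      by (simp add: z0 divide_inverse mult.commute)
  qed
  have Xlim: "((\<lambda>\<tau>. X (z \<tau>)) \<longlongrightarrow> X p) (at 0)"
    using isCont_tendsto_compose[OF has_derivative_continuous[OF X_has_derivative[OF p_in_Omega]] zlim] .
  have PsiD: "((\<lambda>\<tau>. \<Psi>D (X (z \<tau>)) b) \<longlongrightarrow> \<Psi>D (X p) b) (at 0)" for b
    using isCont_tendsto_compose[OF diffeomorphism_continuous_derivative[OF psi(1,2)] Xlim] .
  \<comment> \<open>The image of the kernel direction in the target, divided by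
    \<open>\<tau>\<close>. It is split along the axes because \<open>\<Psi>D\<close> is known to be
    continuous for fixed directions.\<close>
  define R where "R \<tau> = (- (Im (m 1 (z \<tau>)) / \<tau>)) *\<^sub>R \<Psi>D (X (z \<tau>)) (axis 1 1)
    + (- (Im (m 2 (z \<tau>)) / \<tau>)) *\<^sub>R \<Psi>D (X (z \<tau>)) (axis 2 1)" for \<tau>
  have "(R \<longlongrightarrow> (- 0) *\<^sub>R \<Psi>D (X p) (axis 1 1) + (- 0) *\<^sub>R \<Psi>D (X p) (axis 2 1)) (at 0)"
    unfolding R_def[abs_def] by (intro tendsto_intros mlim PsiD) auto
  then have Rlim: "(R \<longlongrightarrow> 0) (at 0)" by simp
  have R: "\<forall>\<^sub>F \<tau> in at 0. R \<tau> = vector [0, 2 * q \<tau> $ 1, q \<tau> $ 2 / \<tau>]"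
    using zN wV eventually_at_filter[of "\<lambda>\<tau>. \<tau> \<noteq> 0" 0 UNIV]
  proof -
    have "\<forall>\<^sub>F \<tau> in at 0. \<tau> \<noteq> (0::real)" by (simp add: eventually_at_filter)
    with zN wV show ?thesis
    proof eventually_elim
      case (elim \<tau>)
      have ez: "\<eta> (z \<tau>) = w \<tau>"
        using diffeomorphism_mem(2)[OF diffeomorphism_sym[OF eta(1)] elim(2)] by (simp add: z_def)
      have lin: "linear (\<Psi>D (X (z \<tau>)))"
        using diffeomorphism_derivative[OF psi(1) N(6)[OF elim(1)]] by (rule has_derivative_linear)
      have "vector [- Im (m 1 (z \<tau>)), - Im (m 2 (z \<tau>)), 0]
          = (- Im (m 1 (z \<tau>))) *\<^sub>R axis 1 1 + (- Im (m 2 (z \<tau>))) *\<^sub>R (axis 2 1 :: real ^ 3)"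
        by (simp add: vec_eq_iff forall_3 axis_def)
      then have "\<Psi>D (X (z \<tau>)) (vector [- Im (m 1 (z \<tau>)), - Im (m 2 (z \<tau>)), 0])
          = (- Im (m 1 (z \<tau>))) *\<^sub>R \<Psi>D (X (z \<tau>)) (axis 1 1) + (- Im (m 2 (z \<tau>))) *\<^sub>R \<Psi>D (X (z \<tau>)) (axis 2 1)"
        using lin by (simp only: linear_add linear_scale)
      also have "\<Psi>D (X (z \<tau>)) (vector [- Im (m 1 (z \<tau>)), - Im (m 2 (z \<tau>)), 0]) = f_sw' (w \<tau>) (q \<tau>)"
        using chain_rule[OF elim(1), of "v \<tau>"] kernel_direction[OF elim(1)] by (simp add: ez q_def v_def)
      also have "\<dots> = vector [0, 2 * \<tau> * q \<tau> $ 1, q \<tau> $ 2]"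
        by (simp add: f_sw'_def w_def)
      finally have "inverse \<tau> *\<^sub>R (vector [0, 2 * \<tau> * q \<tau> $ 1, q \<tau> $ 2] :: real ^ 3) = R \<tau>"
        by (simp add: R_def scaleR_diff_right divide_inverse mult.commute)
      then show "R \<tau> = vector [0, 2 * q \<tau> $ 1, q \<tau> $ 2 / \<tau>]"
        using elim(3) by (simp add: vec_eq_iff forall_3 field_simps) 
    qed
  qed
  have Rj: "((\<lambda>\<tau>. R \<tau> $ j) \<longlongrightarrow> 0) (at 0)" for j
    using tendsto_vec_nth[OF Rlim, of j] by simp
  have "((\<lambda>\<tau>. R \<tau> $ 2 / 2) \<longlongrightarrow> 0 / 2) (at 0)" by (intro tendsto_intros Rj) simp
  then have "((\<lambda>\<tau>. q \<tau> $ 1) \<longlongrightarrow> 0) (at 0)"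
    unfolding div_0 by (rule Lim_transform_eventually) (use R in \<open>auto elim: eventually_mono\<close>)
  moreover have "((\<lambda>\<tau>. q \<tau> $ 2) \<longlongrightarrow> 0) (at 0)"
  proof -
    have "((\<lambda>\<tau>. R \<tau> $ 3 * \<tau>) \<longlongrightarrow> 0 * 0) (at 0)" by (intro tendsto_intros Rj)
    then have "((\<lambda>\<tau>. R \<tau> $ 3 * \<tau>) \<longlongrightarrow> 0) (at 0)" by (simp only: mult_zero_left)
    moreover have "\<forall>\<^sub>F \<tau> in at 0. \<tau> \<noteq> (0::real)" by (simp add: eventually_at_filter)
    with R have "\<forall>\<^sub>F \<tau> in at 0. R \<tau> $ 3 * \<tau> = q \<tau> $ 2" by eventually_elim simp
    ultimately show ?thesis by (rule Lim_transform_eventually)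
  qed
  ultimately have "((\<lambda>\<tau>. q \<tau> $ i) \<longlongrightarrow> 0 $ i) (at 0)" for i
    using exhaust_2[of i] by auto
  then have q0: "(q \<longlongrightarrow> 0) (at 0)" by (rule vec_tendstoI)
  let ?v = "\<i> / \<phi> p $ 3"
  have "((\<lambda>\<tau>. \<phi> (z \<tau>) $ 3) \<longlongrightarrow> \<phi> p $ 3) (at 0)"
    using holomorphic_on_imp_continuous_on[OF phi_holomorphic] p_in_Omega Omega(1)
    by (intro isCont_tendsto_compose[OF _ zlim]) (auto simp: continuous_on_eq_continuous_at)
  then have vlim: "(v \<longlongrightarrow> ?v) (at 0)"
    unfolding v_def[abs_def] by (intro tendsto_divide tendsto_const phi3_nonzero[OF t])
  have etaD: "((\<lambda>\<tau>. \<eta>D (z \<tau>) b) \<longlongrightarrow> \<eta>D p b) (at 0)" for b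
    using isCont_tendsto_compose[OF diffeomorphism_continuous_derivative[OF eta(1,2)] zlim] .
  \<comment> \<open>The direction \<open>v \<tau>\<close> moves with \<open>\<tau>\<close>, so it
    too is resolved into the fixed directions \<open>1\<close> and \<open>\<i>\<close>.\<close>
  have lin: "\<eta>D x b = Re b *\<^sub>R \<eta>D x 1 + Im b *\<^sub>R \<eta>D x \<i>" if "x \<in> U" for x b
  proof -
    have "linear (\<eta>D x)" using diffeomorphism_derivative[OF eta(1) that] by (rule has_derivative_linear)
    then have "\<eta>D x (Re b *\<^sub>R 1 + Im b *\<^sub>R \<i>) = Re b *\<^sub>R \<eta>D x 1 + Im b *\<^sub>R \<eta>D x \<i>"
      by (simp only: linear_add linear_scale)
    moreover have "Re b *\<^sub>R 1 + Im b *\<^sub>R \<i> = b" by (simp add: complex_eq_iff)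
    ultimately show ?thesis by simp
  qed
  have "((\<lambda>\<tau>. Re (v \<tau>) *\<^sub>R \<eta>D (z \<tau>) 1 + Im (v \<tau>) *\<^sub>R \<eta>D (z \<tau>) \<i>) \<longlongrightarrow> Re ?v *\<^sub>R \<eta>D p 1 + Im ?v *\<^sub>R \<eta>D p \<i>) (at 0)"
    by (intro tendsto_intros vlim etaD)
  moreover have "\<forall>\<^sub>F \<tau> in at 0. Re (v \<tau>) *\<^sub>R \<eta>D (z \<tau>) 1 + Im (v \<tau>) *\<^sub>R \<eta>D (z \<tau>) \<i> = q \<tau>"
    using zN
  proof eventually_elim
    case (elim \<tau>)
    show ?case unfolding q_def by (rule lin[OF N(3)[OF elim], symmetric])
  qed
  ultimately have "(q \<longlongrightarrow> Re ?v *\<^sub>R \<eta>D p 1 + Im ?v *\<^sub>R \<eta>D p \<i>) (at 0)"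
    by (rule Lim_transform_eventually)
  then have "(q \<longlongrightarrow> \<eta>D p ?v) (at 0)" unfolding lin[OF eta(2), of ?v] .
  from tendsto_unique[OF _ this q0] have "\<eta>D p ?v = 0" by simp
  then show False
    using diffeomorphism_derivative_inj[OF eta(1,2)] phi3_nonzero[OF t] by fastforce
qed

end

theorem proposition3p2:
  fixes I :: "real set" and lam :: "real \<Rightarrow> complex" and \<alpha> \<beta> :: "real \<Rightarrow> real ^ 3"
    and \<Omega> U :: "complex set" and \<phi> :: "complex \<Rightarrow> complex ^ 3"
    and X :: "complex \<Rightarrow> real ^ 3" and t0 t :: real
  assumes "singular_bjorling_data I lam \<alpha> \<beta>"
    and "bjorling_solution I lam \<alpha> \<beta> \<Omega> \<phi> t0 X"
    and "lam ` I \<subseteq> U" and "U \<subseteq> \<Omega>" and "maxface_on U X"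
    and "t \<in> I"
  shows "has_swallowtail X (lam t) \<longleftrightarrow>
    (let lam' = curve_deriv I lam t; lam'' = (curve_deriv I ^^ 2) lam t;
         \<alpha>' = curve_deriv I \<alpha> t; \<alpha>'' = (curve_deriv I ^^ 2) \<alpha> t;
         b = \<beta> t; b' = curve_deriv I \<beta> t
     in \<alpha>' $ 3 * Re lam' + b $ 3 * Im lam' = 0 \<and>
        Re lam'' * \<alpha>' $ 3 + Re lam' * \<alpha>'' $ 3 + Im lam' * b' $ 3 + Im lam'' * b $ 3 \<noteq> 0 \<and>
        (\<alpha>' \<noteq> 0 \<longrightarrow> \<alpha>' $ 1 * \<alpha>'' $ 2 - \<alpha>' $ 2 * \<alpha>'' $ 1 \<noteq> 0) \<and>
        (b \<noteq> 0 \<longrightarrow> b $ 1 * b' $ 2 - b $ 2 * b' $ 1 \<noteq> 0))"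
proof -
  interpret bjorling_point I lam \<alpha> \<beta> \<Omega> \<phi> X t0 t
    using assms(1,2,6) by unfold_locales
  have "has_swallowtail X (lam t) \<longleftrightarrow>
    Re (h t) = 0 \<and> Re h' \<noteq> 0 \<and> (deriv (m 1) (lam t) \<noteq> 0 \<or> deriv (m 2) (lam t) \<noteq> 0)"
  proof
    assume "has_swallowtail X (lam t)"
    then obtain U V \<eta> \<eta>' A B \<Psi> \<Psi>' where "swallowtail_chart I lam \<alpha> \<beta> \<Omega> \<phi> X t0 t U V \<eta> \<eta>' A B \<Psi> \<Psi>'"
      unfolding has_swallowtail_def swallowtail_chart_def swallowtail_chart_axioms_def
      using bjorling_point_axioms by blast
    then interpret swallowtail_chart I lam \<alpha> \<beta> \<Omega> \<phi> X t0 t U V \<eta> \<eta>' A B \<Psi> \<Psi>' .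
    show "Re (h t) = 0 \<and> Re h' \<noteq> 0 \<and> (deriv (m 1) (lam t) \<noteq> 0 \<or> deriv (m 2) (lam t) \<noteq> 0)"
      using velocity_vanishes acceleration_nonzero gauss_map_regular by blast
  qed (use swallowtail_if in blast)
  then show ?thesis
    unfolding Let_def nondegenerate_iff[symmetric] Re_h Re_h' a_def l'_def l''_def a'_def b'_def by blast
qed

end
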